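(* Let $R$ be a field of characteristic $0$ and let $f\colon A\to B$ be a map in the category $\mathbf{Ch}(R)$ of non-negatively graded chain complexes over $R$. (1) Suppose that $f$ is an injective quasi-isomorphism. Then for any HTCFT structure on $A$ there is an HTCFT structure on $B$ such that $f$ is a morphism of HTCFTs. (2) Suppose that $f$ is a surjective quasi-isomorphism. Then for any HTCFT structure on $B$ there is an HTCFT structure on $A$ such that $f$ is a morphism of HTCFTs.
   Context: **($1$-colored) PROPs without units.** A PROP $\mathsf{P}$ over a symmetric monoidal category consists of objects $\mathsf{P}(m,n)$, $m,n\ge1$ ($n$ inputs, $m$ outputs), with commuting left $\Sigma_m$- and right $\Sigma_n$-actions, associative vertical compositions $\circ\colon\mathsf{P}(m,n)\otimes\mathsf{P}(n,k)\to\mathsf{P}(m,k)$ that are $\Sigma_m$-$\Sigma_k$-equivariant and balanced over $\Sigma_n$, and associative horizontal compositions $\otimes\colon\mathsf{P}(m_1,n_1)\otimes\mathsf{P}(m_2,n_2)\to\mathsf{P}(m_1+m_2,n_1+n_2)$ that are $(\Sigma_{m_1}\times\Sigma_{m_2})$-$(\Sigma_{n_1}\times\Sigma_{n_2})$-equivariant, satisfying the interchange rule $(x_1\otimes x_2)\circ(y_1\otimes y_2)=(x_1\circ y_1)\otimes(x_2\circ y_2)$ (with the symmetry of the monoidal category inserted). Morphisms preserve all the structure. For a chain complex $A$, the endomorphism PROP $E_A$ has $E_A(m,n)=\operatorname{Hom}(A^{\otimes n},A^{\otimes m})$ (internal hom). A $\mathsf{P}$-algebra structure on $A$ is a PROP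 morphism $\mathsf{P}\to E_A$, i.e. a suitable family of chain maps $\lambda\colon\mathsf{P}(m,n)\otimes A^{\otimes n}\to A^{\otimes m}$; a morphism of $\mathsf{P}$-algebras is a chain map $f\colon A\to B$ with $f^{\otimes m}\lambda=\lambda(\mathrm{Id}\otimes f^{\otimes n})$. **Model structures.** $\mathbf{Ch}(R)$ has weak equivalences the quasi-isomorphisms, fibrations the maps surjective in positive degrees, cofibrations the degreewise injections. The category of PROPs over $\mathbf{Ch}(R)$ has the cofibrantly generated model structure with fibrations and weak equivalences defined entrywise. **Segal PROP and HTCFTs.** For $m,n\ge1$ let $\mathsf{Se}(m,n)$ be the moduli space of isomorphism classes of (not necessarily connected, arbitrary genus) complex Riemann surfaces with $m+n$ labeled, mutually non-overlapping holomorphic holes (biholomorphic maps from closed unit disks to the surface), the first $m$ being outputs and the last $n$ inputs. These form the topological Segal PROP $\mathsf{Se}$: horizontal composition is disjoint union; vertical composition $M\circ N$ is holomorphic sewing of the output holes of $N$ to the input holes of $M$; symmetric groups permute labels. Let $\mathbf{Se}=C_*(\mathsf{Se})$ be the PROP over $\mathbf{Ch}(R)$ obtained by applying singular chains with coefficients in $R$, and let $\mathbf{Se}_\infty\to\mathbf{Se}$ be the acyclic fibration from its functorial cofibrant replacement given by Quillen's small object argument in the model category of PROPs over $\mathbf{Ch}(R)$. A *homotopy topological conformal field theory* (HTCFT) is an $\mathbf{Se}_\infty$-algebra in $\mathbf{Ch}(R)$; morphisms of HTCFTs are morphisms of $\mathbf{Se}_\infty$-algebras. *)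

theory Defs
  imports "HOL-Analysis.Analysis" "HOL-Homology.Homology" "HOL-Algebra.Module" "HOL-Combinatorics.Permutations"
begin

section \<open>Modules\<close>

definition lin_maps :: "'r ring \<Rightarrow> ('r, 'a) module \<Rightarrow> ('r, 'b) module \<Rightarrow> ('a \<Rightarrow> 'b) set" where
  "lin_maps R M N = {h \<in> carrier M \<rightarrow> carrier N.
     (\<forall>x\<in>carrier M. \<forall>y\<in>carrier M. h (x \<oplus>\<^bsub>M\<^esub> y) = h x \<oplus>\<^bsub>N\<^esub> h y) \<and>
     (\<forall>r\<in>carrier R. \<forall>x\<in>carrier M. h (r \<odot>\<^bsub>M\<^esub> x) = r \<odot>\<^bsub>N\<^esub> h x)}"

text \<open>The Koszul sign: \<open>ksgn M i x\<close> is \<open>(-1)^i x\<close> in \<open>M\<close>.\<close>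

definition ksgn :: "('r, 'a) module \<Rightarrow> int \<Rightarrow> 'a \<Rightarrow> 'a" where
  "ksgn M i x = (if even i then x else \<ominus>\<^bsub>M\<^esub> x)"

text \<open>In the module records below the ring fields \<open>mult\<close> and \<open>one\<close>, which a module does not use,
  are left undefined.\<close>

definition free_module :: "'r ring \<Rightarrow> 's set \<Rightarrow> ('r, 's \<Rightarrow> 'r) module" where
  "free_module R S = \<lparr>carrier = {c. (\<forall>s. c s \<in> carrier R) \<and> (\<forall>s. s \<notin> S \<longrightarrow> c s = \<zero>\<^bsub>R\<^esub>)
                                   \<and> finite {s. c s \<noteq> \<zero>\<^bsub>R\<^esub>}},
     monoid.mult = undefined, one = undefined,
     zero = (\<lambda>s. \<zero>\<^bsub>R\<^esub>), add = (\<lambda>c c' s. c s \<oplus>\<^bsub>R\<^esub> c' s), smult = (\<lambda>r c s. r \<otimes>\<^bsub>R\<^esub> c s)\<rparr>"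

definition free_gen :: "'r ring \<Rightarrow> 's \<Rightarrow> 's \<Rightarrow> 'r" where
  "free_gen R s = (\<lambda>t. if t = s then \<one>\<^bsub>R\<^esub> else \<zero>\<^bsub>R\<^esub>)"

definition lin_ext :: "'r ring \<Rightarrow> ('r, 'a) module \<Rightarrow> ('s \<Rightarrow> 'a) \<Rightarrow> ('s \<Rightarrow> 'r) \<Rightarrow> 'a" where
  "lin_ext R M g c = (\<Oplus>\<^bsub>M\<^esub>s\<in>{s. c s \<noteq> \<zero>\<^bsub>R\<^esub>}. c s \<odot>\<^bsub>M\<^esub> g s)"

definition submodule_gen :: "'r ring \<Rightarrow> ('r, 'a) module \<Rightarrow> 'a set \<Rightarrow> 'a set" where
  "submodule_gen R M X = \<Inter>{N. submodule N R M \<and> X \<subseteq> N}"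

definition quot_module :: "('r, 'a) module \<Rightarrow> 'a set \<Rightarrow> ('r, 'a set) module" where
  "quot_module M N = \<lparr>carrier = a_rcosets\<^bsub>M\<^esub> N, monoid.mult = undefined, one = undefined,
     zero = N, add = (\<lambda>X Y. X <+>\<^bsub>M\<^esub> Y), smult = (\<lambda>r X. \<Union>x\<in>X. N +>\<^bsub>M\<^esub> (r \<odot>\<^bsub>M\<^esub> x))\<rparr>"


section \<open>Non-negatively graded chain complexes\<close>

text \<open>Degrees are integers, with the zero module in every negative degree; this keeps the Leibniz
  rules free of special cases in degree 0.\<close>

record ('r, 'a) cx =
  md :: "int \<Rightarrow> ('r, 'a) module"
  bdry :: "int \<Rightarrow> 'a \<Rightarrow> 'a"

definition chain_complex :: "'r ring \<Rightarrow> ('r, 'a) cx \<Rightarrow> bool" where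
  "chain_complex R A \<longleftrightarrow>
     (\<forall>d. module R (md A d)) \<and>
     (\<forall>d<0. carrier (md A d) = {\<zero>\<^bsub>md A d\<^esub>}) \<and>
     (\<forall>d. bdry A d \<in> lin_maps R (md A d) (md A (d - 1))) \<and>
     (\<forall>d. \<forall>x\<in>carrier (md A d). bdry A (d - 1) (bdry A d x) = \<zero>\<^bsub>md A (d - 2)\<^esub>)"

definition cx_map :: "'r ring \<Rightarrow> ('r, 'a) cx \<Rightarrow> ('r, 'b) cx \<Rightarrow> (int \<Rightarrow> 'a \<Rightarrow> 'b) \<Rightarrow> bool" where
  "cx_map R A B f \<longleftrightarrow> (\<forall>d. f d \<in> lin_maps R (md A d) (md B d) \<and>
     (\<forall>x\<in>carrier (md A d). f (d - 1) (bdry A d x) = bdry B d (f d x)))"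

definition cycles :: "('r, 'a) cx \<Rightarrow> int \<Rightarrow> 'a set" where
  "cycles A d = {x \<in> carrier (md A d). bdry A d x = \<zero>\<^bsub>md A (d - 1)\<^esub>}"

definition boundaries :: "('r, 'a) cx \<Rightarrow> int \<Rightarrow> 'a set" where
  "boundaries A d = bdry A (d + 1) ` carrier (md A (d + 1))"

definition homology :: "('r, 'a) cx \<Rightarrow> int \<Rightarrow> 'a set set" where
  "homology A d = (\<lambda>z. boundaries A d +>\<^bsub>md A d\<^esub> z) ` cycles A d"

definition homology_map :: "('r, 'b) cx \<Rightarrow> (int \<Rightarrow> 'a \<Rightarrow> 'b) \<Rightarrow> int \<Rightarrow> 'a set \<Rightarrow> 'b set" where
  "homology_map B f d H = (\<Union>z\<in>H. boundaries B d +>\<^bsub>md B d\<^esub> f d z)"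

definition quasi_iso :: "('r, 'a) cx \<Rightarrow> ('r, 'b) cx \<Rightarrow> (int \<Rightarrow> 'a \<Rightarrow> 'b) \<Rightarrow> bool" where
  "quasi_iso A B f \<longleftrightarrow> (\<forall>d. bij_betw (homology_map B f d) (homology A d) (homology B d))"


subsection \<open>The internal hom\<close>

text \<open>The internal hom of non-negatively graded complexes: all graded linear maps of degree \<open>d\<close> if
  \<open>d > 0\<close>, the chain maps if \<open>d = 0\<close>, and zero if \<open>d < 0\<close>. A homomorphism \<open>f\<close> has components
  \<open>f e\<close>, extensional on the source in degree \<open>e\<close>.\<close>

definition hom_carrier ::
  "'r ring \<Rightarrow> ('r, 'x) cx \<Rightarrow> ('r, 'y) cx \<Rightarrow> int \<Rightarrow> (int \<Rightarrow> 'x \<Rightarrow> 'y) set" where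
  "hom_carrier R X Y d = {f.
     (\<forall>e. f e \<in> lin_maps R (md X e) (md Y (e + d)) \<inter> extensional (carrier (md X e))) \<and>
     (d = 0 \<longrightarrow> (\<forall>e. \<forall>x\<in>carrier (md X e). bdry Y e (f e x) = f (e - 1) (bdry X e x))) \<and>
     (d < 0 \<longrightarrow> (\<forall>e. \<forall>x\<in>carrier (md X e). f e x = \<zero>\<^bsub>md Y (e + d)\<^esub>))}"

definition hom_cx :: "'r ring \<Rightarrow> ('r, 'x) cx \<Rightarrow> ('r, 'y) cx \<Rightarrow> ('r, int \<Rightarrow> 'x \<Rightarrow> 'y) cx" where
  "hom_cx R X Y = \<lparr>
     md = (\<lambda>d. \<lparr>carrier = hom_carrier R X Y d, monoid.mult = undefined, one = undefined,
       zero = (\<lambda>e. \<lambda>x\<in>carrier (md X e). \<zero>\<^bsub>md Y (e + d)\<^esub>),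
       add = (\<lambda>f g e. \<lambda>x\<in>carrier (md X e). f e x \<oplus>\<^bsub>md Y (e + d)\<^esub> g e x),
       smult = (\<lambda>r f e. \<lambda>x\<in>carrier (md X e). r \<odot>\<^bsub>md Y (e + d)\<^esub> f e x)\<rparr>),
     bdry = (\<lambda>d f e. \<lambda>x\<in>carrier (md X e).
       bdry Y (e + d) (f e x)
         \<ominus>\<^bsub>md Y (e + d - 1)\<^esub> ksgn (md Y (e + d - 1)) d (f (e - 1) (bdry X e x)))\<rparr>"


subsection \<open>Tensor powers\<close>

text \<open>A list \<open>[(i\<^sub>1, a\<^sub>1), \<dots>, (i\<^sub>n, a\<^sub>n)]\<close> with each \<open>a\<^sub>j\<close> homogeneous of degree \<open>i\<^sub>j\<close> stands for
  \<open>a\<^sub>1 \<otimes> \<dots> \<otimes> a\<^sub>n\<close>. The degree \<open>d\<close> part of the \<open>n\<close>-th tensor power is the free module on the lists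
  of length \<open>n\<close> and total degree \<open>d\<close>, modulo multilinearity.\<close>

definition tdeg :: "(int \<times> 'a) list \<Rightarrow> int" where
  "tdeg l = sum_list (map fst l)"

definition hlists :: "('r, 'a) cx \<Rightarrow> nat \<Rightarrow> int \<Rightarrow> (int \<times> 'a) list set" where
  "hlists A n d = {l. length l = n \<and> (\<forall>(i, a)\<in>set l. a \<in> carrier (md A i)) \<and> tdeg l = d}"

definition tensor_rels :: "'r ring \<Rightarrow> ('r, 'a) cx \<Rightarrow> nat \<Rightarrow> int \<Rightarrow> ((int \<times> 'a) list \<Rightarrow> 'r) set" where
  "tensor_rels R A n d = (let F = free_module R (hlists A n d) in
     {free_gen R (xs @ (i, a \<oplus>\<^bsub>md A i\<^esub> b) # ys)
        \<ominus>\<^bsub>F\<^esub> (free_gen R (xs @ (i, a) # ys) \<oplus>\<^bsub>F\<^esub> free_gen R (xs @ (i, b) # ys)) | xs ys i a b.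
        xs @ (i, a) # ys \<in> hlists A n d \<and> xs @ (i, b) # ys \<in> hlists A n d} \<union>
     {free_gen R (xs @ (i, r \<odot>\<^bsub>md A i\<^esub> a) # ys)
        \<ominus>\<^bsub>F\<^esub> (r \<odot>\<^bsub>F\<^esub> free_gen R (xs @ (i, a) # ys)) | xs ys i a r.
        xs @ (i, a) # ys \<in> hlists A n d \<and> r \<in> carrier R})"

definition tensor_ker :: "'r ring \<Rightarrow> ('r, 'a) cx \<Rightarrow> nat \<Rightarrow> int \<Rightarrow> ((int \<times> 'a) list \<Rightarrow> 'r) set" where
  "tensor_ker R A n d = submodule_gen R (free_module R (hlists A n d)) (tensor_rels R A n d)"

type_synonym ('r, 'a) tensor = "((int \<times> 'a) list \<Rightarrow> 'r) set"

definition tensor_mod :: "'r ring \<Rightarrow> ('r, 'a) cx \<Rightarrow> nat \<Rightarrow> int \<Rightarrow> ('r, ('r, 'a) tensor) module" where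
  "tensor_mod R A n d = quot_module (free_module R (hlists A n d)) (tensor_ker R A n d)"

definition ten :: "'r ring \<Rightarrow> ('r, 'a) cx \<Rightarrow> (int \<times> 'a) list \<Rightarrow> ('r, 'a) tensor" where
  "ten R A l = tensor_ker R A (length l) (tdeg l)
     +>\<^bsub>free_module R (hlists A (length l) (tdeg l))\<^esub> free_gen R l"

text \<open>The universal property of the tensor power: \<open>tensor_lift R A n d M g\<close> is the linear map into
  \<open>M\<close> with value \<open>g l\<close> on the elementary tensor \<open>ten R A l\<close>, for \<open>g\<close> multilinear.\<close>

definition tensor_lift :: "'r ring \<Rightarrow> ('r, 'a) cx \<Rightarrow> nat \<Rightarrow> int \<Rightarrow> ('r, 'b) module \<Rightarrow>
    ((int \<times> 'a) list \<Rightarrow> 'b) \<Rightarrow> ('r, 'a) tensor \<Rightarrow> 'b" where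
  "tensor_lift R A n d M g = (THE h.
     h \<in> lin_maps R (tensor_mod R A n d) M \<inter> extensional (carrier (tensor_mod R A n d)) \<and>
     (\<forall>l\<in>hlists A n d. h (ten R A l) = g l))"

definition tensor_cx :: "'r ring \<Rightarrow> ('r, 'a) cx \<Rightarrow> nat \<Rightarrow> ('r, ('r, 'a) tensor) cx" where
  "tensor_cx R A n = \<lparr>
     md = tensor_mod R A n,
     bdry = (\<lambda>d. tensor_lift R A n d (tensor_mod R A n (d - 1)) (\<lambda>l.
       \<Oplus>\<^bsub>tensor_mod R A n (d - 1)\<^esub>j\<in>{..<n}.
         ksgn (tensor_mod R A n (d - 1)) (tdeg (take j l))
           (ten R A (l[j := (fst (l ! j) - 1, bdry A (fst (l ! j)) (snd (l ! j)))]))))\<rparr>"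

definition tensor_map :: "'r ring \<Rightarrow> ('r, 'a) cx \<Rightarrow> ('r, 'b) cx \<Rightarrow> (int \<Rightarrow> 'a \<Rightarrow> 'b) \<Rightarrow>
    nat \<Rightarrow> int \<Rightarrow> ('r, 'a) tensor \<Rightarrow> ('r, 'b) tensor" where
  "tensor_map R A B f n d = tensor_lift R A n d (tensor_mod R B n d)
     (\<lambda>l. ten R B (map (\<lambda>(i, a). (i, f i a)) l))"

text \<open>The canonical map from the tensor product of the \<open>m\<close>-th power (degree \<open>d\<close>) and the \<open>n\<close>-th
  power (degree \<open>e\<close>) to the \<open>(m + n)\<close>-th power, on a pair \<open>(u, v)\<close>.\<close>

definition tensor_conc :: "'r ring \<Rightarrow> ('r, 'a) cx \<Rightarrow> nat \<Rightarrow> int \<Rightarrow> nat \<Rightarrow> int \<Rightarrow>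
    ('r, 'a) tensor \<Rightarrow> ('r, 'a) tensor \<Rightarrow> ('r, 'a) tensor" where
  "tensor_conc R A m d n e u v = tensor_lift R A m d (tensor_mod R A (m + n) (d + e))
     (\<lambda>l. tensor_lift R A n e (tensor_mod R A (m + n) (d + e)) (\<lambda>l'. ten R A (l @ l')) v) u"

text \<open>The left action of a permutation \<open>\<sigma>\<close> moves the \<open>j\<close>-th factor to place \<open>\<sigma> j\<close>; the sign is the
  Koszul sign.\<close>

definition tensor_perm :: "'r ring \<Rightarrow> ('r, 'a) cx \<Rightarrow> nat \<Rightarrow> int \<Rightarrow> (nat \<Rightarrow> nat) \<Rightarrow>
    ('r, 'a) tensor \<Rightarrow> ('r, 'a) tensor" where
  "tensor_perm R A n d \<sigma> = tensor_lift R A n d (tensor_mod R A n d)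
     (\<lambda>l. ksgn (tensor_mod R A n d)
        (\<Sum>(j, k)\<in>{(j, k). j < k \<and> k < n \<and> \<sigma> k < \<sigma> j}. fst (l ! j) * fst (l ! k))
        (ten R A (map (\<lambda>i. l ! (inv_into UNIV \<sigma> i)) [0..<n])))"


section \<open>PROPs without units over chain complexes\<close>

text \<open>\<open>m\<close> counts outputs and \<open>n\<close> inputs; only \<open>m, n \<ge> 1\<close> is meaningful. Every operation takes the
  arities and then the degrees of its arguments. A structure map out of a tensor product of
  complexes is given as a bilinear operation on homogeneous elements satisfying the Leibniz rule.\<close>

record ('r, 'p) prop_data =
  pcx :: "nat \<Rightarrow> nat \<Rightarrow> ('r, 'p) cx"
  lact :: "nat \<Rightarrow> nat \<Rightarrow> int \<Rightarrow> (nat \<Rightarrow> nat) \<Rightarrow> 'p \<Rightarrow> 'p"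
  ract :: "nat \<Rightarrow> nat \<Rightarrow> int \<Rightarrow> 'p \<Rightarrow> (nat \<Rightarrow> nat) \<Rightarrow> 'p"
  vcomp :: "nat \<Rightarrow> nat \<Rightarrow> nat \<Rightarrow> int \<Rightarrow> int \<Rightarrow> 'p \<Rightarrow> 'p \<Rightarrow> 'p"
  hcomp :: "nat \<Rightarrow> nat \<Rightarrow> nat \<Rightarrow> nat \<Rightarrow> int \<Rightarrow> int \<Rightarrow> 'p \<Rightarrow> 'p \<Rightarrow> 'p"

abbreviation pmod :: "('r, 'p) prop_data \<Rightarrow> nat \<Rightarrow> nat \<Rightarrow> int \<Rightarrow> ('r, 'p) module" where
  "pmod P m n d \<equiv> md (pcx P m n) d"

abbreviation pel :: "('r, 'p) prop_data \<Rightarrow> nat \<Rightarrow> nat \<Rightarrow> int \<Rightarrow> 'p set" where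
  "pel P m n d \<equiv> carrier (pmod P m n d)"

definition bilin_chain ::
  "'r ring \<Rightarrow> ('r, 'x) cx \<Rightarrow> ('r, 'y) cx \<Rightarrow> ('r, 'z) cx \<Rightarrow> (int \<Rightarrow> int \<Rightarrow> 'x \<Rightarrow> 'y \<Rightarrow> 'z) \<Rightarrow> bool" where
  "bilin_chain R X Y Z b \<longleftrightarrow> (\<forall>i j.
     (\<forall>y\<in>carrier (md Y j). (\<lambda>x. b i j x y) \<in> lin_maps R (md X i) (md Z (i + j))) \<and>
     (\<forall>x\<in>carrier (md X i). b i j x \<in> lin_maps R (md Y j) (md Z (i + j))) \<and>
     (\<forall>x\<in>carrier (md X i). \<forall>y\<in>carrier (md Y j).
        bdry Z (i + j) (b i j x y) =
          b (i - 1) j (bdry X i x) y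
            \<oplus>\<^bsub>md Z (i + j - 1)\<^esub> ksgn (md Z (i + j - 1)) i (b i (j - 1) x (bdry Y j y))))"

definition block_perm :: "nat \<Rightarrow> (nat \<Rightarrow> nat) \<Rightarrow> (nat \<Rightarrow> nat) \<Rightarrow> nat \<Rightarrow> nat" where
  "block_perm m \<sigma> \<sigma>' i = (if i < m then \<sigma> i else m + \<sigma>' (i - m))"

locale unitless_prop =
  fixes R :: "'r ring" and P :: "('r, 'p) prop_data"
  assumes complex: "1 \<le> m \<Longrightarrow> 1 \<le> n \<Longrightarrow> chain_complex R (pcx P m n)"
    and lact_chain: "1 \<le> m \<Longrightarrow> 1 \<le> n \<Longrightarrow> \<sigma> permutes {..<m} \<Longrightarrow>
      cx_map R (pcx P m n) (pcx P m n) (\<lambda>d. lact P m n d \<sigma>)"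
    and ract_chain: "1 \<le> m \<Longrightarrow> 1 \<le> n \<Longrightarrow> \<tau> permutes {..<n} \<Longrightarrow>
      cx_map R (pcx P m n) (pcx P m n) (\<lambda>d x. ract P m n d x \<tau>)"
    and lact_id: "1 \<le> m \<Longrightarrow> 1 \<le> n \<Longrightarrow> x \<in> pel P m n d \<Longrightarrow> lact P m n d id x = x"
    and lact_mult: "1 \<le> m \<Longrightarrow> 1 \<le> n \<Longrightarrow> x \<in> pel P m n d \<Longrightarrow>
      \<sigma> permutes {..<m} \<Longrightarrow> \<sigma>' permutes {..<m} \<Longrightarrow>
      lact P m n d (\<sigma> \<circ> \<sigma>') x = lact P m n d \<sigma> (lact P m n d \<sigma>' x)"
    and ract_id: "1 \<le> m \<Longrightarrow> 1 \<le> n \<Longrightarrow> x \<in> pel P m n d \<Longrightarrow> ract P m n d x id = x"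
    and ract_mult: "1 \<le> m \<Longrightarrow> 1 \<le> n \<Longrightarrow> x \<in> pel P m n d \<Longrightarrow>
      \<tau> permutes {..<n} \<Longrightarrow> \<tau>' permutes {..<n} \<Longrightarrow>
      ract P m n d x (\<tau> \<circ> \<tau>') = ract P m n d (ract P m n d x \<tau>) \<tau>'"
    and actions_commute: "1 \<le> m \<Longrightarrow> 1 \<le> n \<Longrightarrow> x \<in> pel P m n d \<Longrightarrow>
      \<sigma> permutes {..<m} \<Longrightarrow> \<tau> permutes {..<n} \<Longrightarrow>
      ract P m n d (lact P m n d \<sigma> x) \<tau> = lact P m n d \<sigma> (ract P m n d x \<tau>)"
    and vcomp_chain: "1 \<le> m \<Longrightarrow> 1 \<le> n \<Longrightarrow> 1 \<le> k \<Longrightarrow>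
      bilin_chain R (pcx P m n) (pcx P n k) (pcx P m k) (vcomp P m n k)"
    and vcomp_assoc: "1 \<le> m \<Longrightarrow> 1 \<le> n \<Longrightarrow> 1 \<le> k \<Longrightarrow> 1 \<le> l \<Longrightarrow>
      x \<in> pel P m n a \<Longrightarrow> y \<in> pel P n k b \<Longrightarrow> z \<in> pel P k l c \<Longrightarrow>
      vcomp P m k l (a + b) c (vcomp P m n k a b x y) z =
      vcomp P m n l a (b + c) x (vcomp P n k l b c y z)"
    and vcomp_lact: "1 \<le> m \<Longrightarrow> 1 \<le> n \<Longrightarrow> 1 \<le> k \<Longrightarrow> \<sigma> permutes {..<m} \<Longrightarrow>
      x \<in> pel P m n a \<Longrightarrow> y \<in> pel P n k b \<Longrightarrow>
      vcomp P m n k a b (lact P m n a \<sigma> x) y = lact P m k (a + b) \<sigma> (vcomp P m n k a b x y)"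
    and vcomp_ract: "1 \<le> m \<Longrightarrow> 1 \<le> n \<Longrightarrow> 1 \<le> k \<Longrightarrow> \<tau> permutes {..<k} \<Longrightarrow>
      x \<in> pel P m n a \<Longrightarrow> y \<in> pel P n k b \<Longrightarrow>
      vcomp P m n k a b x (ract P n k b y \<tau>) = ract P m k (a + b) (vcomp P m n k a b x y) \<tau>"
    and vcomp_balanced: "1 \<le> m \<Longrightarrow> 1 \<le> n \<Longrightarrow> 1 \<le> k \<Longrightarrow> \<sigma> permutes {..<n} \<Longrightarrow>
      x \<in> pel P m n a \<Longrightarrow> y \<in> pel P n k b \<Longrightarrow>
      vcomp P m n k a b (ract P m n a x \<sigma>) y = vcomp P m n k a b x (lact P n k b \<sigma> y)"
    and hcomp_chain: "1 \<le> m1 \<Longrightarrow> 1 \<le> n1 \<Longrightarrow> 1 \<le> m2 \<Longrightarrow> 1 \<le> n2 \<Longrightarrow>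
      bilin_chain R (pcx P m1 n1) (pcx P m2 n2) (pcx P (m1 + m2) (n1 + n2)) (hcomp P m1 n1 m2 n2)"
    and hcomp_assoc: "1 \<le> m1 \<Longrightarrow> 1 \<le> n1 \<Longrightarrow> 1 \<le> m2 \<Longrightarrow> 1 \<le> n2 \<Longrightarrow> 1 \<le> m3 \<Longrightarrow> 1 \<le> n3 \<Longrightarrow>
      x \<in> pel P m1 n1 a \<Longrightarrow> y \<in> pel P m2 n2 b \<Longrightarrow> z \<in> pel P m3 n3 c \<Longrightarrow>
      hcomp P (m1 + m2) (n1 + n2) m3 n3 (a + b) c (hcomp P m1 n1 m2 n2 a b x y) z =
      hcomp P m1 n1 (m2 + m3) (n2 + n3) a (b + c) x (hcomp P m2 n2 m3 n3 b c y z)"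
    and hcomp_lact: "1 \<le> m1 \<Longrightarrow> 1 \<le> n1 \<Longrightarrow> 1 \<le> m2 \<Longrightarrow> 1 \<le> n2 \<Longrightarrow>
      \<sigma> permutes {..<m1} \<Longrightarrow> \<sigma>' permutes {..<m2} \<Longrightarrow>
      x \<in> pel P m1 n1 a \<Longrightarrow> y \<in> pel P m2 n2 b \<Longrightarrow>
      hcomp P m1 n1 m2 n2 a b (lact P m1 n1 a \<sigma> x) (lact P m2 n2 b \<sigma>' y) =
      lact P (m1 + m2) (n1 + n2) (a + b) (block_perm m1 \<sigma> \<sigma>') (hcomp P m1 n1 m2 n2 a b x y)"
    and hcomp_ract: "1 \<le> m1 \<Longrightarrow> 1 \<le> n1 \<Longrightarrow> 1 \<le> m2 \<Longrightarrow> 1 \<le> n2 \<Longrightarrow>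
      \<tau> permutes {..<n1} \<Longrightarrow> \<tau>' permutes {..<n2} \<Longrightarrow>
      x \<in> pel P m1 n1 a \<Longrightarrow> y \<in> pel P m2 n2 b \<Longrightarrow>
      hcomp P m1 n1 m2 n2 a b (ract P m1 n1 a x \<tau>) (ract P m2 n2 b y \<tau>') =
      ract P (m1 + m2) (n1 + n2) (a + b) (hcomp P m1 n1 m2 n2 a b x y) (block_perm n1 \<tau> \<tau>')"
    and interchange: "1 \<le> m1 \<Longrightarrow> 1 \<le> n1 \<Longrightarrow> 1 \<le> k1 \<Longrightarrow> 1 \<le> m2 \<Longrightarrow> 1 \<le> n2 \<Longrightarrow> 1 \<le> k2 \<Longrightarrow>
      x1 \<in> pel P m1 n1 a1 \<Longrightarrow> x2 \<in> pel P m2 n2 a2 \<Longrightarrow>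
      y1 \<in> pel P n1 k1 b1 \<Longrightarrow> y2 \<in> pel P n2 k2 b2 \<Longrightarrow>
      vcomp P (m1 + m2) (n1 + n2) (k1 + k2) (a1 + a2) (b1 + b2)
        (hcomp P m1 n1 m2 n2 a1 a2 x1 x2) (hcomp P n1 k1 n2 k2 b1 b2 y1 y2) =
      ksgn (pmod P (m1 + m2) (k1 + k2) (a1 + a2 + b1 + b2)) (a2 * b1)
        (hcomp P m1 k1 m2 k2 (a1 + b1) (a2 + b2)
          (vcomp P m1 n1 k1 a1 b1 x1 y1) (vcomp P m2 n2 k2 a2 b2 x2 y2))"

definition prop_hom :: "'r ring \<Rightarrow> ('r, 'p) prop_data \<Rightarrow> ('r, 'q) prop_data \<Rightarrow>
    (nat \<Rightarrow> nat \<Rightarrow> int \<Rightarrow> 'p \<Rightarrow> 'q) \<Rightarrow> bool" where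
  "prop_hom R P Q \<phi> \<longleftrightarrow>
     (\<forall>m\<ge>1. \<forall>n\<ge>1. cx_map R (pcx P m n) (pcx Q m n) (\<phi> m n)) \<and>
     (\<forall>m\<ge>1. \<forall>n\<ge>1. \<forall>d. \<forall>x\<in>pel P m n d. \<forall>\<sigma>. \<sigma> permutes {..<m} \<longrightarrow>
        \<phi> m n d (lact P m n d \<sigma> x) = lact Q m n d \<sigma> (\<phi> m n d x)) \<and>
     (\<forall>m\<ge>1. \<forall>n\<ge>1. \<forall>d. \<forall>x\<in>pel P m n d. \<forall>\<tau>. \<tau> permutes {..<n} \<longrightarrow>
        \<phi> m n d (ract P m n d x \<tau>) = ract Q m n d (\<phi> m n d x) \<tau>) \<and>
     (\<forall>m\<ge>1. \<forall>n\<ge>1. \<forall>k\<ge>1. \<forall>a b. \<forall>x\<in>pel P m n a. \<forall>y\<in>pel P n k b.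
        \<phi> m k (a + b) (vcomp P m n k a b x y) = vcomp Q m n k a b (\<phi> m n a x) (\<phi> n k b y)) \<and>
     (\<forall>m1\<ge>1. \<forall>n1\<ge>1. \<forall>m2\<ge>1. \<forall>n2\<ge>1. \<forall>a b. \<forall>x\<in>pel P m1 n1 a. \<forall>y\<in>pel P m2 n2 b.
        \<phi> (m1 + m2) (n1 + n2) (a + b) (hcomp P m1 n1 m2 n2 a b x y) =
        hcomp Q m1 n1 m2 n2 a b (\<phi> m1 n1 a x) (\<phi> m2 n2 b y))"


subsection \<open>Endomorphism PROPs and algebras\<close>

definition endo_prop ::
  "'r ring \<Rightarrow> ('r, 'a) cx \<Rightarrow> ('r, int \<Rightarrow> ('r, 'a) tensor \<Rightarrow> ('r, 'a) tensor) prop_data" where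
  "endo_prop R A = \<lparr>
     pcx = (\<lambda>m n. hom_cx R (tensor_cx R A n) (tensor_cx R A m)),
     lact = (\<lambda>m n d \<sigma> f e. \<lambda>u\<in>carrier (tensor_mod R A n e). tensor_perm R A m (e + d) \<sigma> (f e u)),
     ract = (\<lambda>m n d f \<tau> e. \<lambda>u\<in>carrier (tensor_mod R A n e). f e (tensor_perm R A n e \<tau> u)),
     vcomp = (\<lambda>m n k a b f g e. \<lambda>u\<in>carrier (tensor_mod R A k e). f (e + b) (g e u)),
     hcomp = (\<lambda>m1 n1 m2 n2 a b f g e.
       tensor_lift R A (n1 + n2) e (tensor_mod R A (m1 + m2) (e + (a + b)))
         (\<lambda>l. let i = tdeg (take n1 l); j = tdeg (drop n1 l) in
            ksgn (tensor_mod R A (m1 + m2) (e + (a + b))) (b * i)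
              (tensor_conc R A m1 (i + a) m2 (j + b)
                 (f i (ten R A (take n1 l))) (g j (ten R A (drop n1 l))))))\<rparr>"

definition prop_algebra :: "'r ring \<Rightarrow> ('r, 'p) prop_data \<Rightarrow> ('r, 'a) cx \<Rightarrow>
    (nat \<Rightarrow> nat \<Rightarrow> int \<Rightarrow> 'p \<Rightarrow> int \<Rightarrow> ('r, 'a) tensor \<Rightarrow> ('r, 'a) tensor) \<Rightarrow> bool" where
  "prop_algebra R P A \<alpha> \<longleftrightarrow> prop_hom R P (endo_prop R A) \<alpha>"

definition prop_algebra_hom :: "'r ring \<Rightarrow> ('r, 'p) prop_data \<Rightarrow> ('r, 'a) cx \<Rightarrow> ('r, 'b) cx \<Rightarrow>
    (nat \<Rightarrow> nat \<Rightarrow> int \<Rightarrow> 'p \<Rightarrow> int \<Rightarrow> ('r, 'a) tensor \<Rightarrow> ('r, 'a) tensor) \<Rightarrow>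
    (nat \<Rightarrow> nat \<Rightarrow> int \<Rightarrow> 'p \<Rightarrow> int \<Rightarrow> ('r, 'b) tensor \<Rightarrow> ('r, 'b) tensor) \<Rightarrow>
    (int \<Rightarrow> 'a \<Rightarrow> 'b) \<Rightarrow> bool" where
  "prop_algebra_hom R P A B \<alpha> \<beta> f \<longleftrightarrow> cx_map R A B f \<and>
     (\<forall>m\<ge>1. \<forall>n\<ge>1. \<forall>d e. \<forall>x\<in>pel P m n d. \<forall>u\<in>carrier (tensor_mod R A n e).
        tensor_map R A B f m (e + d) (\<alpha> m n d x e u) =
        \<beta> m n d x e (tensor_map R A B f n e u))"


section \<open>The small object argument for PROPs\<close>

text \<open>The generating cofibrations of PROPs are the free PROP maps induced by placing, in a biarity
  \<open>(m, n)\<close>, the inclusion of the sphere complex of degree \<open>d - 1\<close> in the disk complex of degree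
  \<open>d\<close>, for \<open>d \<ge> 0\<close> (the sphere of degree \<open>-1\<close> is zero). A square from such a map to
  \<open>\<epsilon> : X \<longrightarrow> Q\<close> is a cycle \<open>z \<in> X(m,n)\<close> of degree \<open>d - 1\<close> with an element \<open>y \<in> Q(m,n)\<close> of degree
  \<open>d\<close> such that \<open>\<epsilon> z = \<partial> y\<close>. The pushout along it freely adjoins an element of degree \<open>d\<close>, written
  \<open>Cell k m n d z y\<close> if adjoined to stage \<open>k\<close>, with boundary \<open>z\<close> and image \<open>y\<close>. Beginning with the
  initial (zero) PROP, each stage adjoins one cell for every square, and the replacement of \<open>Q\<close>
  is the union of the stages. The stages are realised as PROP expressions in the cells, modulo the
  smallest congruence whose quotient satisfies the PROP axioms.\<close>

datatype ('r, 'q) pexp =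
    Cell nat nat nat int "('r, 'q) pexp" 'q
  | Zero nat nat int
  | Add "('r, 'q) pexp" "('r, 'q) pexp"
  | Scale 'r "('r, 'q) pexp"
  | LAct "nat \<Rightarrow> nat" "('r, 'q) pexp"
  | RAct "('r, 'q) pexp" "nat \<Rightarrow> nat"
  | Vert "('r, 'q) pexp" "('r, 'q) pexp"
  | Hor "('r, 'q) pexp" "('r, 'q) pexp"

primrec eouts :: "('r, 'q) pexp \<Rightarrow> nat" where
  "eouts (Cell k m n d z y) = m"
| "eouts (Zero m n d) = m"
| "eouts (Add a b) = eouts a"
| "eouts (Scale r a) = eouts a"
| "eouts (LAct \<sigma> a) = eouts a"
| "eouts (RAct a \<tau>) = eouts a"
| "eouts (Vert a b) = eouts a"
| "eouts (Hor a b) = eouts a + eouts b"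

primrec eins :: "('r, 'q) pexp \<Rightarrow> nat" where
  "eins (Cell k m n d z y) = n"
| "eins (Zero m n d) = n"
| "eins (Add a b) = eins a"
| "eins (Scale r a) = eins a"
| "eins (LAct \<sigma> a) = eins a"
| "eins (RAct a \<tau>) = eins a"
| "eins (Vert a b) = eins b"
| "eins (Hor a b) = eins a + eins b"

primrec edeg :: "('r, 'q) pexp \<Rightarrow> int" where
  "edeg (Cell k m n d z y) = d"
| "edeg (Zero m n d) = d"
| "edeg (Add a b) = edeg a"
| "edeg (Scale r a) = edeg a"
| "edeg (LAct \<sigma> a) = edeg a"
| "edeg (RAct a \<tau>) = edeg a"
| "edeg (Vert a b) = edeg a + edeg b"
| "edeg (Hor a b) = edeg a + edeg b"

definition same_type :: "('r, 'q) pexp \<Rightarrow> ('r, 'q) pexp \<Rightarrow> bool" where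
  "same_type a b \<longleftrightarrow> eouts a = eouts b \<and> eins a = eins b \<and> edeg a = edeg b"

abbreviation rsgn :: "'r ring \<Rightarrow> int \<Rightarrow> 'r" where
  "rsgn R i \<equiv> (if even i then \<one>\<^bsub>R\<^esub> else \<ominus>\<^bsub>R\<^esub> \<one>\<^bsub>R\<^esub>)"

primrec ebdry :: "'r ring \<Rightarrow> ('r, 'q) pexp \<Rightarrow> ('r, 'q) pexp" where
  "ebdry R (Cell k m n d z y) = z"
| "ebdry R (Zero m n d) = Zero m n (d - 1)"
| "ebdry R (Add a b) = Add (ebdry R a) (ebdry R b)"
| "ebdry R (Scale r a) = Scale r (ebdry R a)"
| "ebdry R (LAct \<sigma> a) = LAct \<sigma> (ebdry R a)"
| "ebdry R (RAct a \<tau>) = RAct (ebdry R a) \<tau>"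
| "ebdry R (Vert a b) = Add (Vert (ebdry R a) b) (Scale (rsgn R (edeg a)) (Vert a (ebdry R b)))"
| "ebdry R (Hor a b) = Add (Hor (ebdry R a) b) (Scale (rsgn R (edeg a)) (Hor a (ebdry R b)))"

text \<open>The augmentation \<open>\<epsilon>\<close> to \<open>Q\<close>, on expressions.\<close>

primrec eaug :: "('r, 'q) prop_data \<Rightarrow> ('r, 'q) pexp \<Rightarrow> 'q" where
  "eaug Q (Cell k m n d z y) = y"
| "eaug Q (Zero m n d) = \<zero>\<^bsub>pmod Q m n d\<^esub>"
| "eaug Q (Add a b) = eaug Q a \<oplus>\<^bsub>pmod Q (eouts a) (eins a) (edeg a)\<^esub> eaug Q b"
| "eaug Q (Scale r a) = r \<odot>\<^bsub>pmod Q (eouts a) (eins a) (edeg a)\<^esub> eaug Q a"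
| "eaug Q (LAct \<sigma> a) = lact Q (eouts a) (eins a) (edeg a) \<sigma> (eaug Q a)"
| "eaug Q (RAct a \<tau>) = ract Q (eouts a) (eins a) (edeg a) (eaug Q a) \<tau>"
| "eaug Q (Vert a b) =
     vcomp Q (eouts a) (eins a) (eins b) (edeg a) (edeg b) (eaug Q a) (eaug Q b)"
| "eaug Q (Hor a b) =
     hcomp Q (eouts a) (eins a) (eouts b) (eins b) (edeg a) (edeg b) (eaug Q a) (eaug Q b)"

text \<open>Well-formed expressions over a set \<open>C\<close> of cells.\<close>

inductive pterm :: "'r ring \<Rightarrow> ('r, 'q) pexp set \<Rightarrow> ('r, 'q) pexp \<Rightarrow> bool" for R C where
  "c \<in> C \<Longrightarrow> pterm R C c"
| "1 \<le> m \<Longrightarrow> 1 \<le> n \<Longrightarrow> pterm R C (Zero m n d)"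
| "pterm R C a \<Longrightarrow> pterm R C b \<Longrightarrow> same_type a b \<Longrightarrow> pterm R C (Add a b)"
| "r \<in> carrier R \<Longrightarrow> pterm R C a \<Longrightarrow> pterm R C (Scale r a)"
| "pterm R C a \<Longrightarrow> \<sigma> permutes {..<eouts a} \<Longrightarrow> pterm R C (LAct \<sigma> a)"
| "pterm R C a \<Longrightarrow> \<tau> permutes {..<eins a} \<Longrightarrow> pterm R C (RAct a \<tau>)"
| "pterm R C a \<Longrightarrow> pterm R C b \<Longrightarrow> eins a = eouts b \<Longrightarrow> pterm R C (Vert a b)"
| "pterm R C a \<Longrightarrow> pterm R C b \<Longrightarrow> pterm R C (Hor a b)"

definition pterms ::
  "'r ring \<Rightarrow> ('r, 'q) pexp set \<Rightarrow> nat \<Rightarrow> nat \<Rightarrow> int \<Rightarrow> ('r, 'q) pexp set" where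
  "pterms R C m n d = {a. pterm R C a \<and> eouts a = m \<and> eins a = n \<and> edeg a = d}"

text \<open>Operations on the quotient by \<open>E\<close>, computed on representatives.\<close>

definition cls1 :: "('e \<times> 'e) set \<Rightarrow> ('e \<Rightarrow> 'e) \<Rightarrow> 'e set \<Rightarrow> 'e set" where
  "cls1 E h X = (\<Union>a\<in>X. E `` {h a})"

definition cls2 :: "('e \<times> 'e) set \<Rightarrow> ('e \<Rightarrow> 'e \<Rightarrow> 'e) \<Rightarrow> 'e set \<Rightarrow> 'e set \<Rightarrow> 'e set" where
  "cls2 E h X Y = (\<Union>a\<in>X. \<Union>b\<in>Y. E `` {h a b})"

definition quot_prop :: "'r ring \<Rightarrow> ('r, 'q) pexp set \<Rightarrow> (('r, 'q) pexp \<times> ('r, 'q) pexp) set \<Rightarrow>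
    ('r, ('r, 'q) pexp set) prop_data" where
  "quot_prop R C E = \<lparr>
     pcx = (\<lambda>m n. \<lparr>
       md = (\<lambda>d. \<lparr>carrier = pterms R C m n d // E, monoid.mult = undefined, one = undefined,
         zero = E `` {Zero m n d}, add = cls2 E Add, smult = (\<lambda>r. cls1 E (Scale r))\<rparr>),
       bdry = (\<lambda>d. cls1 E (ebdry R))\<rparr>),
     lact = (\<lambda>m n d \<sigma>. cls1 E (LAct \<sigma>)),
     ract = (\<lambda>m n d X \<tau>. cls1 E (\<lambda>a. RAct a \<tau>) X),
     vcomp = (\<lambda>m n k a b. cls2 E Vert),
     hcomp = (\<lambda>m1 n1 m2 n2 a b. cls2 E Hor)\<rparr>"

definition prop_congruence ::
  "'r ring \<Rightarrow> ('r, 'q) pexp set \<Rightarrow> (('r, 'q) pexp \<times> ('r, 'q) pexp) set \<Rightarrow> bool" where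
  "prop_congruence R C E \<longleftrightarrow>
     equiv {a. pterm R C a} E \<and>
     (\<forall>(a, a')\<in>E. same_type a a' \<and>
        (ebdry R a, ebdry R a') \<in> E \<and>
        (\<forall>r\<in>carrier R. (Scale r a, Scale r a') \<in> E) \<and>
        (\<forall>\<sigma>. \<sigma> permutes {..<eouts a} \<longrightarrow> (LAct \<sigma> a, LAct \<sigma> a') \<in> E) \<and>
        (\<forall>\<tau>. \<tau> permutes {..<eins a} \<longrightarrow> (RAct a \<tau>, RAct a' \<tau>) \<in> E) \<and>
        (\<forall>(b, b')\<in>E.
           (same_type a b \<longrightarrow> (Add a b, Add a' b') \<in> E) \<and>
           (eins a = eouts b \<longrightarrow> (Vert a b, Vert a' b') \<in> E) \<and>
           (Hor a b, Hor a' b') \<in> E)) \<and>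
     unitless_prop R (quot_prop R C E)"

definition least_congruence :: "'r ring \<Rightarrow> ('r, 'q) pexp set \<Rightarrow>
    (('r, 'q) pexp \<times> ('r, 'q) pexp) set \<Rightarrow> (('r, 'q) pexp \<times> ('r, 'q) pexp) set" where
  "least_congruence R C E0 = \<Inter>{E. prop_congruence R C E \<and> E0 \<subseteq> E}"

text \<open>The cells adjoined to the stage with cells \<open>C\<close> and congruence \<open>E\<close>. The datatype holds an
  expression for the attaching cycle, so cells attached along equal cycles are identified by
  \<open>cell_eqs\<close>.\<close>

definition new_cells :: "'r ring \<Rightarrow> ('r, 'q) prop_data \<Rightarrow> nat \<Rightarrow> ('r, 'q) pexp set \<Rightarrow>
    (('r, 'q) pexp \<times> ('r, 'q) pexp) set \<Rightarrow> ('r, 'q) pexp set" where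
  "new_cells R Q k C E = {Cell k m n d z y | m n d z y.
     1 \<le> m \<and> 1 \<le> n \<and> 0 \<le> d \<and>
     z \<in> pterms R C m n (d - 1) \<and> (ebdry R z, Zero m n (d - 2)) \<in> E \<and>
     y \<in> pel Q m n d \<and> eaug Q z = bdry (pcx Q m n) d y}"

definition cell_eqs :: "nat \<Rightarrow> ('r, 'q) pexp set \<Rightarrow> (('r, 'q) pexp \<times> ('r, 'q) pexp) set \<Rightarrow>
    (('r, 'q) pexp \<times> ('r, 'q) pexp) set" where
  "cell_eqs k N E = {(Cell k m n d z y, Cell k m n d z' y) | m n d z z' y.
     Cell k m n d z y \<in> N \<and> Cell k m n d z' y \<in> N \<and> (z, z') \<in> E}"

primrec soa_stage :: "'r ring \<Rightarrow> ('r, 'q) prop_data \<Rightarrow> nat \<Rightarrow>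
    ('r, 'q) pexp set \<times> (('r, 'q) pexp \<times> ('r, 'q) pexp) set" where
  "soa_stage R Q 0 = ({}, least_congruence R {} {})"
| "soa_stage R Q (Suc k) = (let (C, E) = soa_stage R Q k; N = new_cells R Q k C E in
     (C \<union> N, least_congruence R (C \<union> N) (E \<union> cell_eqs k N E)))"

definition cofibrant_replacement ::
  "'r ring \<Rightarrow> ('r, 'q) prop_data \<Rightarrow> ('r, ('r, 'q) pexp set) prop_data" where
  "cofibrant_replacement R Q =
     quot_prop R (\<Union>k. fst (soa_stage R Q k)) (\<Union>k. snd (soa_stage R Q k))"


section \<open>Riemann surfaces with holes\<close>

record 'p surface =
  stop :: "'p topology"
  atlas :: "('p set \<times> ('p \<Rightarrow> complex)) set"

definition riemann_surface :: "('p, 'x) surface_scheme \<Rightarrow> bool" where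
  "riemann_surface X \<longleftrightarrow>
     Hausdorff_space (stop X) \<and>
     (\<Union>(U, \<phi>)\<in>atlas X. U) = topspace (stop X) \<and>
     (\<forall>(U, \<phi>)\<in>atlas X. openin (stop X) U \<and> open (\<phi> ` U) \<and>
        homeomorphic_map (subtopology (stop X) U) (top_of_set (\<phi> ` U)) \<phi>) \<and>
     (\<forall>(U, \<phi>)\<in>atlas X. \<forall>(V, \<psi>)\<in>atlas X. (\<psi> \<circ> inv_into U \<phi>) holomorphic_on \<phi> ` (U \<inter> V))"

definition plane :: "complex surface" where
  "plane = \<lparr>stop = euclidean, atlas = {(UNIV, id)}\<rparr>"

text \<open>\<open>f\<close> is a holomorphic map from the open subset \<open>W\<close> of \<open>X\<close> to \<open>Y\<close>.\<close>

definition holo_map ::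
  "('p, 'x) surface_scheme \<Rightarrow> 'p set \<Rightarrow> ('q, 'y) surface_scheme \<Rightarrow> ('p \<Rightarrow> 'q) \<Rightarrow> bool" where
  "holo_map X W Y f \<longleftrightarrow>
     openin (stop X) W \<and>
     continuous_map (subtopology (stop X) W) (stop Y) f \<and>
     (\<forall>(U, \<phi>)\<in>atlas X. \<forall>(V, \<psi>)\<in>atlas Y.
        (\<psi> \<circ> f \<circ> inv_into U \<phi>) holomorphic_on \<phi> ` {x \<in> U \<inter> W. f x \<in> V})"

text \<open>A biholomorphic map from the closed unit disk onto its image extends by definition to a
  biholomorphic map on an open neighbourhood of the disk. The values of the data \<open>h\<close> outside of the
  closed disk carry no meaning.\<close>

definition hole :: "('p, 'x) surface_scheme \<Rightarrow> (complex \<Rightarrow> 'p) \<Rightarrow> bool" where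
  "hole X h \<longleftrightarrow> (\<exists>W g. open W \<and> cball 0 1 \<subseteq> W \<and> inj_on g W \<and> holo_map plane W X g \<and>
     (\<forall>z\<in>cball 0 1. g z = h z))"

record 'p holed_surface = "'p surface" +
  outs :: "nat \<Rightarrow> complex \<Rightarrow> 'p"
  ins :: "nat \<Rightarrow> complex \<Rightarrow> 'p"

text \<open>A closed surface, of any genus and possibly disconnected, with \<open>m\<close> output and \<open>n\<close> input holes
  whose closed disks are pairwise disjoint.\<close>

definition holed :: "nat \<Rightarrow> nat \<Rightarrow> 'p holed_surface \<Rightarrow> bool" where
  "holed m n M \<longleftrightarrow>
     riemann_surface M \<and> compact_space (stop M) \<and>
     (\<forall>i<m. hole M (outs M i)) \<and> (\<forall>j<n. hole M (ins M j)) \<and>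
     (\<forall>i<m. \<forall>i'<m. i \<noteq> i' \<longrightarrow> outs M i ` cball 0 1 \<inter> outs M i' ` cball 0 1 = {}) \<and>
     (\<forall>j<n. \<forall>j'<n. j \<noteq> j' \<longrightarrow> ins M j ` cball 0 1 \<inter> ins M j' ` cball 0 1 = {}) \<and>
     (\<forall>i<m. \<forall>j<n. outs M i ` cball 0 1 \<inter> ins M j ` cball 0 1 = {})"

definition holes_match ::
  "nat \<Rightarrow> nat \<Rightarrow> 'p holed_surface \<Rightarrow> 'q holed_surface \<Rightarrow> ('p \<Rightarrow> 'q) \<Rightarrow> bool" where
  "holes_match m n M M' F \<longleftrightarrow>
     (\<forall>i<m. \<forall>z\<in>cball 0 1. F (outs M i z) = outs M' i z) \<and>
     (\<forall>j<n. \<forall>z\<in>cball 0 1. F (ins M j z) = ins M' j z)"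

definition holed_iso :: "nat \<Rightarrow> nat \<Rightarrow> 'p holed_surface \<Rightarrow> 'q holed_surface \<Rightarrow> bool" where
  "holed_iso m n M M' \<longleftrightarrow> (\<exists>F G. homeomorphic_maps (stop M) (stop M') F G \<and>
     holo_map M (topspace (stop M)) M' F \<and> holo_map M' (topspace (stop M')) M G \<and>
     holes_match m n M M' F)"

text \<open>A compact surface has at most continuum many points, so every isomorphism class has
  representatives with points in \<^typ>\<open>real\<close>.\<close>

type_synonym seg_point = "real holed_surface set"

definition seg_class :: "nat \<Rightarrow> nat \<Rightarrow> real holed_surface \<Rightarrow> seg_point" where
  "seg_class m n M = {M'. holed m n M' \<and> holed_iso m n M M'}"

definition seg_points :: "nat \<Rightarrow> nat \<Rightarrow> seg_point set" where
  "seg_points m n = seg_class m n ` {M. holed m n M}"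


subsection \<open>The topology of the moduli space\<close>

text \<open>The Teichmueller topology. \<open>F\<close> is an orientation preserving \<open>C\<^sup>1\<close> diffeomorphism that carries
  holes to holes and whose Beltrami coefficient \<open>F_zbar / F_z\<close> has absolute value at most
  \<open>\<epsilon>\<close>; the functions \<open>a\<close> and \<open>b\<close> are \<open>F_z\<close> and \<open>F_zbar\<close> in local coordinates.\<close>

definition almost_holo ::
  "nat \<Rightarrow> nat \<Rightarrow> real \<Rightarrow> 'p holed_surface \<Rightarrow> 'q holed_surface \<Rightarrow> ('p \<Rightarrow> 'q) \<Rightarrow> bool" where
  "almost_holo m n \<epsilon> M M' F \<longleftrightarrow>
     homeomorphic_map (stop M) (stop M') F \<and> holes_match m n M M' F \<and>
     (\<forall>(U, \<phi>)\<in>atlas M. \<forall>(V, \<psi>)\<in>atlas M'. \<exists>a b.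
        let Z = \<phi> ` {x \<in> U. F x \<in> V} in
        continuous_on Z a \<and> continuous_on Z b \<and>
        (\<forall>z\<in>Z. ((\<psi> \<circ> F \<circ> inv_into U \<phi>) has_derivative (\<lambda>v. a z * v + b z * cnj v)) (at z) \<and>
           a z \<noteq> 0 \<and> norm (b z) \<le> \<epsilon> * norm (a z)))"

definition seg_near :: "nat \<Rightarrow> nat \<Rightarrow> real \<Rightarrow> seg_point \<Rightarrow> seg_point \<Rightarrow> bool" where
  "seg_near m n \<epsilon> X Y \<longleftrightarrow> (\<exists>M\<in>X. \<exists>M'\<in>Y. \<exists>F. almost_holo m n \<epsilon> M M' F)"

definition seg_open :: "nat \<Rightarrow> nat \<Rightarrow> seg_point set \<Rightarrow> bool" where
  "seg_open m n \<U> \<longleftrightarrow> \<U> \<subseteq> seg_points m n \<and>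
     (\<forall>X\<in>\<U>. \<exists>\<epsilon>>0. \<epsilon> < 1 \<and> (\<forall>Y\<in>seg_points m n. seg_near m n \<epsilon> X Y \<longrightarrow> Y \<in> \<U>))"

definition seg_topology :: "nat \<Rightarrow> nat \<Rightarrow> seg_point topology" where
  "seg_topology m n = topology (seg_open m n)"

lemma seg_near_mono:
  assumes "seg_near m n \<epsilon> X Y" "\<epsilon> \<le> \<delta>"
  shows "seg_near m n \<delta> X Y"
proof -
  have "\<epsilon> * norm w \<le> \<delta> * norm w" for w :: complex
    using assms(2) by (simp add: mult_right_mono)
  then have *: "norm v \<le> \<epsilon> * norm w \<Longrightarrow> norm v \<le> \<delta> * norm w" for v w :: complex
    using order_trans by blast
  show ?thesis
    using assms(1) unfolding seg_near_def almost_holo_def Let_def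
    by (smt (verit) * case_prodI2 case_prod_conv)
qed

lemma istopology_seg_open: "istopology (seg_open m n)"
  unfolding istopology_def
proof (intro conjI allI impI)
  fix \<U> \<V> assume U: "seg_open m n \<U>" and V: "seg_open m n \<V>"
  show "seg_open m n (\<U> \<inter> \<V>)"
    unfolding seg_open_def
  proof (intro conjI ballI)
    show "\<U> \<inter> \<V> \<subseteq> seg_points m n"
      using U by (auto simp: seg_open_def)
    fix X assume "X \<in> \<U> \<inter> \<V>"
    then obtain \<epsilon> \<delta> where "\<epsilon> > 0" "\<epsilon> < 1" "\<delta> > 0"
      and 1: "\<And>Y. Y \<in> seg_points m n \<Longrightarrow> seg_near m n \<epsilon> X Y \<Longrightarrow> Y \<in> \<U>"
      and 2: "\<And>Y. Y \<in> seg_points m n \<Longrightarrow> seg_near m n \<delta> X Y \<Longrightarrow> Y \<in> \<V>"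
      using U V unfolding seg_open_def by (metis IntD1 IntD2)
    then show "\<exists>\<epsilon>>0. \<epsilon> < 1 \<and> (\<forall>Y\<in>seg_points m n. seg_near m n \<epsilon> X Y \<longrightarrow> Y \<in> \<U> \<inter> \<V>)"
      by (intro exI [of _ "min \<epsilon> \<delta>"])
        (auto intro!: 1 2 elim!: seg_near_mono)
  qed
next
  fix \<K> assume "\<forall>K\<in>\<K>. seg_open m n K"
  then show "seg_open m n (\<Union>\<K>)"
    unfolding seg_open_def by (simp add: Sup_le_iff) (metis UnionI)
qed


subsection \<open>The operations of the Segal PROP\<close>

text \<open>\<open>S\<close> results from \<open>M\<close> and \<open>N\<close> by removing the interiors of the input holes of \<open>M\<close> and of the
  output holes of \<open>N\<close> and sewing the boundary circles of equal label by \<open>z w = 1\<close> in the hole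
  coordinates. The maps \<open>p\<close> and \<open>q\<close> embed the two pieces in \<open>S\<close>. Along a seam, the coordinate of
  the sewn surface is the coordinate of \<open>M\<close> on the outer side of the unit circle, and the inverse of
  that of \<open>N\<close> on the inner side; here \<open>g\<close> and \<open>h\<close> extend the holes to a larger disk.\<close>

definition sewn :: "nat \<Rightarrow> nat \<Rightarrow> nat \<Rightarrow>
    'p holed_surface \<Rightarrow> 'p holed_surface \<Rightarrow> 'p holed_surface \<Rightarrow> bool" where
  "sewn m n k M N S \<longleftrightarrow> holed m k S \<and> (\<exists>p q.
     let DM = topspace (stop M) - (\<Union>j<n. ins M j ` ball 0 1);
         DN = topspace (stop N) - (\<Union>j<n. outs N j ` ball 0 1);
         IM = topspace (stop M) - (\<Union>j<n. ins M j ` cball 0 1);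
         IN = topspace (stop N) - (\<Union>j<n. outs N j ` cball 0 1)
     in continuous_map (subtopology (stop M) DM) (stop S) p \<and> inj_on p DM \<and>
        continuous_map (subtopology (stop N) DN) (stop S) q \<and> inj_on q DN \<and>
        p ` DM \<union> q ` DN = topspace (stop S) \<and>
        (\<forall>x\<in>DM. \<forall>y\<in>DN. p x = q y \<longleftrightarrow>
           (\<exists>j<n. \<exists>z. norm z = 1 \<and> x = ins M j z \<and> y = outs N j (1 / z))) \<and>
        holo_map M IM S p \<and> holo_map N IN S q \<and>
        (\<forall>j<n. \<exists>\<rho>>1. \<exists>g h.
           inj_on g (ball 0 \<rho>) \<and> holo_map plane (ball 0 \<rho>) M g \<and>
           (\<forall>z\<in>cball 0 1. g z = ins M j z) \<and> g ` (ball 0 \<rho> - cball 0 1) \<subseteq> IM \<and>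
           inj_on h (ball 0 \<rho>) \<and> holo_map plane (ball 0 \<rho>) N h \<and>
           (\<forall>z\<in>cball 0 1. h z = outs N j z) \<and> h ` (ball 0 \<rho> - cball 0 1) \<subseteq> IN \<and>
           holo_map plane {w. 1 / \<rho> < norm w \<and> norm w < \<rho>} S
             (\<lambda>w. if 1 \<le> norm w then p (g w) else q (h (1 / w)))) \<and>
        (\<forall>i<m. \<forall>z\<in>cball 0 1. outs S i z = p (outs M i z)) \<and>
        (\<forall>j<k. \<forall>z\<in>cball 0 1. ins S j z = q (ins N j z)))"

definition disjoint_sum :: "nat \<Rightarrow> nat \<Rightarrow> nat \<Rightarrow> nat \<Rightarrow>
    'p holed_surface \<Rightarrow> 'p holed_surface \<Rightarrow> 'p holed_surface \<Rightarrow> bool" where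
  "disjoint_sum m1 n1 m2 n2 M N S \<longleftrightarrow> holed (m1 + m2) (n1 + n2) S \<and> (\<exists>p q.
     holo_map M (topspace (stop M)) S p \<and> inj_on p (topspace (stop M)) \<and>
     holo_map N (topspace (stop N)) S q \<and> inj_on q (topspace (stop N)) \<and>
     p ` topspace (stop M) \<inter> q ` topspace (stop N) = {} \<and>
     p ` topspace (stop M) \<union> q ` topspace (stop N) = topspace (stop S) \<and>
     (\<forall>z\<in>cball 0 1.
        (\<forall>i<m1. outs S i z = p (outs M i z)) \<and> (\<forall>i<m2. outs S (m1 + i) z = q (outs N i z)) \<and>
        (\<forall>j<n1. ins S j z = p (ins M j z)) \<and> (\<forall>j<n2. ins S (n1 + j) z = q (ins N j z))))"

definition seg_vcomp :: "nat \<Rightarrow> nat \<Rightarrow> nat \<Rightarrow> seg_point \<Rightarrow> seg_point \<Rightarrow> seg_point" where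
  "seg_vcomp m n k X Y = {S. \<exists>M\<in>X. \<exists>N\<in>Y. sewn m n k M N S}"

definition seg_hcomp :: "nat \<Rightarrow> nat \<Rightarrow> nat \<Rightarrow> nat \<Rightarrow> seg_point \<Rightarrow> seg_point \<Rightarrow> seg_point" where
  "seg_hcomp m1 n1 m2 n2 X Y = {S. \<exists>M\<in>X. \<exists>N\<in>Y. disjoint_sum m1 n1 m2 n2 M N S}"

definition seg_lact :: "(nat \<Rightarrow> nat) \<Rightarrow> seg_point \<Rightarrow> seg_point" where
  "seg_lact \<sigma> X = (\<lambda>M. M\<lparr>outs := outs M \<circ> inv_into UNIV \<sigma>\<rparr>) ` X"

definition seg_ract :: "seg_point \<Rightarrow> (nat \<Rightarrow> nat) \<Rightarrow> seg_point" where
  "seg_ract X \<tau> = (\<lambda>M. M\<lparr>ins := ins M \<circ> \<tau>\<rparr>) ` X"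


section \<open>Singular chains\<close>

definition sing_cx :: "'r ring \<Rightarrow> 'x topology \<Rightarrow> ('r, ((nat \<Rightarrow> real) \<Rightarrow> 'x) \<Rightarrow> 'r) cx" where
  "sing_cx R X = (let M = (\<lambda>d. free_module R (if d < 0 then {} else singular_simplex_set (nat d) X)) in
     \<lparr>md = M,
      bdry = (\<lambda>d. lin_ext R (M (d - 1)) (\<lambda>s.
        if d \<le> 0 then \<zero>\<^bsub>M (d - 1)\<^esub>
        else \<Oplus>\<^bsub>M (d - 1)\<^esub>k\<in>{..nat d}. ksgn (M (d - 1)) (int k) (free_gen R (singular_face (nat d) k s))))\<rparr>)"

definition sing_map :: "'r ring \<Rightarrow> 'y topology \<Rightarrow> int \<Rightarrow> ('x \<Rightarrow> 'y) \<Rightarrow>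
    (((nat \<Rightarrow> real) \<Rightarrow> 'x) \<Rightarrow> 'r) \<Rightarrow> ((nat \<Rightarrow> real) \<Rightarrow> 'y) \<Rightarrow> 'r" where
  "sing_map R Y d h = lin_ext R (md (sing_cx R Y) d) (\<lambda>s. free_gen R (simplex_map (nat d) h s))"

text \<open>The affine map from the standard \<open>N\<close>-simplex induced by a map \<open>\<alpha>\<close> of vertices.\<close>

definition vertex_map :: "nat \<Rightarrow> (nat \<Rightarrow> nat) \<Rightarrow> (nat \<Rightarrow> real) \<Rightarrow> nat \<Rightarrow> real" where
  "vertex_map N \<alpha> x = (\<lambda>j. \<Sum>i\<in>{i. i \<le> N \<and> \<alpha> i = j}. x i)"

text \<open>Singular chains are a lax symmetric monoidal functor by the Eilenberg--Zilber shuffle product.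
  A \<open>(p, q)\<close>-shuffle is a lattice path from \<open>(0, 0)\<close> to \<open>(p, q)\<close>, given by the set
  \<open>A \<subseteq> {0, \<dots>, p + q - 1}\<close> of its steps in the first direction; its sign counts the steps in the
  second direction that precede a step in the first. The product of \<open>s\<close> and \<open>t\<close> is composed with a
  map \<open>h\<close> of two variables.\<close>

definition shuffle_simplex :: "nat \<Rightarrow> nat set \<Rightarrow> ('x \<Rightarrow> 'y \<Rightarrow> 'z) \<Rightarrow>
    ((nat \<Rightarrow> real) \<Rightarrow> 'x) \<Rightarrow> ((nat \<Rightarrow> real) \<Rightarrow> 'y) \<Rightarrow> (nat \<Rightarrow> real) \<Rightarrow> 'z" where
  "shuffle_simplex N A h s t = (\<lambda>x\<in>standard_simplex N.
     h (s (vertex_map N (\<lambda>i. card (A \<inter> {..<i})) x)) (t (vertex_map N (\<lambda>i. card ({..<i} - A)) x)))"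

definition sing_prod :: "'r ring \<Rightarrow> 'z topology \<Rightarrow> int \<Rightarrow> int \<Rightarrow> ('x \<Rightarrow> 'y \<Rightarrow> 'z) \<Rightarrow>
    (((nat \<Rightarrow> real) \<Rightarrow> 'x) \<Rightarrow> 'r) \<Rightarrow> (((nat \<Rightarrow> real) \<Rightarrow> 'y) \<Rightarrow> 'r) \<Rightarrow> ((nat \<Rightarrow> real) \<Rightarrow> 'z) \<Rightarrow> 'r" where
  "sing_prod R Z p q h c e = (let M = md (sing_cx R Z) (p + q); N = nat p + nat q in
     lin_ext R M (\<lambda>s. lin_ext R M (\<lambda>t.
       \<Oplus>\<^bsub>M\<^esub>A\<in>{A. A \<subseteq> {..<N} \<and> card A = nat p}.
         ksgn M (int (card {(i, j). i < j \<and> j < N \<and> i \<notin> A \<and> j \<in> A}))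
           (free_gen R (shuffle_simplex N A h s t))) e) c)"


section \<open>Homotopy topological conformal field theories\<close>

type_synonym 'r seg_chain = "((nat \<Rightarrow> real) \<Rightarrow> seg_point) \<Rightarrow> 'r"

definition segal_chains :: "'r ring \<Rightarrow> ('r, 'r seg_chain) prop_data" where
  "segal_chains R = \<lparr>
     pcx = (\<lambda>m n. sing_cx R (seg_topology m n)),
     lact = (\<lambda>m n d \<sigma>. sing_map R (seg_topology m n) d (seg_lact \<sigma>)),
     ract = (\<lambda>m n d c \<tau>. sing_map R (seg_topology m n) d (\<lambda>X. seg_ract X \<tau>) c),
     vcomp = (\<lambda>m n k a b. sing_prod R (seg_topology m k) a b (seg_vcomp m n k)),
     hcomp = (\<lambda>m1 n1 m2 n2 a b.
       sing_prod R (seg_topology (m1 + m2) (n1 + n2)) a b (seg_hcomp m1 n1 m2 n2))\<rparr>"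

type_synonym 'r segal_inf_elem = "('r, 'r seg_chain) pexp set"

definition segal_inf :: "'r ring \<Rightarrow> ('r, 'r segal_inf_elem) prop_data" where
  "segal_inf R = cofibrant_replacement R (segal_chains R)"

type_synonym ('r, 'a) htcft_structure =
  "nat \<Rightarrow> nat \<Rightarrow> int \<Rightarrow> 'r segal_inf_elem \<Rightarrow> int \<Rightarrow> ('r, 'a) tensor \<Rightarrow> ('r, 'a) tensor"

definition htcft :: "'r ring \<Rightarrow> ('r, 'a) cx \<Rightarrow> ('r, 'a) htcft_structure \<Rightarrow> bool" where
  "htcft R A \<alpha> \<longleftrightarrow> prop_algebra R (segal_inf R) A \<alpha>"

definition htcft_hom :: "'r ring \<Rightarrow> ('r, 'a) cx \<Rightarrow> ('r, 'b) cx \<Rightarrow>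
    ('r, 'a) htcft_structure \<Rightarrow> ('r, 'b) htcft_structure \<Rightarrow> (int \<Rightarrow> 'a \<Rightarrow> 'b) \<Rightarrow> bool" where
  "htcft_hom R A B \<alpha> \<beta> f \<longleftrightarrow> prop_algebra_hom R (segal_inf R) A B \<alpha> \<beta> f"

end

theory Submission
  imports Defs
begin

text \<open>Since PROPs here have no units, an algebra structure \<open>\<alpha>\<close> on \<open>A\<close> can be transferred strictly along
  chain maps \<open>i : A \<rightarrow> B\<close> and \<open>p : B \<rightarrow> A\<close> with \<open>p i = id\<close>: the formula \<open>\<beta>(x) = i\<^sup>\<otimes>\<^sup>m \<alpha>(x) p\<^sup>\<otimes>\<^sup>n\<close> respects
  all operations, and both \<open>i\<close> and \<open>p\<close> become morphisms of algebras. This holds over every PROP, so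
  neither cofibrancy nor the Segal PROP itself plays a role. Over a field, a subcomplex \<open>V\<close> of \<open>B\<close> has a
  complementary subcomplex as soon as the connecting homomorphism of \<open>V \<rightarrow> B \<rightarrow> B/V\<close> vanishes. Applied to
  the image of an injective quasi-isomorphism this gives a chain retraction, and applied to the kernel of
  a surjective one a chain section.\<close>

section \<open>Linear maps, free modules and quotients\<close>

text \<open>Conjugation by \<open>i\<close> and \<open>p\<close> would send a unit to
  \<open>i p\<close>, which need not be the identity; this is why the absence of units matters.
  Between two vertically composed operations the formula inserts \<open>p i\<close> in every tensor
  factor, so \<open>p i = id\<close> has to hold strictly, and a homotopy inverse of
  \<open>f\<close> would not do. Both claims use the same transfer: in (1) \<open>f\<close> is
  \<open>i\<close> and a retraction is \<open>p\<close>; in (2) \<open>f\<close> is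
  \<open>p\<close>, a section is \<open>i\<close>, and the structure travels from \<open>B\<close>
  to \<open>A\<close>. The difficulty in splitting is that linear complements chosen degree by
  degree need not be closed under the boundary. The choice in one degree must leave room for the
  boundaries coming from the next one, and the vanishing of the connecting homomorphism makes this
  possible. Tensor powers are quotients of free modules, and maps out of them are singled out by
  their values on elementary tensors. Hence a formula on lists can be evaluated only once it is
  known to be multilinear, and identities between linear maps are tested on elementary
  tensors.\<close>

lemma (in abelian_group) minus_eq_iff:
  "x \<in> carrier G \<Longrightarrow> y \<in> carrier G \<Longrightarrow> z \<in> carrier G \<Longrightarrow> x \<ominus> y = z \<longleftrightarrow> x = z \<oplus> y"
  unfolding a_minus_def by (rule add.inv_solve_right')

lemma (in abelian_group) minus_eq_zero_iff:
  "x \<in> carrier G \<Longrightarrow> y \<in> carrier G \<Longrightarrow> x \<ominus> y = \<zero> \<longleftrightarrow> x = y"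
  by (simp add: minus_eq_iff)

lemma lin_mapsI:
  assumes "\<And>x. x \<in> carrier M \<Longrightarrow> h x \<in> carrier N"
    and "\<And>x y. x \<in> carrier M \<Longrightarrow> y \<in> carrier M \<Longrightarrow> h (x \<oplus>\<^bsub>M\<^esub> y) = h x \<oplus>\<^bsub>N\<^esub> h y"
    and "\<And>r x. r \<in> carrier R \<Longrightarrow> x \<in> carrier M \<Longrightarrow> h (r \<odot>\<^bsub>M\<^esub> x) = r \<odot>\<^bsub>N\<^esub> h x"
  shows "h \<in> lin_maps R M N"
  using assms by (auto simp: lin_maps_def)

lemma lin_maps_closed [intro]: "h \<in> lin_maps R M N \<Longrightarrow> x \<in> carrier M \<Longrightarrow> h x \<in> carrier N"
  by (auto simp: lin_maps_def)

lemma lin_maps_add: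
  "h \<in> lin_maps R M N \<Longrightarrow> x \<in> carrier M \<Longrightarrow> y \<in> carrier M \<Longrightarrow> h (x \<oplus>\<^bsub>M\<^esub> y) = h x \<oplus>\<^bsub>N\<^esub> h y"
  by (auto simp: lin_maps_def)

lemma lin_maps_smult:
  "h \<in> lin_maps R M N \<Longrightarrow> r \<in> carrier R \<Longrightarrow> x \<in> carrier M \<Longrightarrow> h (r \<odot>\<^bsub>M\<^esub> x) = r \<odot>\<^bsub>N\<^esub> h x"
  by (auto simp: lin_maps_def)

text \<open>\<open>lin_maps\<close> sees only values on the carrier. Lifts and components of an
  internal hom are cut off to be extensional, while linearity is established for the formula behind
  them; this passes from one to the other.\<close>

lemma lin_maps_eqI:
  assumes "module R M" "k \<in> lin_maps R M N" "\<And>x. x \<in> carrier M \<Longrightarrow> h x = k x"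
  shows "h \<in> lin_maps R M N"
proof -
  interpret M: module R M by fact
  show ?thesis using assms(2,3) by (auto simp: lin_maps_def Pi_def)
qed

lemma lin_maps_comp:
  "h \<in> lin_maps R M N \<Longrightarrow> k \<in> lin_maps R N K \<Longrightarrow> (\<lambda>x. k (h x)) \<in> lin_maps R M K"
  by (auto simp: lin_maps_def Pi_def)

lemma lin_maps_id: "(\<lambda>x. x) \<in> lin_maps R M M"
  by (auto simp: lin_maps_def)

lemma lin_maps_zero:
  assumes "module R M" "module R N" "h \<in> lin_maps R M N"
  shows "h \<zero>\<^bsub>M\<^esub> = \<zero>\<^bsub>N\<^esub>"
proof -
  interpret M: module R M by fact
  interpret N: module R N by fact
  have "h (\<zero>\<^bsub>R\<^esub> \<odot>\<^bsub>M\<^esub> \<zero>\<^bsub>M\<^esub>) = \<zero>\<^bsub>R\<^esub> \<odot>\<^bsub>N\<^esub> h \<zero>\<^bsub>M\<^esub>"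
    using assms(3) by (intro lin_maps_smult) auto
  then show ?thesis using lin_maps_closed[OF assms(3)] by simp
qed

lemma lin_maps_neg:
  assumes "module R M" "module R N" "h \<in> lin_maps R M N" "x \<in> carrier M"
  shows "h (\<ominus>\<^bsub>M\<^esub> x) = \<ominus>\<^bsub>N\<^esub> h x"
proof -
  interpret M: module R M by fact
  interpret N: module R N by fact
  have "h (\<ominus>\<^bsub>M\<^esub> x) \<oplus>\<^bsub>N\<^esub> h x = h (\<ominus>\<^bsub>M\<^esub> x \<oplus>\<^bsub>M\<^esub> x)"
    using assms by (simp add: lin_maps_add)
  also have "\<dots> = \<zero>\<^bsub>N\<^esub>"
    using assms by (simp add: M.M.l_neg lin_maps_zero)
  finally show ?thesis
    using assms lin_maps_closed[OF assms(3)] by (intro N.M.minus_equality [symmetric]) auto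
qed

lemma lin_maps_minus:
  assumes "module R M" "module R N" "h \<in> lin_maps R M N" "x \<in> carrier M" "y \<in> carrier M"
  shows "h (x \<ominus>\<^bsub>M\<^esub> y) = h x \<ominus>\<^bsub>N\<^esub> h y"
proof -
  interpret M: module R M by fact
  show ?thesis
    using assms by (simp add: a_minus_def lin_maps_add lin_maps_neg)
qed

lemma ksgn_closed [intro]: "module R M \<Longrightarrow> x \<in> carrier M \<Longrightarrow> ksgn M i x \<in> carrier M"
  unfolding ksgn_def by (auto dest: module.axioms(2) intro: abelian_group.a_inv_closed)

lemma lin_maps_ksgn:
  assumes "module R M" "module R N" "h \<in> lin_maps R M N" "x \<in> carrier M"
  shows "h (ksgn M i x) = ksgn N i (h x)"
  using assms by (simp add: ksgn_def lin_maps_neg)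

lemma ksgn_lin:
  assumes "module R M"
  shows "ksgn M i \<in> lin_maps R M M"
proof -
  interpret M: module R M by fact
  show ?thesis
    by (rule lin_mapsI) (auto simp: ksgn_def M.M.minus_add M.smult_r_minus)
qed

lemma lin_maps_finsum:
  assumes "module R M" "module R N" "h \<in> lin_maps R M N" "finite S" "g \<in> S \<rightarrow> carrier M"
  shows "h (\<Oplus>\<^bsub>M\<^esub>s\<in>S. g s) = (\<Oplus>\<^bsub>N\<^esub>s\<in>S. h (g s))"
proof -
  interpret M: module R M by fact
  interpret N: module R N by fact
  show ?thesis
    using assms(4,5)
  proof (induction S rule: finite_induct)
    case empty
    then show ?case using assms by (simp add: lin_maps_zero)
  next
    case (insert s S)
    then have "g \<in> S \<rightarrow> carrier M" "g s \<in> carrier M" by auto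
    with insert show ?case
      using lin_maps_closed[OF assms(3)]
      by (simp add: lin_maps_add[OF assms(3)] M.M.finsum_closed Pi_iff)
  qed
qed

lemma lin_maps_plus:
  assumes "module R M" "h \<in> lin_maps R K M" "k \<in> lin_maps R K M"
  shows "(\<lambda>x. h x \<oplus>\<^bsub>M\<^esub> k x) \<in> lin_maps R K M"
proof -
  interpret M: module R M by fact
  show ?thesis
    using lin_maps_closed[OF assms(2)] lin_maps_closed[OF assms(3)]
    by (intro lin_mapsI)
      (simp_all add: lin_maps_add[OF assms(2)] lin_maps_add[OF assms(3)] lin_maps_smult[OF assms(2)]
        lin_maps_smult[OF assms(3)] M.smult_r_distr M.M.add.m_ac)
qed

lemma lin_maps_scale:
  assumes "module R M" "h \<in> lin_maps R K M" "r \<in> carrier R"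
  shows "(\<lambda>x. r \<odot>\<^bsub>M\<^esub> h x) \<in> lin_maps R K M"
proof -
  interpret M: module R M by fact
  show ?thesis
    using lin_maps_closed[OF assms(2)] assms(3)
    by (intro lin_mapsI)
      (simp_all add: lin_maps_add[OF assms(2)] lin_maps_smult[OF assms(2)] M.smult_r_distr
        M.R.m_comm flip: M.smult_assoc1)
qed

lemma lin_maps_sum:
  assumes "module R M" "finite S" and h: "\<And>j. j \<in> S \<Longrightarrow> h j \<in> lin_maps R K M"
  shows "(\<lambda>x. \<Oplus>\<^bsub>M\<^esub>j\<in>S. h j x) \<in> lin_maps R K M"
proof -
  interpret M: module R M by fact
  show ?thesis
  proof (rule lin_mapsI)
    show "(\<Oplus>\<^bsub>M\<^esub>j\<in>S. h j x) \<in> carrier M" if "x \<in> carrier K" for x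
      using lin_maps_closed[OF h that] by (intro M.M.finsum_closed) auto
    show "(\<Oplus>\<^bsub>M\<^esub>j\<in>S. h j (x \<oplus>\<^bsub>K\<^esub> y)) = (\<Oplus>\<^bsub>M\<^esub>j\<in>S. h j x) \<oplus>\<^bsub>M\<^esub> (\<Oplus>\<^bsub>M\<^esub>j\<in>S. h j y)"
      if "x \<in> carrier K" "y \<in> carrier K" for x y
    proof -
      have "(\<Oplus>\<^bsub>M\<^esub>j\<in>S. h j (x \<oplus>\<^bsub>K\<^esub> y)) = (\<Oplus>\<^bsub>M\<^esub>j\<in>S. h j x \<oplus>\<^bsub>M\<^esub> h j y)"
        using lin_maps_closed[OF h] lin_maps_add[OF h] that by (intro M.M.finsum_cong') auto
      then show ?thesis
        using lin_maps_closed[OF h] that assms(2) by (simp add: M.M.finsum_addf Pi_iff)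
    qed
    show "(\<Oplus>\<^bsub>M\<^esub>j\<in>S. h j (r \<odot>\<^bsub>K\<^esub> x)) = r \<odot>\<^bsub>M\<^esub> (\<Oplus>\<^bsub>M\<^esub>j\<in>S. h j x)"
      if "r \<in> carrier R" "x \<in> carrier K" for r x
    proof -
      have "(\<Oplus>\<^bsub>M\<^esub>j\<in>S. h j (r \<odot>\<^bsub>K\<^esub> x)) = (\<Oplus>\<^bsub>M\<^esub>j\<in>S. r \<odot>\<^bsub>M\<^esub> h j x)"
        using lin_maps_closed[OF h] lin_maps_smult[OF h] that by (intro M.M.finsum_cong') auto
      then show ?thesis
        using lin_maps_closed[OF h] that assms(2) by (simp add: M.finsum_smult_ldistr Pi_iff)
    qed
  qed
qed

subsection \<open>Submodules\<close>

lemma submodule_carrier: "module R M \<Longrightarrow> submodule N R M \<Longrightarrow> N \<subseteq> carrier M"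
  by (rule module.submoduleE(1))

lemma submodule_zero: "submodule N R M \<Longrightarrow> \<zero>\<^bsub>M\<^esub> \<in> N"
  using subgroup.one_closed[OF submodule.axioms(1)] by fastforce

lemma submodule_minus:
  assumes "module R M" "submodule N R M" "x \<in> N" "y \<in> N"
  shows "x \<ominus>\<^bsub>M\<^esub> y \<in> N"
  using module.submoduleE(3,5)[OF assms(1,2)] assms(3,4) by (simp add: a_minus_def)

lemma submodule_zero_mod:
  assumes "module R M"
  shows "submodule {\<zero>\<^bsub>M\<^esub>} R M"
proof -
  interpret M: module R M by fact
  show ?thesis by (rule M.submoduleI) auto
qed

lemma submodule_vimage:
  assumes "module R M" "module R N" "h \<in> lin_maps R M N" "submodule K R N"
  shows "submodule {x \<in> carrier M. h x \<in> K} R M"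
proof -
  interpret M: module R M by fact
  interpret N: module R N by fact
  show ?thesis
    using assms N.submoduleE(3,4,5)[OF assms(4)] submodule_zero[OF assms(4)]
    by (intro M.submoduleI)
      (auto simp: lin_maps_zero lin_maps_neg lin_maps_add lin_maps_smult)
qed

lemma submodule_image:
  assumes "module R M" "module R N" "h \<in> lin_maps R M N"
  shows "submodule (h ` carrier M) R N"
proof -
  interpret M: module R M by fact
  interpret N: module R N by fact
  show ?thesis
  proof (rule N.submoduleI)
    show "h ` carrier M \<subseteq> carrier N" using assms by auto
    show "\<zero>\<^bsub>N\<^esub> \<in> h ` carrier M"
      using lin_maps_zero[OF assms] by (metis M.M.zero_closed image_eqI)
    show "\<ominus>\<^bsub>N\<^esub> a \<in> h ` carrier M" if "a \<in> h ` carrier M" for a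
      using that lin_maps_neg[OF assms] by (metis (no_types, lifting) M.M.a_inv_closed image_iff)
    show "a \<oplus>\<^bsub>N\<^esub> b \<in> h ` carrier M" if "a \<in> h ` carrier M" "b \<in> h ` carrier M" for a b
      using that lin_maps_add[OF assms(3)] by (metis (no_types, lifting) M.M.add.m_closed image_iff)
    show "r \<odot>\<^bsub>N\<^esub> a \<in> h ` carrier M" if "r \<in> carrier R" "a \<in> h ` carrier M" for r a
      using that lin_maps_smult[OF assms(3)] by (metis (no_types, lifting) M.smult_closed image_iff)
  qed
qed

lemma submodule_gen_submodule:
  assumes "module R M" "X \<subseteq> carrier M"
  shows "submodule (submodule_gen R M X) R M"
proof -
  interpret M: module R M by fact
  show ?thesis
    unfolding submodule_gen_def
  proof (rule M.submoduleI)
    \<comment> \<open>The intersection is over a nonempty family, since \<open>carrier M\<close>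
      itself contains \<open>X\<close>.\<close>
    show "\<Inter>{N. submodule N R M \<and> X \<subseteq> N} \<subseteq> carrier M"
      using assms(2) M.carrier_is_submodule by auto
  qed (auto intro: submodule_zero M.submoduleE)
qed

lemma submodule_gen_incl: "X \<subseteq> submodule_gen R M X"
  unfolding submodule_gen_def by auto

lemma submodule_gen_least: "submodule N R M \<Longrightarrow> X \<subseteq> N \<Longrightarrow> submodule_gen R M X \<subseteq> N"
  unfolding submodule_gen_def by auto

subsection \<open>Free modules\<close>

lemma free_module_simps [simp]:
  "\<zero>\<^bsub>free_module R S\<^esub> = (\<lambda>s. \<zero>\<^bsub>R\<^esub>)"
  "c \<oplus>\<^bsub>free_module R S\<^esub> c' = (\<lambda>s. c s \<oplus>\<^bsub>R\<^esub> c' s)"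
  "r \<odot>\<^bsub>free_module R S\<^esub> c = (\<lambda>s. r \<otimes>\<^bsub>R\<^esub> c s)"
  by (simp_all add: free_module_def)

lemma free_module_carrier:
  "c \<in> carrier (free_module R S) \<longleftrightarrow>
     (\<forall>s. c s \<in> carrier R) \<and> (\<forall>s. s \<notin> S \<longrightarrow> c s = \<zero>\<^bsub>R\<^esub>) \<and> finite {s. c s \<noteq> \<zero>\<^bsub>R\<^esub>}"
  by (simp add: free_module_def)

lemma free_module_module:
  assumes "cring R"
  shows "module R (free_module R S)"
proof -
  interpret R: cring R by fact
  have add: "(\<lambda>s. c s \<oplus>\<^bsub>R\<^esub> c' s) \<in> carrier (free_module R S)"
    if "c \<in> carrier (free_module R S)" "c' \<in> carrier (free_module R S)" for c c'
  proof -
    have "{s. c s \<oplus>\<^bsub>R\<^esub> c' s \<noteq> \<zero>\<^bsub>R\<^esub>} \<subseteq> {s. c s \<noteq> \<zero>\<^bsub>R\<^esub>} \<union> {s. c' s \<noteq> \<zero>\<^bsub>R\<^esub>}" by auto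
    then show ?thesis
      using that unfolding free_module_carrier by (auto intro: finite_subset)
  qed
  have smult: "(\<lambda>s. r \<otimes>\<^bsub>R\<^esub> c s) \<in> carrier (free_module R S)"
    if "c \<in> carrier (free_module R S)" "r \<in> carrier R" for c r
  proof -
    have "{s. r \<otimes>\<^bsub>R\<^esub> c s \<noteq> \<zero>\<^bsub>R\<^esub>} \<subseteq> {s. c s \<noteq> \<zero>\<^bsub>R\<^esub>}" using that by auto
    then show ?thesis
      using that unfolding free_module_carrier by (auto intro: finite_subset)
  qed
  have car: "\<And>c s. c \<in> carrier (free_module R S) \<Longrightarrow> c s \<in> carrier R"
    by (auto simp: free_module_carrier)
  have "abelian_group (free_module R S)"
  proof (rule abelian_groupI)
    fix c assume c: "c \<in> carrier (free_module R S)"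
    show "\<exists>c'\<in>carrier (free_module R S). c' \<oplus>\<^bsub>free_module R S\<^esub> c = \<zero>\<^bsub>free_module R S\<^esub>"
    proof (rule bexI)
      show "(\<lambda>s. \<ominus>\<^bsub>R\<^esub> \<one>\<^bsub>R\<^esub> \<otimes>\<^bsub>R\<^esub> c s) \<oplus>\<^bsub>free_module R S\<^esub> c = \<zero>\<^bsub>free_module R S\<^esub>"
        using car[OF c] by (simp add: fun_eq_iff R.l_minus R.l_neg)
    qed (use c smult in auto)
  qed (auto simp: add car R.add.m_ac, auto simp: free_module_carrier)
  then show ?thesis
    by (intro moduleI)
      (auto simp: smult car R.l_distr R.r_distr R.m_assoc assms)
qed

lemma free_gen_carrier:
  assumes "cring R" "s \<in> S"
  shows "free_gen R s \<in> carrier (free_module R S)"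
proof -
  interpret R: cring R by fact
  have "{t. free_gen R s t \<noteq> \<zero>\<^bsub>R\<^esub>} \<subseteq> {s}" by (auto simp: free_gen_def)
  then show ?thesis
    using assms(2) unfolding free_module_carrier by (auto simp: free_gen_def intro: finite_subset)
qed

text \<open>Induction on the finite support, splitting off one coefficient at a time. It is what
  makes a linear map determined by its values on generators.\<close>

lemma free_module_induct [consumes 2, case_names zero add]:
  assumes "cring R" and c: "c \<in> carrier (free_module R S)"
    and zero: "P \<zero>\<^bsub>free_module R S\<^esub>"
    and add: "\<And>c s r. c \<in> carrier (free_module R S) \<Longrightarrow> P c \<Longrightarrow> s \<in> S \<Longrightarrow> r \<in> carrier R \<Longrightarrow>
      P (c \<oplus>\<^bsub>free_module R S\<^esub> (r \<odot>\<^bsub>free_module R S\<^esub> free_gen R s))"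
  shows "P c"
proof -
  interpret R: cring R by fact
  have "finite {s. c s \<noteq> \<zero>\<^bsub>R\<^esub>}" using c by (simp add: free_module_carrier)
  then show ?thesis using c
  proof (induction "{s. c s \<noteq> \<zero>\<^bsub>R\<^esub>}" arbitrary: c rule: finite_induct)
    case empty
    then have "c = \<zero>\<^bsub>free_module R S\<^esub>" by (auto simp: fun_eq_iff)
    then show ?case using zero by simp
  next
    case (insert s T)
    \<comment> \<open>Erasing the coefficient at \<open>s\<close> leaves an element with support
      exactly \<open>T\<close>.\<close>
    let ?c = "c(s := \<zero>\<^bsub>R\<^esub>)"
    have T: "T = {t. ?c t \<noteq> \<zero>\<^bsub>R\<^esub>}" using insert.hyps by auto
    have c': "?c \<in> carrier (free_module R S)"
      using insert.prems insert.hyps(1) unfolding free_module_carrier T by auto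
    have s: "s \<in> S" "c s \<in> carrier R"
      using insert.hyps(4) insert.prems by (auto simp: free_module_carrier)
    have "P (?c \<oplus>\<^bsub>free_module R S\<^esub> (c s \<odot>\<^bsub>free_module R S\<^esub> free_gen R s))"
      using insert.hyps(3)[OF T c'] c' s by (intro add)
    also have "?c \<oplus>\<^bsub>free_module R S\<^esub> (c s \<odot>\<^bsub>free_module R S\<^esub> free_gen R s) = c"
      using insert.prems by (auto simp: fun_eq_iff free_gen_def free_module_carrier)
    finally show ?case .
  qed
qed

lemma free_module_ext:
  assumes "cring R" "module R M"
    and "h \<in> lin_maps R (free_module R S) M" "k \<in> lin_maps R (free_module R S) M"
    and "\<And>s. s \<in> S \<Longrightarrow> h (free_gen R s) = k (free_gen R s)"
    and "c \<in> carrier (free_module R S)"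
  shows "h c = k c"
  using assms(1,6)
proof (induction rule: free_module_induct)
  case zero
  show ?case
    using lin_maps_zero[OF free_module_module[OF assms(1)] assms(2)] assms(3,4) by metis
next
  case (add c s r)
  interpret F: module R "free_module R S" using assms(1) by (rule free_module_module)
  have g: "free_gen R s \<in> carrier (free_module R S)"
    using assms(1) add by (intro free_gen_carrier)
  then have rg: "r \<odot>\<^bsub>free_module R S\<^esub> free_gen R s \<in> carrier (free_module R S)"
    using add by (intro F.smult_closed)
  show ?case
    using add assms(5)[of s]
    by (simp only: lin_maps_add[OF assms(3) add(1) rg] lin_maps_add[OF assms(4) add(1) rg]
        lin_maps_smult[OF assms(3) _ g] lin_maps_smult[OF assms(4) _ g])
qed

text \<open>\<open>lin_ext\<close> sums over the support of its argument, which changes with the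
  argument. Summing over a finite superset makes the sums for different arguments
  comparable.\<close>

lemma lin_ext_superset:
  assumes "module R M" "c \<in> carrier (free_module R S)" "g \<in> S \<rightarrow> carrier M"
    and "finite T" "{s. c s \<noteq> \<zero>\<^bsub>R\<^esub>} \<subseteq> T" "T \<subseteq> S"
  shows "lin_ext R M g c = (\<Oplus>\<^bsub>M\<^esub>s\<in>T. c s \<odot>\<^bsub>M\<^esub> g s)"
proof -
  interpret M: module R M by fact
  show ?thesis
    unfolding lin_ext_def
    using assms(2-) by (intro M.add.finprod_mono_neutral_cong_left)
      (auto simp: free_module_carrier Pi_iff subset_iff)
qed

lemma lin_ext_lin:
  assumes "module R M" "g \<in> S \<rightarrow> carrier M"
  shows "lin_ext R M g \<in> lin_maps R (free_module R S) M"
proof -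
  interpret M: module R M by fact
  let ?F = "free_module R S"
  have supp: "finite {s. c s \<noteq> \<zero>\<^bsub>R\<^esub>}" "{s. c s \<noteq> \<zero>\<^bsub>R\<^esub>} \<subseteq> S" "\<And>s. c s \<in> carrier R"
    if "c \<in> carrier ?F" for c
    using that by (auto simp: free_module_carrier)
  interpret F: module R ?F using M.is_cring by (rule free_module_module)
  show ?thesis
  proof (rule lin_mapsI)
    fix c assume c: "c \<in> carrier ?F"
    show "lin_ext R M g c \<in> carrier M"
      unfolding lin_ext_def using supp(2,3)[OF c] assms(2)
      by (intro M.M.finsum_closed) (auto simp: Pi_iff subset_iff)
  next
    fix c c' assume c: "c \<in> carrier ?F" "c' \<in> carrier ?F"
    \<comment> \<open>Coefficients may cancel, so the support of the sum can be smaller than this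
      union.\<close>
    let ?T = "{s. c s \<noteq> \<zero>\<^bsub>R\<^esub>} \<union> {s. c' s \<noteq> \<zero>\<^bsub>R\<^esub>}"
    have T: "finite ?T" "?T \<subseteq> S" using c supp by auto
    have cc: "c \<oplus>\<^bsub>?F\<^esub> c' \<in> carrier ?F" using c by (rule F.M.a_closed)
    have "lin_ext R M g (c \<oplus>\<^bsub>?F\<^esub> c') = (\<Oplus>\<^bsub>M\<^esub>s\<in>?T. (c \<oplus>\<^bsub>?F\<^esub> c') s \<odot>\<^bsub>M\<^esub> g s)"
      by (rule lin_ext_superset[OF assms(1) cc assms(2) T(1) _ T(2)]) auto
    also have "\<dots> = (\<Oplus>\<^bsub>M\<^esub>s\<in>?T. c s \<odot>\<^bsub>M\<^esub> g s \<oplus>\<^bsub>M\<^esub> c' s \<odot>\<^bsub>M\<^esub> g s)"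
      using c T(2) assms(2) supp(3)
      by (intro M.M.finsum_cong') (auto simp: M.smult_l_distr Pi_iff subset_iff)
    also have "\<dots> = (\<Oplus>\<^bsub>M\<^esub>s\<in>?T. c s \<odot>\<^bsub>M\<^esub> g s) \<oplus>\<^bsub>M\<^esub> (\<Oplus>\<^bsub>M\<^esub>s\<in>?T. c' s \<odot>\<^bsub>M\<^esub> g s)"
      using c T assms(2) supp(3) by (intro M.M.finsum_addf) (auto simp: Pi_iff subset_iff)
    also have "\<dots> = lin_ext R M g c \<oplus>\<^bsub>M\<^esub> lin_ext R M g c'"
      using lin_ext_superset[OF assms(1) c(1) assms(2) T(1) _ T(2)]
        lin_ext_superset[OF assms(1) c(2) assms(2) T(1) _ T(2)] by auto
    finally show "lin_ext R M g (c \<oplus>\<^bsub>?F\<^esub> c') = lin_ext R M g c \<oplus>\<^bsub>M\<^esub> lin_ext R M g c'" .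
  next
    fix r c assume r: "r \<in> carrier R" and c: "c \<in> carrier ?F"
    let ?T = "{s. c s \<noteq> \<zero>\<^bsub>R\<^esub>}"
    have rc: "r \<odot>\<^bsub>?F\<^esub> c \<in> carrier ?F" using r c by (rule F.smult_closed)
    have "lin_ext R M g (r \<odot>\<^bsub>?F\<^esub> c) = (\<Oplus>\<^bsub>M\<^esub>s\<in>?T. (r \<odot>\<^bsub>?F\<^esub> c) s \<odot>\<^bsub>M\<^esub> g s)"
      using r c supp by (intro lin_ext_superset[OF assms(1) rc assms(2)]) auto
    also have "\<dots> = (\<Oplus>\<^bsub>M\<^esub>s\<in>?T. r \<odot>\<^bsub>M\<^esub> (c s \<odot>\<^bsub>M\<^esub> g s))"
      using c r assms(2) supp(2,3)
      by (intro M.M.finsum_cong') (auto simp: M.smult_assoc1 Pi_iff subset_iff)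
    also have "\<dots> = r \<odot>\<^bsub>M\<^esub> lin_ext R M g c"
      unfolding lin_ext_def
      using c r assms(2) supp
      by (intro M.finsum_smult_ldistr[symmetric]) (auto simp: Pi_iff subset_iff)
    finally show "lin_ext R M g (r \<odot>\<^bsub>?F\<^esub> c) = r \<odot>\<^bsub>M\<^esub> lin_ext R M g c" .
  qed
qed

lemma lin_ext_gen:
  assumes "module R M" "g \<in> S \<rightarrow> carrier M" "s \<in> S"
  shows "lin_ext R M g (free_gen R s) = g s"
proof -
  interpret M: module R M by fact
  have "lin_ext R M g (free_gen R s) = (\<Oplus>\<^bsub>M\<^esub>t\<in>{s}. free_gen R s t \<odot>\<^bsub>M\<^esub> g t)"
    using assms free_gen_carrier[OF M.is_cring assms(3)]
    by (intro lin_ext_superset) (auto simp: free_gen_def)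
  also have "\<dots> = g s"
    using assms by (auto simp: free_gen_def Pi_iff)
  finally show ?thesis .
qed

subsection \<open>Quotients\<close>

context
  fixes R :: "'r ring" and M :: "('r, 'a) module" and N
  assumes M: "module R M" and N: "submodule N R M"
begin

interpretation M: module R M by (rule M)

interpretation N: abelian_subgroup N M
  using submodule.axioms(1)[OF N] M.M.abelian_group_axioms
  by (intro abelian_subgroupI3) (auto simp: additive_subgroup_def)

lemma quot_module_carrier: "carrier (quot_module M N) = (\<lambda>x. N +>\<^bsub>M\<^esub> x) ` carrier M"
  by (auto simp: quot_module_def A_RCOSETS_def RCOSETS_def a_r_coset_def)

lemma quot_module_zero: "\<zero>\<^bsub>quot_module M N\<^esub> = N +>\<^bsub>M\<^esub> \<zero>\<^bsub>M\<^esub>"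
  using M.M.a_coset_add_zero[OF N.a_subset] by (simp add: quot_module_def)

lemma quot_module_add: "x \<in> carrier M \<Longrightarrow> y \<in> carrier M \<Longrightarrow>
    (N +>\<^bsub>M\<^esub> x) \<oplus>\<^bsub>quot_module M N\<^esub> (N +>\<^bsub>M\<^esub> y) = N +>\<^bsub>M\<^esub> (x \<oplus>\<^bsub>M\<^esub> y)"
  by (simp add: quot_module_def N.a_rcos_sum)

lemma coset_eq_iff: "x \<in> carrier M \<Longrightarrow> y \<in> carrier M \<Longrightarrow>
    N +>\<^bsub>M\<^esub> x = N +>\<^bsub>M\<^esub> y \<longleftrightarrow> x \<ominus>\<^bsub>M\<^esub> y \<in> N"
  unfolding a_minus_def
  using N.a_rcos_module[of y x] N.a_rcos_self[of x] N.a_repr_independence'[of x y] by auto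

text \<open>The scalar action on cosets is a union over all representatives. It is a single coset
  because \<open>N\<close> absorbs \<open>r\<close> times the difference of two
  representatives.\<close>

lemma quot_module_smult:
  assumes "r \<in> carrier R" "x \<in> carrier M"
  shows "r \<odot>\<^bsub>quot_module M N\<^esub> (N +>\<^bsub>M\<^esub> x) = N +>\<^bsub>M\<^esub> (r \<odot>\<^bsub>M\<^esub> x)"
proof -
  have eq: "N +>\<^bsub>M\<^esub> (r \<odot>\<^bsub>M\<^esub> y) = N +>\<^bsub>M\<^esub> (r \<odot>\<^bsub>M\<^esub> x)" if y: "y \<in> N +>\<^bsub>M\<^esub> x" for y
  proof -
    have yM: "y \<in> carrier M" using y assms(2) by (meson N.a_elemrcos_carrier)
    have "N +>\<^bsub>M\<^esub> y = N +>\<^bsub>M\<^esub> x"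
      using N.a_repr_independence'[OF y assms(2)] by simp
    then have "y \<ominus>\<^bsub>M\<^esub> x \<in> N" using coset_eq_iff assms yM by blast
    then have "r \<odot>\<^bsub>M\<^esub> (y \<ominus>\<^bsub>M\<^esub> x) \<in> N" using assms(1) M.submoduleE(4)[OF N] by blast
    also have "r \<odot>\<^bsub>M\<^esub> (y \<ominus>\<^bsub>M\<^esub> x) = r \<odot>\<^bsub>M\<^esub> y \<ominus>\<^bsub>M\<^esub> r \<odot>\<^bsub>M\<^esub> x"
      using assms yM by (simp add: a_minus_def M.smult_r_distr M.smult_r_minus)
    finally show ?thesis using coset_eq_iff assms yM by simp
  qed
  have "N +>\<^bsub>M\<^esub> x \<noteq> {}" using N.a_rcos_self[OF assms(2)] by blast
  then have "(\<Union>y\<in>N +>\<^bsub>M\<^esub> x. N +>\<^bsub>M\<^esub> (r \<odot>\<^bsub>M\<^esub> y)) = N +>\<^bsub>M\<^esub> (r \<odot>\<^bsub>M\<^esub> x)"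
    using eq by (rule SUP_eq_const)
  then show ?thesis by (simp add: quot_module_def)
qed

lemma quot_module_module: "module R (quot_module M N)"
proof -
  let ?Q = "quot_module M N"
  have "abelian_group ?Q"
  proof (rule abelian_groupI)
    fix X assume "X \<in> carrier ?Q"
    then obtain x where x: "x \<in> carrier M" "X = N +>\<^bsub>M\<^esub> x" by (auto simp: quot_module_carrier)
    show "\<exists>Y\<in>carrier ?Q. Y \<oplus>\<^bsub>?Q\<^esub> X = \<zero>\<^bsub>?Q\<^esub>"
      using x by (intro bexI[of _ "N +>\<^bsub>M\<^esub> (\<ominus>\<^bsub>M\<^esub> x)"])
        (auto simp: quot_module_carrier quot_module_add quot_module_zero M.M.l_neg)
  qed (auto simp: quot_module_carrier quot_module_add quot_module_zero M.M.add.m_ac)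
  then show ?thesis
    by (intro moduleI)
      (auto simp: quot_module_carrier quot_module_add quot_module_smult M.is_cring
        M.smult_l_distr M.smult_r_distr M.smult_assoc1)
qed

lemma quot_module_proj: "(\<lambda>x. N +>\<^bsub>M\<^esub> x) \<in> lin_maps R M (quot_module M N)"
  by (rule lin_mapsI) (auto simp: quot_module_carrier quot_module_add quot_module_smult)

text \<open>Values are computed on a chosen representative; two representatives differ by an element
  of \<open>N\<close>, which \<open>h\<close> kills. Only the values on cosets are exported, not the
  choice.\<close>

lemma quot_module_lift:
  assumes K: "module R K" and h: "h \<in> lin_maps R M K" and ker: "\<And>x. x \<in> N \<Longrightarrow> h x = \<zero>\<^bsub>K\<^esub>"
  obtains k where "k \<in> lin_maps R (quot_module M N) K"
    and "\<And>x. x \<in> carrier M \<Longrightarrow> k (N +>\<^bsub>M\<^esub> x) = h x"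
proof -
  interpret K: module R K by (rule K)
  define k where "k X = h (SOME x. x \<in> carrier M \<and> X = N +>\<^bsub>M\<^esub> x)" for X
  have k: "k (N +>\<^bsub>M\<^esub> x) = h x" if x: "x \<in> carrier M" for x
  proof -
    define y where "y = (SOME y. y \<in> carrier M \<and> N +>\<^bsub>M\<^esub> x = N +>\<^bsub>M\<^esub> y)"
    have y: "y \<in> carrier M" "N +>\<^bsub>M\<^esub> x = N +>\<^bsub>M\<^esub> y"
      using someI[of "\<lambda>y. y \<in> carrier M \<and> N +>\<^bsub>M\<^esub> x = N +>\<^bsub>M\<^esub> y" x] x by (auto simp: y_def)
    then have "h (x \<ominus>\<^bsub>M\<^esub> y) = \<zero>\<^bsub>K\<^esub>" using ker coset_eq_iff x by blast
    then have "h x \<ominus>\<^bsub>K\<^esub> h y = \<zero>\<^bsub>K\<^esub>" using lin_maps_minus[OF M K h x y(1)] by simp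
    then have "h x = h y" using lin_maps_closed[OF h] x y by (simp add: K.M.minus_eq_zero_iff)
    then show ?thesis by (simp add: k_def y_def)
  qed
  have "k \<in> lin_maps R (quot_module M N) K"
    using lin_maps_closed[OF h] lin_maps_add[OF h] lin_maps_smult[OF h]
    by (intro lin_mapsI) (auto simp: quot_module_carrier quot_module_add quot_module_smult k)
  with k show ?thesis using that by blast
qed

end

section \<open>Tensor powers\<close>

lemma chain_complex_module: "chain_complex R A \<Longrightarrow> module R (md A d)"
  by (simp add: chain_complex_def)

lemma chain_complex_cring: "chain_complex R A \<Longrightarrow> cring R"
  using chain_complex_module module.axioms(1) by blast

lemma chain_complex_bdry: "chain_complex R A \<Longrightarrow> bdry A d \<in> lin_maps R (md A d) (md A (d - 1))"
  by (simp add: chain_complex_def)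

lemma tdeg_map_fst: "map fst l = map fst l' \<Longrightarrow> tdeg l = tdeg l'"
  by (simp add: tdeg_def)

lemma tdeg_append [simp]: "tdeg (l @ l') = tdeg l + tdeg l'"
  by (simp add: tdeg_def)

lemma hlists_length: "l \<in> hlists A n d \<Longrightarrow> length l = n"
  by (simp add: hlists_def)

lemma hlists_tdeg: "l \<in> hlists A n d \<Longrightarrow> tdeg l = d"
  by (simp add: hlists_def)

lemma hlists_nth: "l \<in> hlists A n d \<Longrightarrow> p < n \<Longrightarrow> snd (l ! p) \<in> carrier (md A (fst (l ! p)))"
  unfolding hlists_def by (metis (mono_tags, lifting) case_prodE mem_Collect_eq nth_mem prod.sel)

lemma map_fst_update: "map fst (l[p := (fst (l ! p), a)]) = map fst l"
  by (metis (no_types, lifting) list_update_id list_update_overwrite map_update fst_conv)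

lemma hlists_update:
  assumes "l \<in> hlists A n d" "a \<in> carrier (md A (fst (l ! p)))"
  shows "l[p := (fst (l ! p), a)] \<in> hlists A n d"
proof -
  have "tdeg (l[p := (fst (l ! p), a)]) = tdeg l"
    by (rule tdeg_map_fst) (rule map_fst_update)
  then show ?thesis
    using assms set_update_subset_insert[of l p "(fst (l ! p), a)"] by (fastforce simp: hlists_def)
qed

lemma hlists_append:
  "l \<in> hlists A m d \<Longrightarrow> l' \<in> hlists A n e \<Longrightarrow> l @ l' \<in> hlists A (m + n) (d + e)"
  by (auto simp: hlists_def)

lemma hlists_take_drop:
  assumes "l \<in> hlists A (m + n) e"
  shows "take m l \<in> hlists A m (tdeg (take m l))" "drop m l \<in> hlists A n (tdeg (drop m l))"
    and "tdeg (take m l) + tdeg (drop m l) = e"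
proof -
  show "tdeg (take m l) + tdeg (drop m l) = e"
    using assms by (simp add: hlists_def flip: tdeg_append)
qed (use assms in \<open>auto simp: hlists_def dest: in_set_takeD in_set_dropD\<close>)

text \<open>Linearity is asked one slot at a time with the degree stored in that slot held fixed,
  since elements of different degrees are never added. This is the form in which the relations in
  \<open>tensor_rels\<close> are killed.\<close>

definition multilinear :: "'r ring \<Rightarrow> ('r, 'a) cx \<Rightarrow> nat \<Rightarrow> int \<Rightarrow> ('r, 'b) module \<Rightarrow>
    ((int \<times> 'a) list \<Rightarrow> 'b) \<Rightarrow> bool" where
  "multilinear R A n d M g \<longleftrightarrow> (\<forall>l\<in>hlists A n d. g l \<in> carrier M \<and>
     (\<forall>p<n. (\<lambda>a. g (l[p := (fst (l ! p), a)])) \<in> lin_maps R (md A (fst (l ! p))) M))"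

lemma multilinearI:
  assumes "\<And>l. l \<in> hlists A n d \<Longrightarrow> g l \<in> carrier M"
    and "\<And>l p. l \<in> hlists A n d \<Longrightarrow> p < n \<Longrightarrow>
      (\<lambda>a. g (l[p := (fst (l ! p), a)])) \<in> lin_maps R (md A (fst (l ! p))) M"
  shows "multilinear R A n d M g"
  using assms by (simp add: multilinear_def)

lemma multilinear_closed: "multilinear R A n d M g \<Longrightarrow> l \<in> hlists A n d \<Longrightarrow> g l \<in> carrier M"
  by (simp add: multilinear_def)

lemma multilinear_slot:
  "multilinear R A n d M g \<Longrightarrow> l \<in> hlists A n d \<Longrightarrow> p < n \<Longrightarrow>
     (\<lambda>a. g (l[p := (fst (l ! p), a)])) \<in> lin_maps R (md A (fst (l ! p))) M"
  by (simp add: multilinear_def)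

text \<open>Each slot of \<open>l\<close> feeds a single slot of \<open>G l\<close>, through a
  linear map. Boundaries of one slot, permutations, concatenations and the slotwise action of a
  chain map are all of this kind.\<close>

lemma multilinear_reindex:
  assumes A: "chain_complex R A" and g: "multilinear R B m e M g"
    and G: "\<And>l. l \<in> hlists A n d \<Longrightarrow> G l \<in> hlists B m e"
    and slot: "\<And>l p. l \<in> hlists A n d \<Longrightarrow> p < n \<Longrightarrow>
      \<exists>q<m. \<exists>\<phi>\<in>lin_maps R (md A (fst (l ! p))) (md B (fst (G l ! q))).
        \<forall>a. G (l[p := (fst (l ! p), a)]) = (G l)[q := (fst (G l ! q), \<phi> a)]"
  shows "multilinear R A n d M (\<lambda>l. g (G l))"
proof (rule multilinearI)
  fix l p assume l: "l \<in> hlists A n d" "p < n"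
  obtain q \<phi> where q: "q < m" and \<phi>: "\<phi> \<in> lin_maps R (md A (fst (l ! p))) (md B (fst (G l ! q)))"
    and eq: "\<And>a. G (l[p := (fst (l ! p), a)]) = (G l)[q := (fst (G l ! q), \<phi> a)]"
    using slot[OF l] by blast
  show "(\<lambda>a. g (G (l[p := (fst (l ! p), a)]))) \<in> lin_maps R (md A (fst (l ! p))) M"
    unfolding eq using \<phi> multilinear_slot[OF g G[OF l(1)] q] by (rule lin_maps_comp)
qed (use g G in \<open>auto simp: multilinear_def\<close>)

lemma multilinear_finsum:
  assumes M: "module R M" and "finite S" and g: "\<And>j. j \<in> S \<Longrightarrow> multilinear R A n d M (g j)"
  shows "multilinear R A n d M (\<lambda>l. \<Oplus>\<^bsub>M\<^esub>j\<in>S. g j l)"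
proof -
  interpret M: module R M by (rule M)
  show ?thesis
  proof (rule multilinearI)
    show "(\<Oplus>\<^bsub>M\<^esub>j\<in>S. g j l) \<in> carrier M" if "l \<in> hlists A n d" for l
      using multilinear_closed[OF g that] by (intro M.M.finsum_closed) auto
  qed (use multilinear_slot[OF g] in \<open>intro lin_maps_sum[OF M assms(2)]\<close>)
qed

text \<open>Koszul signs depend only on the degrees in the list, and varying the element in one slot
  leaves these fixed; each slot thus meets a constant sign.\<close>

lemma multilinear_ksgn:
  assumes A: "chain_complex R A" and M: "module R M" and g: "multilinear R A n d M g"
    and s: "\<And>l l'. length l = n \<Longrightarrow> map fst l = map fst l' \<Longrightarrow> s l = s l'"
  shows "multilinear R A n d M (\<lambda>l. ksgn M (s l) (g l))"
proof (rule multilinearI)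
  fix l p assume l: "l \<in> hlists A n d" "p < n"
  have s: "s (l[p := (fst (l ! p), a)]) = s l" for a
    using hlists_length[OF l(1)] by (intro s) (auto simp: map_fst_update)
  show "(\<lambda>a. ksgn M (s (l[p := (fst (l ! p), a)])) (g (l[p := (fst (l ! p), a)])))
      \<in> lin_maps R (md A (fst (l ! p))) M"
    unfolding s using multilinear_slot[OF g l] ksgn_lin[OF M] by (rule lin_maps_comp)
qed (use g ksgn_closed[OF M] in \<open>auto simp: multilinear_def\<close>)

subsection \<open>The universal property\<close>

lemma hlists_split:
  assumes "xs @ (i, a) # ys \<in> hlists A n d" "b \<in> carrier (md A i)"
  shows "xs @ (i, b) # ys \<in> hlists A n d"
  using hlists_update[OF assms(1), of b "length xs"] assms(2) by simp

lemma hlists_split_carrier: "xs @ (i, a) # ys \<in> hlists A n d \<Longrightarrow> a \<in> carrier (md A i)"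
  by (auto simp: hlists_def)

context
  fixes R :: "'r ring" and A :: "('r, 'a) cx"
  assumes A: "chain_complex R A"
begin

interpretation R: cring R using A by (rule chain_complex_cring)

interpretation A: module R "md A d" for d using A by (rule chain_complex_module)

interpretation F: module R "free_module R S" for S using R.is_cring by (rule free_module_module)

lemma tensor_rels_carrier: "tensor_rels R A n d \<subseteq> carrier (free_module R (hlists A n d))"
proof -
  have g: "free_gen R l \<in> carrier (free_module R (hlists A n d))" if "l \<in> hlists A n d" for l
    using R.is_cring that by (rule free_gen_carrier)
  have add: "xs @ (i, a \<oplus>\<^bsub>md A i\<^esub> b) # ys \<in> hlists A n d"
    if "xs @ (i, a) # ys \<in> hlists A n d" "xs @ (i, b) # ys \<in> hlists A n d" for xs i a b ys
    using that by (meson hlists_split hlists_split_carrier A.M.a_closed)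
  have smult: "xs @ (i, r \<odot>\<^bsub>md A i\<^esub> a) # ys \<in> hlists A n d"
    if "xs @ (i, a) # ys \<in> hlists A n d" "r \<in> carrier R" for xs i a r ys
    using that by (meson hlists_split hlists_split_carrier A.smult_closed)
  show ?thesis
    unfolding tensor_rels_def Let_def
    by (intro Un_least subsetI; elim CollectE exE conjE)
      (simp_all only:, (intro F.M.minus_closed F.M.a_closed F.smult_closed g add smult; assumption)+)
qed

lemma tensor_ker_submodule: "submodule (tensor_ker R A n d) R (free_module R (hlists A n d))"
  unfolding tensor_ker_def using F.module_axioms tensor_rels_carrier by (rule submodule_gen_submodule)

lemma tensor_mod_module: "module R (tensor_mod R A n d)"
  unfolding tensor_mod_def using F.module_axioms tensor_ker_submodule by (rule quot_module_module)

lemma ten_coset: "l \<in> hlists A n d \<Longrightarrow>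
    ten R A l = tensor_ker R A n d +>\<^bsub>free_module R (hlists A n d)\<^esub> free_gen R l"
  by (simp add: ten_def hlists_length hlists_tdeg)

lemma ten_closed:
  assumes "l \<in> hlists A n d"
  shows "ten R A l \<in> carrier (tensor_mod R A n d)"
  unfolding ten_coset[OF assms] tensor_mod_def
    quot_module_carrier[OF F.module_axioms tensor_ker_submodule]
  using free_gen_carrier[OF R.is_cring assms] by (rule imageI)

lemma ten_add:
  assumes "xs @ (i, a) # ys \<in> hlists A n d" "b \<in> carrier (md A i)"
  shows "ten R A (xs @ (i, a \<oplus>\<^bsub>md A i\<^esub> b) # ys) =
    ten R A (xs @ (i, a) # ys) \<oplus>\<^bsub>tensor_mod R A n d\<^esub> ten R A (xs @ (i, b) # ys)"
proof -
  let ?F = "free_module R (hlists A n d)"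
  let ?l = "\<lambda>x. xs @ (i, x) # ys"
  note Q = F.module_axioms[of "hlists A n d"] tensor_ker_submodule[of n d]
  note g = free_gen_carrier[OF R.is_cring]
  have a: "a \<in> carrier (md A i)" using assms(1) by (rule hlists_split_carrier)
  have l: "?l b \<in> hlists A n d" "?l (a \<oplus>\<^bsub>md A i\<^esub> b) \<in> hlists A n d"
    using assms a by (auto intro: hlists_split[OF assms(1)])
  have "free_gen R (?l (a \<oplus>\<^bsub>md A i\<^esub> b)) \<ominus>\<^bsub>?F\<^esub> (free_gen R (?l a) \<oplus>\<^bsub>?F\<^esub> free_gen R (?l b))
      \<in> tensor_rels R A n d"
    unfolding tensor_rels_def Let_def using assms(1) l(1) by blast
  then have "free_gen R (?l (a \<oplus>\<^bsub>md A i\<^esub> b)) \<ominus>\<^bsub>?F\<^esub> (free_gen R (?l a) \<oplus>\<^bsub>?F\<^esub> free_gen R (?l b))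
      \<in> tensor_ker R A n d"
    unfolding tensor_ker_def using submodule_gen_incl by fast
  then show ?thesis
    unfolding ten_coset[OF assms(1)] ten_coset[OF l(1)] ten_coset[OF l(2)] tensor_mod_def
      quot_module_add[OF Q g[OF assms(1)] g[OF l(1)]]
    by (rule coset_eq_iff[OF Q g[OF l(2)] F.M.a_closed[OF g[OF assms(1)] g[OF l(1)]], THEN iffD2])
qed

lemma ten_smult:
  assumes "xs @ (i, a) # ys \<in> hlists A n d" "r \<in> carrier R"
  shows "ten R A (xs @ (i, r \<odot>\<^bsub>md A i\<^esub> a) # ys) =
    r \<odot>\<^bsub>tensor_mod R A n d\<^esub> ten R A (xs @ (i, a) # ys)"
proof -
  let ?F = "free_module R (hlists A n d)"
  let ?l = "\<lambda>x. xs @ (i, x) # ys"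
  note Q = F.module_axioms[of "hlists A n d"] tensor_ker_submodule[of n d]
  note g = free_gen_carrier[OF R.is_cring]
  have a: "a \<in> carrier (md A i)" using assms(1) by (rule hlists_split_carrier)
  have l: "?l (r \<odot>\<^bsub>md A i\<^esub> a) \<in> hlists A n d"
    using assms a by (auto intro: hlists_split[OF assms(1)])
  have "free_gen R (?l (r \<odot>\<^bsub>md A i\<^esub> a)) \<ominus>\<^bsub>?F\<^esub> (r \<odot>\<^bsub>?F\<^esub> free_gen R (?l a)) \<in> tensor_rels R A n d"
    unfolding tensor_rels_def Let_def using assms by blast
  then have "free_gen R (?l (r \<odot>\<^bsub>md A i\<^esub> a)) \<ominus>\<^bsub>?F\<^esub> (r \<odot>\<^bsub>?F\<^esub> free_gen R (?l a)) \<in> tensor_ker R A n d"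
    unfolding tensor_ker_def using submodule_gen_incl by fast
  then show ?thesis
    unfolding ten_coset[OF assms(1)] ten_coset[OF l] tensor_mod_def
      quot_module_smult[OF Q assms(2) g[OF assms(1)]]
    by (rule coset_eq_iff[OF Q g[OF l] F.smult_closed[OF assms(2) g[OF assms(1)]], THEN iffD2])
qed

lemma ten_multilinear: "multilinear R A n d (tensor_mod R A n d) (ten R A)"
proof (rule multilinearI)
  fix l p assume l: "l \<in> hlists A n d" "p < n"
  let ?i = "fst (l ! p)" and ?xs = "take p l" and ?ys = "drop (Suc p) l"
  have p: "p < length l" using l by (simp add: hlists_length)
  \<comment> \<open>Multilinearity speaks of list updates, the defining relations of split lists;
    this equation translates.\<close>
  have eq: "l[p := (?i, a)] = ?xs @ (?i, a) # ?ys" for a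
    using p by (simp add: upd_conv_take_nth_drop)
  have mem: "?xs @ (?i, a) # ?ys \<in> hlists A n d" if "a \<in> carrier (md A ?i)" for a
    using hlists_update[OF l(1) that] by (simp add: eq)
  show "(\<lambda>a. ten R A (l[p := (?i, a)])) \<in> lin_maps R (md A ?i) (tensor_mod R A n d)"
    unfolding eq by (rule lin_mapsI) (simp_all add: ten_closed mem ten_add ten_smult)
qed (rule ten_closed)

text \<open>Uniqueness half of the universal property: elementary tensors are the classes of the
  free generators.\<close>

lemma tensor_mod_ext:
  assumes "module R M" "h \<in> lin_maps R (tensor_mod R A n d) M" "k \<in> lin_maps R (tensor_mod R A n d) M"
    and "\<And>l. l \<in> hlists A n d \<Longrightarrow> h (ten R A l) = k (ten R A l)"
    and "u \<in> carrier (tensor_mod R A n d)"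
  shows "h u = k u"
proof -
  let ?F = "free_module R (hlists A n d)"
  let ?\<pi> = "\<lambda>c. tensor_ker R A n d +>\<^bsub>?F\<^esub> c"
  note Q = F.module_axioms tensor_ker_submodule
  have \<pi>: "?\<pi> \<in> lin_maps R ?F (tensor_mod R A n d)"
    unfolding tensor_mod_def using Q by (rule quot_module_proj)
  have "h (?\<pi> c) = k (?\<pi> c)" if "c \<in> carrier ?F" for c
    using R.is_cring assms(1) lin_maps_comp[OF \<pi> assms(2)] lin_maps_comp[OF \<pi> assms(3)] _ that
  proof (rule free_module_ext)
    fix l assume l: "l \<in> hlists A n d"
    show "h (?\<pi> (free_gen R l)) = k (?\<pi> (free_gen R l))"
      using assms(4)[OF l] by (simp add: ten_coset[OF l])
  qed
  then show ?thesis
    using assms(5) unfolding tensor_mod_def by (auto simp: quot_module_carrier[OF Q])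
qed

text \<open>\<open>tensor_lift\<close> is a definite description; extensionality makes the described
  map unique as a function and not just on the carrier. The lemma recognises a given map as a
  lift.\<close>

lemma tensor_lift_eqI:
  assumes "module R M" "h \<in> lin_maps R (tensor_mod R A n d) M"
    and "h \<in> extensional (carrier (tensor_mod R A n d))"
    and "\<And>l. l \<in> hlists A n d \<Longrightarrow> h (ten R A l) = g l"
  shows "tensor_lift R A n d M g = h"
  unfolding tensor_lift_def
proof (rule the_equality)
  fix k assume k: "k \<in> lin_maps R (tensor_mod R A n d) M \<inter> extensional (carrier (tensor_mod R A n d)) \<and>
     (\<forall>l\<in>hlists A n d. k (ten R A l) = g l)"
  from k have kl: "k \<in> lin_maps R (tensor_mod R A n d) M"
    and ke: "k \<in> extensional (carrier (tensor_mod R A n d))"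
    and kt: "\<And>l. l \<in> hlists A n d \<Longrightarrow> k (ten R A l) = h (ten R A l)"
    by (simp_all add: assms(4))
  show "k = h"
    using ke assms(3) tensor_mod_ext[OF assms(1) kl assms(2) kt] by (rule extensionalityI)
qed (use assms in auto)

text \<open>Existence half of the universal property: \<open>g\<close> is extended linearly to the
  free module, and the extension descends to the quotient.\<close>

lemma tensor_lift:
  assumes M: "module R M" and g: "multilinear R A n d M g"
  shows "tensor_lift R A n d M g \<in> lin_maps R (tensor_mod R A n d) M"
    and "tensor_lift R A n d M g \<in> extensional (carrier (tensor_mod R A n d))"
    and "l \<in> hlists A n d \<Longrightarrow> tensor_lift R A n d M g (ten R A l) = g l"
proof -
  interpret M: module R M by (rule M)
  let ?F = "free_module R (hlists A n d)"
  let ?h = "lin_ext R M g"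
  have gc: "g \<in> hlists A n d \<rightarrow> carrier M" using g by (auto simp: multilinear_def)
  have h: "?h \<in> lin_maps R ?F M" using M gc by (rule lin_ext_lin)
  have hg: "?h (free_gen R l) = g l" if "l \<in> hlists A n d" for l
    using M gc that by (rule lin_ext_gen)
  have fg: "free_gen R l \<in> carrier ?F" if "l \<in> hlists A n d" for l
    using R.is_cring that by (rule free_gen_carrier)
  have slot: "(\<lambda>x. g (xs @ (i, x) # ys)) \<in> lin_maps R (md A i) M"
    if "xs @ (i, a) # ys \<in> hlists A n d" for xs i a ys
    using multilinear_slot[OF g that, of "length xs"] hlists_length[OF that] by simp
  \<comment> \<open>The kernel of the extension is a submodule, so once it contains
    \<open>tensor_rels\<close> it contains all of \<open>tensor_ker\<close>.\<close>
  have "tensor_rels R A n d \<subseteq> {c \<in> carrier ?F. ?h c \<in> {\<zero>\<^bsub>M\<^esub>}}"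
  proof
    fix c assume c: "c \<in> tensor_rels R A n d"
    then have cF: "c \<in> carrier ?F" using tensor_rels_carrier by blast
    from c consider (add) xs i a b ys
        where "c = free_gen R (xs @ (i, a \<oplus>\<^bsub>md A i\<^esub> b) # ys)
            \<ominus>\<^bsub>?F\<^esub> (free_gen R (xs @ (i, a) # ys) \<oplus>\<^bsub>?F\<^esub> free_gen R (xs @ (i, b) # ys))"
          "xs @ (i, a) # ys \<in> hlists A n d" "xs @ (i, b) # ys \<in> hlists A n d"
      | (smult) xs i a r ys
        where "c = free_gen R (xs @ (i, r \<odot>\<^bsub>md A i\<^esub> a) # ys) \<ominus>\<^bsub>?F\<^esub> (r \<odot>\<^bsub>?F\<^esub> free_gen R (xs @ (i, a) # ys))"
          "xs @ (i, a) # ys \<in> hlists A n d" "r \<in> carrier R"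
      unfolding tensor_rels_def Let_def by blast
    then have "?h c = \<zero>\<^bsub>M\<^esub>"
    proof cases
      case add
      have a: "a \<in> carrier (md A i)" "b \<in> carrier (md A i)"
        using hlists_split_carrier[OF add(2)] hlists_split_carrier[OF add(3)] by simp_all
      have ab: "xs @ (i, a \<oplus>\<^bsub>md A i\<^esub> b) # ys \<in> hlists A n d"
        using hlists_split[OF add(2)] a by blast
      show ?thesis
        unfolding add(1)
        using gc add(2,3) ab fg
        by (simp del: free_module_simps add: lin_maps_minus[OF F.module_axioms M h] lin_maps_add[OF h] hg
            M.M.minus_eq_zero_iff Pi_iff lin_maps_add[OF slot[OF add(2)] a])
    next
      case smult
      have a: "a \<in> carrier (md A i)" by (rule hlists_split_carrier[OF smult(2)])
      have ra: "xs @ (i, r \<odot>\<^bsub>md A i\<^esub> a) # ys \<in> hlists A n d"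
        using hlists_split[OF smult(2)] a smult(3) by blast
      show ?thesis
        unfolding smult(1)
        using gc smult(2,3) ra fg
        by (simp del: free_module_simps add: lin_maps_minus[OF F.module_axioms M h] lin_maps_smult[OF h] hg
            M.M.minus_eq_zero_iff Pi_iff lin_maps_smult[OF slot[OF smult(2)] smult(3) a])
    qed
    with cF show "c \<in> {c \<in> carrier ?F. ?h c \<in> {\<zero>\<^bsub>M\<^esub>}}" by simp
  qed
  then have "tensor_ker R A n d \<subseteq> {c \<in> carrier ?F. ?h c \<in> {\<zero>\<^bsub>M\<^esub>}}"
    unfolding tensor_ker_def
    using submodule_vimage[OF F.module_axioms M h submodule_zero_mod[OF M]]
    by (intro submodule_gen_least)
  then have ker: "\<And>c. c \<in> tensor_ker R A n d \<Longrightarrow> ?h c = \<zero>\<^bsub>M\<^esub>" by blast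
  obtain k where k: "k \<in> lin_maps R (tensor_mod R A n d) M"
    and kF: "\<And>c. c \<in> carrier ?F \<Longrightarrow> k (tensor_ker R A n d +>\<^bsub>?F\<^esub> c) = ?h c"
    using quot_module_lift[OF F.module_axioms tensor_ker_submodule M h ker]
    unfolding tensor_mod_def by blast
  \<comment> \<open>The map on the quotient is arbitrary off the carrier; cutting it off gives the
    extensional representative that the description asks for.\<close>
  let ?k = "restrict k (carrier (tensor_mod R A n d))"
  have kl: "?k \<in> lin_maps R (tensor_mod R A n d) M"
    by (rule lin_maps_eqI[OF tensor_mod_module k]) simp
  have kt: "?k (ten R A l) = g l" if "l \<in> hlists A n d" for l
    using that kF[OF fg] by (simp add: ten_closed) (simp add: ten_coset hg)
  have "tensor_lift R A n d M g = ?k"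
    using M kl restrict_extensional kt by (rule tensor_lift_eqI)
  then show "tensor_lift R A n d M g \<in> lin_maps R (tensor_mod R A n d) M"
    "tensor_lift R A n d M g \<in> extensional (carrier (tensor_mod R A n d))"
    "l \<in> hlists A n d \<Longrightarrow> tensor_lift R A n d M g (ten R A l) = g l"
    using kl kt by auto
qed

end

subsection \<open>Boundary, functoriality, permutations and concatenation\<close>

lemma tensor_cx_simps [simp]: "md (tensor_cx R A n) = tensor_mod R A n"
  by (simp add: tensor_cx_def)

lemma tdeg_update:
  assumes "j < length l"
  shows "tdeg (l[j := (i, a)]) = tdeg l + (i - fst (l ! j))"
proof -
  have "tdeg l = tdeg (take j l) + fst (l ! j) + tdeg (drop (Suc j) l)"
    by (subst id_take_nth_drop[OF assms]) (simp add: tdeg_def)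
  then show ?thesis
    by (simp add: upd_conv_take_nth_drop[OF assms]) (simp add: tdeg_def)
qed

context
  fixes R :: "'r ring" and A :: "('r, 'a) cx"
  assumes A: "chain_complex R A"
begin

private abbreviation (input) slot_bdry :: "nat \<Rightarrow> (int \<times> 'a) list \<Rightarrow> (int \<times> 'a) list" where
  "slot_bdry j l \<equiv> l[j := (fst (l ! j) - 1, bdry A (fst (l ! j)) (snd (l ! j)))]"

lemma slot_bdry_hlists:
  assumes "l \<in> hlists A n d" "j < n"
  shows "slot_bdry j l \<in> hlists A n (d - 1)"
proof -
  have "j < length l" using assms by (simp add: hlists_length)
  moreover have "bdry A (fst (l ! j)) (snd (l ! j)) \<in> carrier (md A (fst (l ! j) - 1))"
    using lin_maps_closed[OF chain_complex_bdry[OF A] hlists_nth[OF assms]] .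
  ultimately show ?thesis
    using assms(1) set_update_subset_insert[of l j]
    by (fastforce simp: hlists_def tdeg_update)
qed

text \<open>An element put into slot \<open>j\<close> passes through the linear map
  \<open>bdry A\<close>; an element in any other slot stays in its place unchanged.\<close>

lemma slot_bdry_multilinear:
  assumes j: "j < n"
  shows "multilinear R A n d (tensor_mod R A n (d - 1)) (\<lambda>l. ten R A (slot_bdry j l))"
proof (rule multilinear_reindex[OF A ten_multilinear[OF A]])
  fix l p assume l: "l \<in> hlists A n d" and p: "p < n"
  then have len: "length l = n" by (simp add: hlists_length)
  show "\<exists>q<n. \<exists>\<phi>\<in>lin_maps R (md A (fst (l ! p))) (md A (fst (slot_bdry j l ! q))).
      \<forall>a. slot_bdry j (l[p := (fst (l ! p), a)]) =
        (slot_bdry j l)[q := (fst (slot_bdry j l ! q), \<phi> a)]"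
  proof (cases "p = j")
    case True
    show ?thesis
      using j len True chain_complex_bdry[OF A, of "fst (l ! j)"]
      by (intro exI[of _ j] conjI bexI[of _ "bdry A (fst (l ! j))"]) simp_all
  next
    case False
    then show ?thesis
      using p len by (intro exI[of _ p] conjI bexI[of _ "\<lambda>x. x"])
        (simp_all add: lin_maps_id list_update_swap)
  qed
qed (rule slot_bdry_hlists[OF _ j])

lemma tensor_bdry:
  shows tensor_bdry_lin:
    "bdry (tensor_cx R A n) d \<in> lin_maps R (tensor_mod R A n d) (tensor_mod R A n (d - 1))"
  and tensor_bdry_ten: "l \<in> hlists A n d \<Longrightarrow> bdry (tensor_cx R A n) d (ten R A l) =
    (\<Oplus>\<^bsub>tensor_mod R A n (d - 1)\<^esub>j\<in>{..<n}.
       ksgn (tensor_mod R A n (d - 1)) (tdeg (take j l)) (ten R A (slot_bdry j l)))"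
proof -
  have "multilinear R A n d (tensor_mod R A n (d - 1)) (\<lambda>l.
      \<Oplus>\<^bsub>tensor_mod R A n (d - 1)\<^esub>j\<in>{..<n}.
         ksgn (tensor_mod R A n (d - 1)) (tdeg (take j l)) (ten R A (slot_bdry j l)))"
    by (intro multilinear_finsum multilinear_ksgn slot_bdry_multilinear tensor_mod_module A)
      (auto intro: tdeg_map_fst simp flip: take_map)
  note lift = tensor_lift[OF A tensor_mod_module[OF A] this]
  show "bdry (tensor_cx R A n) d \<in> lin_maps R (tensor_mod R A n d) (tensor_mod R A n (d - 1))"
    unfolding tensor_cx_def cx.simps by (rule lift(1))
  show "bdry (tensor_cx R A n) d (ten R A l) =
    (\<Oplus>\<^bsub>tensor_mod R A n (d - 1)\<^esub>j\<in>{..<n}.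
       ksgn (tensor_mod R A n (d - 1)) (tdeg (take j l)) (ten R A (slot_bdry j l)))"
    if "l \<in> hlists A n d"
    unfolding tensor_cx_def cx.simps by (rule lift(3)[OF that])
qed

section \<open>Permutations of tensor factors\<close>

lemma perm_list_hlists:
  assumes "l \<in> hlists A n d" "\<sigma> permutes {..<n}"
  shows "map (\<lambda>i. l ! inv_into UNIV \<sigma> i) [0..<n] \<in> hlists A n d"
proof -
  \<comment> \<open>\<open>permute_list\<close> brings in invariance of the multiset of entries;
    total degree and membership in the carriers depend only on that multiset.\<close>
  have "permute_list (inv_into UNIV \<sigma>) l = map (\<lambda>i. l ! inv_into UNIV \<sigma> i) [0..<n]"
    using assms(1) by (simp add: permute_list_def hlists_length)
  moreover have "mset (permute_list (inv_into UNIV \<sigma>) l) = mset l"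
    using assms by (intro mset_permute_list permutes_inv) (simp add: hlists_length)
  ultimately have m: "mset (map (\<lambda>i. l ! inv_into UNIV \<sigma> i) [0..<n]) = mset l" by simp
  have "tdeg (map (\<lambda>i. l ! inv_into UNIV \<sigma> i) [0..<n]) = tdeg l"
    unfolding tdeg_def using arg_cong[OF m, of "\<lambda>M. sum_mset (image_mset fst M)"]
    by (simp only: sum_mset_sum_list flip: mset_map)
  with mset_eq_setD[OF m] show ?thesis
    using assms(1) unfolding hlists_def by simp
qed

lemma tensor_perm:
  assumes \<sigma>: "\<sigma> permutes {..<n}"
  shows tensor_perm_lin: "tensor_perm R A n d \<sigma> \<in> lin_maps R (tensor_mod R A n d) (tensor_mod R A n d)"
  and tensor_perm_ten: "l \<in> hlists A n d \<Longrightarrow> tensor_perm R A n d \<sigma> (ten R A l) =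
    ksgn (tensor_mod R A n d)
      (\<Sum>(j, k)\<in>{(j, k). j < k \<and> k < n \<and> \<sigma> k < \<sigma> j}. fst (l ! j) * fst (l ! k))
      (ten R A (map (\<lambda>i. l ! inv_into UNIV \<sigma> i) [0..<n]))"
proof -
  have "multilinear R A n d (tensor_mod R A n d)
      (\<lambda>l. ten R A (map (\<lambda>i. l ! inv_into UNIV \<sigma> i) [0..<n]))"
  proof (rule multilinear_reindex[OF A ten_multilinear[OF A]])
    fix l p assume l: "l \<in> hlists A n d" and p: "p < n"
    then have len: "length l = n" by (simp add: hlists_length)
    have \<sigma>p: "\<sigma> p < n" using p permutes_in_image[OF \<sigma>] by auto
    have inv: "inv_into UNIV \<sigma> (\<sigma> p) = p" using permutes_inverses(2)[OF \<sigma>] .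
    \<comment> \<open>The factor in slot \<open>p\<close> moves to place \<open>\<sigma> p\<close>,
      so updating \<open>l\<close> at \<open>p\<close> is updating the permuted list at
      \<open>\<sigma> p\<close>.\<close>
    have "map (\<lambda>i. l[p := x] ! inv_into UNIV \<sigma> i) [0..<n] =
        (map (\<lambda>i. l ! inv_into UNIV \<sigma> i) [0..<n])[\<sigma> p := x]" for x
    proof (rule nth_equalityI)
      fix i assume "i < length (map (\<lambda>i. l[p := x] ! inv_into UNIV \<sigma> i) [0..<n])"
      then have "i < n" by simp
      moreover have "inv_into UNIV \<sigma> i = p \<longleftrightarrow> i = \<sigma> p"
        using permutes_inv_eq[OF \<sigma>] by metis
      ultimately show "map (\<lambda>i. l[p := x] ! inv_into UNIV \<sigma> i) [0..<n] ! i =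
        (map (\<lambda>i. l ! inv_into UNIV \<sigma> i) [0..<n])[\<sigma> p := x] ! i"
        using len p by (auto simp: nth_list_update)
    qed simp
    then show "\<exists>q<n. \<exists>\<phi>\<in>lin_maps R (md A (fst (l ! p)))
          (md A (fst (map (\<lambda>i. l ! inv_into UNIV \<sigma> i) [0..<n] ! q))).
        \<forall>a. map (\<lambda>i. l[p := (fst (l ! p), a)] ! inv_into UNIV \<sigma> i) [0..<n] =
          (map (\<lambda>i. l ! inv_into UNIV \<sigma> i) [0..<n])
            [q := (fst (map (\<lambda>i. l ! inv_into UNIV \<sigma> i) [0..<n] ! q), \<phi> a)]"
      using \<sigma>p inv by (intro exI[of _ "\<sigma> p"] conjI bexI[of _ "\<lambda>x. x"]) (simp_all add: lin_maps_id)
  qed (rule perm_list_hlists[OF _ \<sigma>])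
  then have "multilinear R A n d (tensor_mod R A n d) (\<lambda>l. ksgn (tensor_mod R A n d)
      (\<Sum>(j, k)\<in>{(j, k). j < k \<and> k < n \<and> \<sigma> k < \<sigma> j}. fst (l ! j) * fst (l ! k))
      (ten R A (map (\<lambda>i. l ! inv_into UNIV \<sigma> i) [0..<n])))"
  proof (rule multilinear_ksgn[OF A tensor_mod_module[OF A]])
    fix l l' :: "(int \<times> 'a) list" assume l: "length l = n" "map fst l = map fst l'"
    then have "length l' = n" by (metis length_map)
    then have "fst (l ! j) = fst (l' ! j)" if "j < n" for j
      using l that by (metis nth_map)
    then show "(\<Sum>(j, k)\<in>{(j, k). j < k \<and> k < n \<and> \<sigma> k < \<sigma> j}. fst (l ! j) * fst (l ! k)) =
        (\<Sum>(j, k)\<in>{(j, k). j < k \<and> k < n \<and> \<sigma> k < \<sigma> j}. fst (l' ! j) * fst (l' ! k))"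
      by (intro sum.cong) auto
  qed
  note lift = tensor_lift[OF A tensor_mod_module[OF A] this]
  show "tensor_perm R A n d \<sigma> \<in> lin_maps R (tensor_mod R A n d) (tensor_mod R A n d)"
    unfolding tensor_perm_def by (rule lift(1))
  show "tensor_perm R A n d \<sigma> (ten R A l) = ksgn (tensor_mod R A n d)
      (\<Sum>(j, k)\<in>{(j, k). j < k \<and> k < n \<and> \<sigma> k < \<sigma> j}. fst (l ! j) * fst (l ! k))
      (ten R A (map (\<lambda>i. l ! inv_into UNIV \<sigma> i) [0..<n]))" if "l \<in> hlists A n d"
    unfolding tensor_perm_def by (rule lift(3)[OF that])
qed

section \<open>Concatenation of tensors as a bilinear map\<close>

private lemma ten_append_right:
  assumes l: "l \<in> hlists A m d"
  shows "multilinear R A n e (tensor_mod R A (m + n) (d + e)) (\<lambda>l'. ten R A (l @ l'))"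
proof (rule multilinear_reindex[OF A ten_multilinear[OF A]])
  show "l @ l' \<in> hlists A (m + n) (d + e)" if "l' \<in> hlists A n e" for l'
    using l that by (rule hlists_append)
  show "\<exists>q<m + n. \<exists>\<phi>\<in>lin_maps R (md A (fst (l' ! p))) (md A (fst ((l @ l') ! q))).
      \<forall>a. l @ l'[p := (fst (l' ! p), a)] = (l @ l')[q := (fst ((l @ l') ! q), \<phi> a)]"
    if "l' \<in> hlists A n e" "p < n" for l' p
    using hlists_length[OF l] that
    by (intro exI[of _ "m + p"] conjI bexI[of _ "\<lambda>x. x"])
      (simp_all add: lin_maps_id nth_append list_update_append)
qed

private lemma ten_append_left:
  assumes l': "l' \<in> hlists A n e"
  shows "multilinear R A m d (tensor_mod R A (m + n) (d + e)) (\<lambda>l. ten R A (l @ l'))"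
proof (rule multilinear_reindex[OF A ten_multilinear[OF A]])
  show "l @ l' \<in> hlists A (m + n) (d + e)" if "l \<in> hlists A m d" for l
    using that l' by (rule hlists_append)
  show "\<exists>q<m + n. \<exists>\<phi>\<in>lin_maps R (md A (fst (l ! p))) (md A (fst ((l @ l') ! q))).
      \<forall>a. l[p := (fst (l ! p), a)] @ l' = (l @ l')[q := (fst ((l @ l') ! q), \<phi> a)]"
    if "l \<in> hlists A m d" "p < m" for l p
    using hlists_length[OF that(1)] that
    by (intro exI[of _ p] conjI bexI[of _ "\<lambda>x. x"])
      (simp_all add: lin_maps_id nth_append list_update_append)
qed

text \<open>The inner of the two nested lifts in \<open>tensor_conc\<close>, named so that its
  dependence on the left list can be studied with the right tensor fixed.\<close>

private definition inner_conc where
  "inner_conc m d n e l = tensor_lift R A n e (tensor_mod R A (m + n) (d + e)) (\<lambda>l'. ten R A (l @ l'))"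

private lemma inner_conc:
  assumes "l \<in> hlists A m d"
  shows "inner_conc m d n e l \<in> lin_maps R (tensor_mod R A n e) (tensor_mod R A (m + n) (d + e))"
    and "l' \<in> hlists A n e \<Longrightarrow> inner_conc m d n e l (ten R A l') = ten R A (l @ l')"
  unfolding inner_conc_def
  using tensor_lift[OF A tensor_mod_module[OF A] ten_append_right[OF assms]] by auto

text \<open>For an elementary \<open>v\<close>, linearity in a slot of \<open>l\<close> is
  multilinearity of \<open>ten\<close>. A general \<open>v\<close> is reached because both sides of
  each identity are linear in \<open>v\<close>.\<close>

private lemma inner_conc_multilinear:
  assumes v: "v \<in> carrier (tensor_mod R A n e)"
  shows "multilinear R A m d (tensor_mod R A (m + n) (d + e)) (\<lambda>l. inner_conc m d n e l v)"
proof (rule multilinearI)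
  show "inner_conc m d n e l v \<in> carrier (tensor_mod R A (m + n) (d + e))" if "l \<in> hlists A m d" for l
    using lin_maps_closed[OF inner_conc(1)[OF that] v] .
next
  fix l p assume l: "l \<in> hlists A m d" and p: "p < m"
  let ?i = "fst (l ! p)" and ?M = "tensor_mod R A (m + n) (d + e)"
  let ?l = "\<lambda>a. l[p := (?i, a)]"
  interpret M: module R ?M using A by (rule tensor_mod_module)
  interpret A: module R "md A ?i" using A by (rule chain_complex_module)
  note mem = hlists_update[OF l, of _ p]
  note lin = inner_conc(1)[OF mem] and eval = inner_conc(2)[OF mem]
  note slot = multilinear_slot[OF ten_append_left l p]
  note ext = tensor_mod_ext[OF A M.module_axioms _ _ _ v]
  show "(\<lambda>a. inner_conc m d n e (?l a) v) \<in> lin_maps R (md A ?i) ?M"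
  proof (rule lin_mapsI)
    show "inner_conc m d n e (?l a) v \<in> carrier ?M" if "a \<in> carrier (md A ?i)" for a
      using lin_maps_closed[OF lin[OF that] v] .
    show "inner_conc m d n e (?l (a \<oplus>\<^bsub>md A ?i\<^esub> b)) v =
        inner_conc m d n e (?l a) v \<oplus>\<^bsub>?M\<^esub> inner_conc m d n e (?l b) v"
      if a: "a \<in> carrier (md A ?i)" and b: "b \<in> carrier (md A ?i)" for a b
    proof (rule ext[OF lin lin_maps_plus[OF M.module_axioms lin lin]])
      fix l' assume l': "l' \<in> hlists A n e"
      show "inner_conc m d n e (?l (a \<oplus>\<^bsub>md A ?i\<^esub> b)) (ten R A l') =
          inner_conc m d n e (?l a) (ten R A l') \<oplus>\<^bsub>?M\<^esub> inner_conc m d n e (?l b) (ten R A l')"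
        using lin_maps_add[OF slot[OF l'] a b] a b by (simp add: eval l')
    qed (use a b in auto)
    show "inner_conc m d n e (?l (r \<odot>\<^bsub>md A ?i\<^esub> a)) v = r \<odot>\<^bsub>?M\<^esub> inner_conc m d n e (?l a) v"
      if r: "r \<in> carrier R" and a: "a \<in> carrier (md A ?i)" for r a
    proof (rule ext[OF lin lin_maps_scale[OF M.module_axioms lin]])
      fix l' assume l': "l' \<in> hlists A n e"
      show "inner_conc m d n e (?l (r \<odot>\<^bsub>md A ?i\<^esub> a)) (ten R A l') =
          r \<odot>\<^bsub>?M\<^esub> inner_conc m d n e (?l a) (ten R A l')"
        using lin_maps_smult[OF slot[OF l'] r a] r a by (simp add: eval l')
    qed (use r a in auto)
  qed
qed

private lemma tensor_conc_inner:
  "tensor_conc R A m d n e u v = tensor_lift R A m d (tensor_mod R A (m + n) (d + e)) (\<lambda>l. inner_conc m d n e l v) u"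
  by (simp add: tensor_conc_def inner_conc_def)

lemma tensor_conc_lin_left:
  assumes "v \<in> carrier (tensor_mod R A n e)"
  shows "(\<lambda>u. tensor_conc R A m d n e u v) \<in> lin_maps R (tensor_mod R A m d) (tensor_mod R A (m + n) (d + e))"
  unfolding tensor_conc_inner
  using tensor_lift(1)[OF A tensor_mod_module[OF A] inner_conc_multilinear[OF assms]] .

private lemma tensor_conc_ten_left:
  assumes "v \<in> carrier (tensor_mod R A n e)" "l \<in> hlists A m d"
  shows "tensor_conc R A m d n e (ten R A l) v = inner_conc m d n e l v"
  unfolding tensor_conc_inner
  using tensor_lift(3)[OF A tensor_mod_module[OF A] inner_conc_multilinear[OF assms(1)] assms(2)] .

lemma tensor_conc_ten:
  assumes "l \<in> hlists A m d" "l' \<in> hlists A n e"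
  shows "tensor_conc R A m d n e (ten R A l) (ten R A l') = ten R A (l @ l')"
  using tensor_conc_ten_left[OF ten_closed[OF A assms(2)] assms(1)] inner_conc(2)[OF assms] by simp

text \<open>Being a lift in \<open>u\<close>, the definition shows linearity in \<open>u\<close> at
  once but not in \<open>v\<close>. On an elementary \<open>u\<close> the value is an inner lift
  applied to \<open>v\<close>, hence linear in \<open>v\<close>; a general \<open>u\<close> follows
  because both sides of each identity are linear in \<open>u\<close>.\<close>

lemma tensor_conc_lin_right:
  assumes u: "u \<in> carrier (tensor_mod R A m d)"
  shows "tensor_conc R A m d n e u \<in> lin_maps R (tensor_mod R A n e) (tensor_mod R A (m + n) (d + e))"
proof -
  let ?M = "tensor_mod R A (m + n) (d + e)" and ?N = "tensor_mod R A n e"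
  interpret M: module R ?M using A by (rule tensor_mod_module)
  interpret N: module R ?N using A by (rule tensor_mod_module)
  note ext = tensor_mod_ext[OF A M.module_axioms _ _ _ u]
  note lin = tensor_conc_lin_left
  show ?thesis
  proof (rule lin_mapsI)
    show "tensor_conc R A m d n e u v \<in> carrier ?M" if "v \<in> carrier ?N" for v
      using lin_maps_closed[OF lin[OF that] u] .
    show "tensor_conc R A m d n e u (v \<oplus>\<^bsub>?N\<^esub> w) =
        tensor_conc R A m d n e u v \<oplus>\<^bsub>?M\<^esub> tensor_conc R A m d n e u w"
      if v: "v \<in> carrier ?N" and w: "w \<in> carrier ?N" for v w
    proof (rule ext[OF lin lin_maps_plus[OF M.module_axioms lin lin]])
      fix l assume l: "l \<in> hlists A m d"
      show "tensor_conc R A m d n e (ten R A l) (v \<oplus>\<^bsub>?N\<^esub> w) =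
        tensor_conc R A m d n e (ten R A l) v \<oplus>\<^bsub>?M\<^esub> tensor_conc R A m d n e (ten R A l) w"
        using lin_maps_add[OF inner_conc(1)[OF l] v w] v w by (simp add: tensor_conc_ten_left l)
    qed (use v w in auto)
    show "tensor_conc R A m d n e u (r \<odot>\<^bsub>?N\<^esub> v) = r \<odot>\<^bsub>?M\<^esub> tensor_conc R A m d n e u v"
      if r: "r \<in> carrier R" and v: "v \<in> carrier ?N" for r v
    proof (rule ext[OF lin lin_maps_scale[OF M.module_axioms lin]])
      fix l assume l: "l \<in> hlists A m d"
      show "tensor_conc R A m d n e (ten R A l) (r \<odot>\<^bsub>?N\<^esub> v) =
        r \<odot>\<^bsub>?M\<^esub> tensor_conc R A m d n e (ten R A l) v"
        using lin_maps_smult[OF inner_conc(1)[OF l] r v] r v by (simp add: tensor_conc_ten_left l)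
    qed (use r v in auto)
  qed
qed

lemma tensor_conc_closed:
  "u \<in> carrier (tensor_mod R A m d) \<Longrightarrow> v \<in> carrier (tensor_mod R A n e) \<Longrightarrow>
    tensor_conc R A m d n e u v \<in> carrier (tensor_mod R A (m + n) (d + e))"
  by (rule lin_maps_closed[OF tensor_conc_lin_right])

end

section \<open>Functoriality of tensor powers\<close>

lemma cx_map_lin: "cx_map R A B f \<Longrightarrow> f d \<in> lin_maps R (md A d) (md B d)"
  by (simp add: cx_map_def)

lemma cx_map_bdry: "cx_map R A B f \<Longrightarrow> x \<in> carrier (md A d) \<Longrightarrow> f (d - 1) (bdry A d x) = bdry B d (f d x)"
  by (simp add: cx_map_def)

lemma map_fst_graded [simp]: "map fst (map (\<lambda>(i, a). (i, f i a)) l) = map fst l"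
  by (simp add: case_prod_beta)

lemma tdeg_graded [simp]: "tdeg (map (\<lambda>(i, a). (i, f i a)) l) = tdeg l"
  by (rule tdeg_map_fst) (rule map_fst_graded)

context
  fixes R :: "'r ring" and A :: "('r, 'a) cx" and B :: "('r, 'b) cx" and f
  assumes A: "chain_complex R A" and B: "chain_complex R B" and f: "cx_map R A B f"
begin

private abbreviation (input) fmap :: "(int \<times> 'a) list \<Rightarrow> (int \<times> 'b) list" where
  "fmap \<equiv> map (\<lambda>(i, a). (i, f i a))"

lemma graded_hlists: "l \<in> hlists A n d \<Longrightarrow> fmap l \<in> hlists B n d"
  using lin_maps_closed[OF cx_map_lin[OF f]] by (auto simp: hlists_def)

lemma tensor_map_facts:
  shows tensor_map_lin: "tensor_map R A B f n d \<in> lin_maps R (tensor_mod R A n d) (tensor_mod R B n d)"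
    and tensor_map_ten: "l \<in> hlists A n d \<Longrightarrow>
      tensor_map R A B f n d (ten R A l) = ten R B (map (\<lambda>(i, a). (i, f i a)) l)"
proof -
  have "multilinear R A n d (tensor_mod R B n d) (\<lambda>l. ten R B (fmap l))"
  proof (rule multilinear_reindex[OF A ten_multilinear[OF B]])
    fix l p assume l: "l \<in> hlists A n d" and p: "p < n"
    then have p: "p < n" "p < length l" by (simp_all add: hlists_length)
    show "\<exists>q<n. \<exists>\<phi>\<in>lin_maps R (md A (fst (l ! p))) (md B (fst (fmap l ! q))).
        \<forall>a. fmap (l[p := (fst (l ! p), a)]) = (fmap l)[q := (fst (fmap l ! q), \<phi> a)]"
      using p cx_map_lin[OF f, of "fst (l ! p)"]
      by (intro exI[of _ p] conjI bexI[of _ "f (fst (l ! p))"]) (simp_all add: map_update case_prod_beta)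
  qed (rule graded_hlists)
  note lift = tensor_lift[OF A tensor_mod_module[OF B] this]
  show "tensor_map R A B f n d \<in> lin_maps R (tensor_mod R A n d) (tensor_mod R B n d)"
    unfolding tensor_map_def by (rule lift(1))
  show "tensor_map R A B f n d (ten R A l) = ten R B (fmap l)" if "l \<in> hlists A n d"
    unfolding tensor_map_def by (rule lift(3)[OF that])
qed

text \<open>Applying \<open>f\<close> to all factors commutes with the boundary of one factor
  because \<open>f\<close> is a chain map; the signs agree because \<open>f\<close> keeps all
  degrees.\<close>

lemma tensor_map_bdry:
  assumes "u \<in> carrier (tensor_mod R A n d)"
  shows "tensor_map R A B f n (d - 1) (bdry (tensor_cx R A n) d u) =
    bdry (tensor_cx R B n) d (tensor_map R A B f n d u)"
proof (rule tensor_mod_ext[OF A tensor_mod_module[OF B] lin_maps_comp[OF tensor_bdry_lin[OF A] tensor_map_lin]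
      lin_maps_comp[OF tensor_map_lin tensor_bdry_lin[OF B]] _ assms])
  fix l assume l: "l \<in> hlists A n d"
  let ?M = "tensor_mod R A n (d - 1)" and ?N = "tensor_mod R B n (d - 1)"
  let ?b = "\<lambda>C l j. l[j := (fst (l ! j) - 1, bdry C (fst (l ! j)) (snd (l ! j)))]"
  note M = tensor_mod_module[OF A] and N = tensor_mod_module[OF B]
  interpret N: module R ?N using B by (rule tensor_mod_module)
  have b: "?b A l j \<in> hlists A n (d - 1)" if "j < n" for j
    using A l that by (rule slot_bdry_hlists)
  have comm: "fmap (?b A l j) = ?b B (fmap l) j" if "j < n" for j
  proof -
    have "j < length l" using that hlists_length[OF l] by simp
    then show ?thesis
      using cx_map_bdry[OF f hlists_nth[OF l that]] by (simp add: map_update case_prod_beta)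
  qed
  have t: "tdeg (take j (fmap l)) = tdeg (take j l)" for j
    by (simp add: take_map)
  have "tensor_map R A B f n (d - 1) (bdry (tensor_cx R A n) d (ten R A l)) =
      (\<Oplus>\<^bsub>?N\<^esub>j\<in>{..<n}. tensor_map R A B f n (d - 1) (ksgn ?M (tdeg (take j l)) (ten R A (?b A l j))))"
    unfolding tensor_bdry_ten[OF A l]
    using b by (intro lin_maps_finsum[OF M N tensor_map_lin]) (auto intro!: ksgn_closed M ten_closed[OF A])
  also have "\<dots> = (\<Oplus>\<^bsub>?N\<^esub>j\<in>{..<n}. ksgn ?N (tdeg (take j (fmap l))) (ten R B (?b B (fmap l) j)))"
  proof (rule N.M.finsum_cong')
    fix j assume "j \<in> {..<n}"
    then have j: "j < n" by simp
    show "tensor_map R A B f n (d - 1) (ksgn ?M (tdeg (take j l)) (ten R A (?b A l j))) =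
        ksgn ?N (tdeg (take j (fmap l))) (ten R B (?b B (fmap l) j))"
      unfolding t comm[OF j, symmetric] lin_maps_ksgn[OF M N tensor_map_lin ten_closed[OF A b[OF j]]]
        tensor_map_ten[OF b[OF j]] ..
  qed (use slot_bdry_hlists[OF B graded_hlists[OF l]] in \<open>auto intro!: ksgn_closed N ten_closed[OF B]\<close>)
  also have "\<dots> = bdry (tensor_cx R B n) d (tensor_map R A B f n d (ten R A l))"
    unfolding tensor_map_ten[OF l] by (rule tensor_bdry_ten[OF B graded_hlists[OF l], symmetric])
  finally show "tensor_map R A B f n (d - 1) (bdry (tensor_cx R A n) d (ten R A l)) =
    bdry (tensor_cx R B n) d (tensor_map R A B f n d (ten R A l))" .
qed

lemma tensor_map_perm:
  assumes \<sigma>: "\<sigma> permutes {..<n}" and u: "u \<in> carrier (tensor_mod R A n d)"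
  shows "tensor_map R A B f n d (tensor_perm R A n d \<sigma> u) =
    tensor_perm R B n d \<sigma> (tensor_map R A B f n d u)"
proof (rule tensor_mod_ext[OF A tensor_mod_module[OF B] lin_maps_comp[OF tensor_perm_lin[OF A \<sigma>] tensor_map_lin]
      lin_maps_comp[OF tensor_map_lin tensor_perm_lin[OF B \<sigma>]] _ u])
  fix l assume l: "l \<in> hlists A n d"
  let ?s = "\<lambda>l. \<Sum>(j, k)\<in>{(j, k). j < k \<and> k < n \<and> \<sigma> k < \<sigma> j}. fst (l ! j) * fst (l ! k)"
  let ?\<sigma> = "\<lambda>l. map (\<lambda>i. l ! inv_into UNIV \<sigma> i) [0..<n]"
  have len: "length l = n" using l by (rule hlists_length)
  have inv: "inv_into UNIV \<sigma> i < n" if "i < n" for i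
    using permutes_in_image[OF permutes_inv[OF \<sigma>]] that by (metis lessThan_iff)
  have comm: "fmap (?\<sigma> l) = ?\<sigma> (fmap l)"
    using inv len by (auto simp: case_prod_beta)
  have s: "?s (fmap l) = ?s l"
    using len by (intro sum.cong) (auto simp: case_prod_beta)
  have mem: "?\<sigma> l \<in> hlists A n d" using A l \<sigma> by (rule perm_list_hlists)
  show "tensor_map R A B f n d (tensor_perm R A n d \<sigma> (ten R A l)) =
      tensor_perm R B n d \<sigma> (tensor_map R A B f n d (ten R A l))"
    unfolding tensor_perm_ten[OF A \<sigma> l] tensor_map_ten[OF l]
      tensor_perm_ten[OF B \<sigma> graded_hlists[OF l]]
      lin_maps_ksgn[OF tensor_mod_module[OF A] tensor_mod_module[OF B] tensor_map_lin ten_closed[OF A mem]]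
      tensor_map_ten[OF mem] s comm ..
qed

text \<open>Both sides are bilinear, so \<open>tensor_mod_ext\<close> is used twice: the fact
  \<open>ten\<close> settles every \<open>v\<close> for an elementary left factor, then the left
  factor becomes general.\<close>

lemma tensor_map_conc:
  assumes u: "u \<in> carrier (tensor_mod R A m d)" and v: "v \<in> carrier (tensor_mod R A n e)"
  shows "tensor_map R A B f (m + n) (d + e) (tensor_conc R A m d n e u v) =
    tensor_conc R B m d n e (tensor_map R A B f m d u) (tensor_map R A B f n e v)"
proof -
  note N = tensor_mod_module[OF B] and lin = tensor_map_lin
  note closed = lin_maps_closed[OF lin]
  have ten: "tensor_map R A B f (m + n) (d + e) (tensor_conc R A m d n e (ten R A l) v) =
      tensor_conc R B m d n e (tensor_map R A B f m d (ten R A l)) (tensor_map R A B f n e v)"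
    if l: "l \<in> hlists A m d" for l
  proof (rule tensor_mod_ext[OF A N _ _ _ v])
    show "(\<lambda>v. tensor_map R A B f (m + n) (d + e) (tensor_conc R A m d n e (ten R A l) v))
        \<in> lin_maps R (tensor_mod R A n e) (tensor_mod R B (m + n) (d + e))"
      using tensor_conc_lin_right[OF A ten_closed[OF A l]] lin by (rule lin_maps_comp)
    show "(\<lambda>v. tensor_conc R B m d n e (tensor_map R A B f m d (ten R A l)) (tensor_map R A B f n e v))
        \<in> lin_maps R (tensor_mod R A n e) (tensor_mod R B (m + n) (d + e))"
      using lin tensor_conc_lin_right[OF B closed[OF ten_closed[OF A l]]] by (rule lin_maps_comp)
    fix l' assume l': "l' \<in> hlists A n e"
    show "tensor_map R A B f (m + n) (d + e) (tensor_conc R A m d n e (ten R A l) (ten R A l')) =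
      tensor_conc R B m d n e (tensor_map R A B f m d (ten R A l)) (tensor_map R A B f n e (ten R A l'))"
      unfolding tensor_conc_ten[OF A l l'] tensor_map_ten[OF l] tensor_map_ten[OF l']
        tensor_map_ten[OF hlists_append[OF l l']]
        tensor_conc_ten[OF B graded_hlists[OF l] graded_hlists[OF l']] map_append ..
  qed
  show ?thesis
  proof (rule tensor_mod_ext[OF A N _ _ _ u])
    fix l assume "l \<in> hlists A m d"
    then show "tensor_map R A B f (m + n) (d + e) (tensor_conc R A m d n e (ten R A l) v) =
        tensor_conc R B m d n e (tensor_map R A B f m d (ten R A l)) (tensor_map R A B f n e v)"
      by (rule ten)
  next
    show "(\<lambda>u. tensor_map R A B f (m + n) (d + e) (tensor_conc R A m d n e u v))
        \<in> lin_maps R (tensor_mod R A m d) (tensor_mod R B (m + n) (d + e))"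
      using tensor_conc_lin_left[OF A v] lin by (rule lin_maps_comp)
    show "(\<lambda>u. tensor_conc R B m d n e (tensor_map R A B f m d u) (tensor_map R A B f n e v))
        \<in> lin_maps R (tensor_mod R A m d) (tensor_mod R B (m + n) (d + e))"
      using lin tensor_conc_lin_left[OF B closed[OF v]] by (rule lin_maps_comp)
  qed
qed

end

text \<open>This strict identity is what cancels the inserted maps in the middle of a vertical
  composite.\<close>

lemma tensor_map_left_inverse:
  assumes A: "chain_complex R A" and B: "chain_complex R B"
    and i: "cx_map R A B i" and p: "cx_map R B A p"
    and pi: "\<And>d x. x \<in> carrier (md A d) \<Longrightarrow> p d (i d x) = x"
    and u: "u \<in> carrier (tensor_mod R A n d)"
  shows "tensor_map R B A p n d (tensor_map R A B i n d u) = u"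
proof (rule tensor_mod_ext[OF A tensor_mod_module[OF A] _ lin_maps_id _ u])
  show "(\<lambda>u. tensor_map R B A p n d (tensor_map R A B i n d u))
      \<in> lin_maps R (tensor_mod R A n d) (tensor_mod R A n d)"
    using tensor_map_lin[OF A B i] tensor_map_lin[OF B A p] by (rule lin_maps_comp)
  fix l assume l: "l \<in> hlists A n d"
  have "map (\<lambda>(j, a). (j, p j a)) (map (\<lambda>(j, a). (j, i j a)) l) = l"
    using l pi by (auto simp: hlists_def intro!: map_idI)
  then show "tensor_map R B A p n d (tensor_map R A B i n d (ten R A l)) = ten R A l"
    by (simp only: tensor_map_ten[OF A B i l] tensor_map_ten[OF B A p graded_hlists[OF A B i l]])
qed

section \<open>Transfer along a retract\<close>

lemma cx_map_comp:
  assumes "cx_map R A B f" "cx_map R B C g"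
  shows "cx_map R A C (\<lambda>d x. g d (f d x))"
  unfolding cx_map_def
proof (intro allI conjI ballI)
  fix d
  show "(\<lambda>x. g d (f d x)) \<in> lin_maps R (md A d) (md C d)"
    using cx_map_lin[OF assms(1)] cx_map_lin[OF assms(2)] by (rule lin_maps_comp)
  fix x assume x: "x \<in> carrier (md A d)"
  show "g (d - 1) (f (d - 1) (bdry A d x)) = bdry C d (g d (f d x))"
    unfolding cx_map_bdry[OF assms(1) x]
    using cx_map_bdry[OF assms(2) lin_maps_closed[OF cx_map_lin[OF assms(1)] x]] .
qed

lemma prop_homD:
  assumes "prop_hom R P Q \<phi>"
  shows prop_hom_cx: "1 \<le> m \<Longrightarrow> 1 \<le> n \<Longrightarrow> cx_map R (pcx P m n) (pcx Q m n) (\<phi> m n)"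
    and prop_hom_lact: "1 \<le> m \<Longrightarrow> 1 \<le> n \<Longrightarrow> x \<in> pel P m n d \<Longrightarrow> \<sigma> permutes {..<m} \<Longrightarrow>
      \<phi> m n d (lact P m n d \<sigma> x) = lact Q m n d \<sigma> (\<phi> m n d x)"
    and prop_hom_ract: "1 \<le> m \<Longrightarrow> 1 \<le> n \<Longrightarrow> x \<in> pel P m n d \<Longrightarrow> \<tau> permutes {..<n} \<Longrightarrow>
      \<phi> m n d (ract P m n d x \<tau>) = ract Q m n d (\<phi> m n d x) \<tau>"
    and prop_hom_vcomp: "1 \<le> m \<Longrightarrow> 1 \<le> n \<Longrightarrow> 1 \<le> k \<Longrightarrow> x \<in> pel P m n a \<Longrightarrow> y \<in> pel P n k b \<Longrightarrow>
      \<phi> m k (a + b) (vcomp P m n k a b x y) = vcomp Q m n k a b (\<phi> m n a x) (\<phi> n k b y)"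
    and prop_hom_hcomp: "1 \<le> m1 \<Longrightarrow> 1 \<le> n1 \<Longrightarrow> 1 \<le> m2 \<Longrightarrow> 1 \<le> n2 \<Longrightarrow>
      x \<in> pel P m1 n1 a \<Longrightarrow> z \<in> pel P m2 n2 b \<Longrightarrow>
      \<phi> (m1 + m2) (n1 + n2) (a + b) (hcomp P m1 n1 m2 n2 a b x z) =
      hcomp Q m1 n1 m2 n2 a b (\<phi> m1 n1 a x) (\<phi> m2 n2 b z)"
  using assms by (simp_all add: prop_hom_def)

lemma prop_hom_closed:
  assumes "prop_hom R P Q \<phi>" "1 \<le> m" "1 \<le> n" "x \<in> pel P m n d"
  shows "\<phi> m n d x \<in> pel Q m n d"
  using lin_maps_closed[OF cx_map_lin[OF prop_hom_cx[OF assms(1-3)]] assms(4)] .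

lemma prop_hom_comp:
  assumes \<phi>: "prop_hom R P Q \<phi>" and \<psi>: "prop_hom R Q S \<psi>"
  shows "prop_hom R P S (\<lambda>m n d x. \<psi> m n d (\<phi> m n d x))"
  unfolding prop_hom_def
proof (intro conjI allI impI ballI)
  show "cx_map R (pcx P m n) (pcx S m n) (\<lambda>d x. \<psi> m n d (\<phi> m n d x))" if "1 \<le> m" "1 \<le> n" for m n
    using prop_hom_cx[OF \<phi> that] prop_hom_cx[OF \<psi> that] by (rule cx_map_comp)
qed (simp_all only: prop_homD[OF \<phi>] prop_homD[OF \<psi>] prop_hom_closed[OF \<phi>])

section \<open>Internal homs and the operations of endomorphism PROPs\<close>

lemma hom_cx_carrier [simp]: "carrier (md (hom_cx R X Y) d) = hom_carrier R X Y d"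
  by (simp add: hom_cx_def)

lemma hom_carrier_lin: "g \<in> hom_carrier R X Y d \<Longrightarrow> g e \<in> lin_maps R (md X e) (md Y (e + d))"
  by (simp add: hom_carrier_def)

text \<open>The sign and the split into two blocks are prescribed on lists, and the lift takes these
  values because the expression is multilinear: a slot lies in one of the two blocks and enters
  linearly through the corresponding argument of \<open>tensor_conc\<close>.\<close>

lemma endo_hcomp:
  assumes A: "chain_complex R A"
    and f: "\<And>e. f e \<in> lin_maps R (tensor_mod R A n1 e) (tensor_mod R A m1 (e + a))"
    and g: "\<And>e. g e \<in> lin_maps R (tensor_mod R A n2 e) (tensor_mod R A m2 (e + b))"
  shows endo_hcomp_lin: "hcomp (endo_prop R A) m1 n1 m2 n2 a b f g e
      \<in> lin_maps R (tensor_mod R A (n1 + n2) e) (tensor_mod R A (m1 + m2) (e + (a + b)))"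
    and endo_hcomp_ten: "l \<in> hlists A (n1 + n2) e \<Longrightarrow>
      hcomp (endo_prop R A) m1 n1 m2 n2 a b f g e (ten R A l) =
        ksgn (tensor_mod R A (m1 + m2) (e + (a + b))) (b * tdeg (take n1 l))
          (tensor_conc R A m1 (tdeg (take n1 l) + a) m2 (tdeg (drop n1 l) + b)
             (f (tdeg (take n1 l)) (ten R A (take n1 l)))
             (g (tdeg (drop n1 l)) (ten R A (drop n1 l))))"
proof -
  let ?M = "tensor_mod R A (m1 + m2) (e + (a + b))"
  let ?c = "\<lambda>l. tensor_conc R A m1 (tdeg (take n1 l) + a) m2 (tdeg (drop n1 l) + b)
    (f (tdeg (take n1 l)) (ten R A (take n1 l))) (g (tdeg (drop n1 l)) (ten R A (drop n1 l)))"
  \<comment> \<open>\<open>tensor_conc\<close> lands in the sum of the two block degrees. For a list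
    of total degree \<open>e\<close> this is the target degree, and the equation identifies the two
    modules.\<close>
  have deg: "tdeg (take n1 l) + a + (tdeg (drop n1 l) + b) = e + (a + b)"
    if "l \<in> hlists A (n1 + n2) e" for l
    using hlists_take_drop(3)[OF that] by simp
  have fc: "f (tdeg (take n1 l)) (ten R A (take n1 l)) \<in> carrier (tensor_mod R A m1 (tdeg (take n1 l) + a))"
    and gc: "g (tdeg (drop n1 l)) (ten R A (drop n1 l)) \<in> carrier (tensor_mod R A m2 (tdeg (drop n1 l) + b))"
    if "l \<in> hlists A (n1 + n2) e" for l
    using lin_maps_closed[OF f ten_closed[OF A hlists_take_drop(1)[OF that]]]
      lin_maps_closed[OF g ten_closed[OF A hlists_take_drop(2)[OF that]]] .
  have "multilinear R A (n1 + n2) e ?M ?c"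
  proof (rule multilinearI)
    fix l assume l: "l \<in> hlists A (n1 + n2) e"
    show "?c l \<in> carrier ?M"
      using tensor_conc_closed[OF A fc[OF l] gc[OF l]] by (simp only: deg[OF l])
    fix p assume p: "p < n1 + n2"
    let ?l = "\<lambda>x. l[p := (fst (l ! p), x)]"
    let ?i = "tdeg (take n1 l)" and ?j = "tdeg (drop n1 l)"
    have len: "length l = n1 + n2" using l by (rule hlists_length)
    \<comment> \<open>The block degrees select the components of \<open>f\<close> and
      \<open>g\<close>; they do not vary with the element put into slot \<open>p\<close>.\<close>
    have t: "tdeg (take n1 (?l x)) = ?i" "tdeg (drop n1 (?l x)) = ?j" for x
      by (rule tdeg_map_fst, simp add: map_fst_update flip: take_map drop_map)+
    show "(\<lambda>x. ?c (?l x)) \<in> lin_maps R (md A (fst (l ! p))) ?M"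
    proof (cases "p < n1")
      case True
      have d: "drop n1 (?l x) = drop n1 l" "take n1 (?l x) = (take n1 l)[p := (fst (take n1 l ! p), x)]" for x
        using True len by (simp_all add: take_update_swap)
      have "(\<lambda>x. tensor_conc R A m1 (?i + a) m2 (?j + b)
          (f ?i (ten R A ((take n1 l)[p := (fst (take n1 l ! p), x)]))) (g ?j (ten R A (drop n1 l))))
          \<in> lin_maps R (md A (fst (take n1 l ! p))) (tensor_mod R A (m1 + m2) (?i + a + (?j + b)))"
        by (rule lin_maps_comp[OF lin_maps_comp[OF
              multilinear_slot[OF ten_multilinear[OF A] hlists_take_drop(1)[OF l] True] f]
            tensor_conc_lin_left[OF A gc[OF l]]])
      then show ?thesis
        unfolding t unfolding d using True by (simp only: deg[OF l] nth_take)
    next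
      case False
      let ?q = "p - n1"
      have q: "?q < n2" "drop n1 l ! ?q = l ! p" using False p len by auto
      have d: "take n1 (?l x) = take n1 l" "drop n1 (?l x) = (drop n1 l)[?q := (fst (drop n1 l ! ?q), x)]" for x
        using False p len by (simp_all add: drop_update_swap)
      have "(\<lambda>x. tensor_conc R A m1 (?i + a) m2 (?j + b) (f ?i (ten R A (take n1 l)))
          (g ?j (ten R A ((drop n1 l)[?q := (fst (drop n1 l ! ?q), x)]))))
          \<in> lin_maps R (md A (fst (drop n1 l ! ?q))) (tensor_mod R A (m1 + m2) (?i + a + (?j + b)))"
        by (rule lin_maps_comp[OF lin_maps_comp[OF
              multilinear_slot[OF ten_multilinear[OF A] hlists_take_drop(2)[OF l] q(1)] g]
            tensor_conc_lin_right[OF A fc[OF l]]])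
      then show ?thesis
        unfolding t unfolding d by (simp only: deg[OF l] q(2))
    qed
  qed
  then have "multilinear R A (n1 + n2) e ?M (\<lambda>l. ksgn ?M (b * tdeg (take n1 l)) (?c l))"
    by (rule multilinear_ksgn[OF A tensor_mod_module[OF A]])
      (auto intro!: tdeg_map_fst simp flip: take_map)
  note lift = tensor_lift[OF A tensor_mod_module[OF A] this]
  show "hcomp (endo_prop R A) m1 n1 m2 n2 a b f g e
      \<in> lin_maps R (tensor_mod R A (n1 + n2) e) ?M"
    unfolding endo_prop_def prop_data.simps Let_def by (rule lift(1))
  show "hcomp (endo_prop R A) m1 n1 m2 n2 a b f g e (ten R A l) = ksgn ?M (b * tdeg (take n1 l)) (?c l)"
    if "l \<in> hlists A (n1 + n2) e"
    unfolding endo_prop_def prop_data.simps Let_def by (rule lift(3)[OF that])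
qed

lemma hom_cx_simps:
  "g \<oplus>\<^bsub>md (hom_cx R X Y) d\<^esub> h = (\<lambda>e. \<lambda>x\<in>carrier (md X e). g e x \<oplus>\<^bsub>md Y (e + d)\<^esub> h e x)"
  "r \<odot>\<^bsub>md (hom_cx R X Y) d\<^esub> g = (\<lambda>e. \<lambda>x\<in>carrier (md X e). r \<odot>\<^bsub>md Y (e + d)\<^esub> g e x)"
  "bdry (hom_cx R X Y) d g = (\<lambda>e. \<lambda>x\<in>carrier (md X e). bdry Y (e + d) (g e x)
     \<ominus>\<^bsub>md Y (e + d - 1)\<^esub> ksgn (md Y (e + d - 1)) d (g (e - 1) (bdry X e x)))"
  by (simp_all add: hom_cx_def)

lemma endo_prop_simps:
  "pcx (endo_prop R A) m n = hom_cx R (tensor_cx R A n) (tensor_cx R A m)"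
  "lact (endo_prop R A) m n d \<sigma> g =
    (\<lambda>e. \<lambda>u\<in>carrier (tensor_mod R A n e). tensor_perm R A m (e + d) \<sigma> (g e u))"
  "ract (endo_prop R A) m n d g \<tau> =
    (\<lambda>e. \<lambda>u\<in>carrier (tensor_mod R A n e). g e (tensor_perm R A n e \<tau> u))"
  "vcomp (endo_prop R A) m n k a b g h =
    (\<lambda>e. \<lambda>u\<in>carrier (tensor_mod R A k e). g (e + b) (h e u))"
  by (simp_all add: endo_prop_def)

text \<open>Formed for an arbitrary operation \<open>g\<close>, so that transfer becomes a morphism
  of endomorphism PROPs and a structure is transferred by composing with it. The cut-off to the
  carrier is there because components in \<open>hom_carrier\<close> are extensional.\<close>

definition endo_transfer :: "'r ring \<Rightarrow> ('r, 'a) cx \<Rightarrow> ('r, 'b) cx \<Rightarrow> (int \<Rightarrow> 'a \<Rightarrow> 'b) \<Rightarrow> (int \<Rightarrow> 'b \<Rightarrow> 'a) \<Rightarrow>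
    nat \<Rightarrow> nat \<Rightarrow> int \<Rightarrow> (int \<Rightarrow> ('r, 'a) tensor \<Rightarrow> ('r, 'a) tensor) \<Rightarrow>
    int \<Rightarrow> ('r, 'b) tensor \<Rightarrow> ('r, 'b) tensor" where
  "endo_transfer R A B i p m n d g = (\<lambda>e. \<lambda>u\<in>carrier (tensor_mod R B n e).
     tensor_map R A B i m (e + d) (g e (tensor_map R B A p n e u)))"

section \<open>Conjugation by a retract as a morphism of endomorphism PROPs\<close>

context
  fixes R :: "'r ring" and A :: "('r, 'a) cx" and B :: "('r, 'b) cx" and i p
  assumes A: "chain_complex R A" and B: "chain_complex R B"
    and i: "cx_map R A B i" and p: "cx_map R B A p"
    and pi: "\<And>d x. x \<in> carrier (md A d) \<Longrightarrow> p d (i d x) = x"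
begin

private abbreviation (input) "I \<equiv> tensor_map R A B i"
private abbreviation (input) "P \<equiv> tensor_map R B A p"
private abbreviation (input) "T \<equiv> endo_transfer R A B i p"
private abbreviation (input) "EA m n d \<equiv> hom_carrier R (tensor_cx R A n) (tensor_cx R A m) d"
private abbreviation (input) "EB m n d \<equiv> hom_carrier R (tensor_cx R B n) (tensor_cx R B m) d"

private lemmas I_lin = tensor_map_lin[OF A B i]
private lemmas P_lin = tensor_map_lin[OF B A p]
private lemmas I_closed = lin_maps_closed[OF I_lin]
private lemmas P_closed = lin_maps_closed[OF P_lin]
private lemmas modA = tensor_mod_module[OF A]
private lemmas modB = tensor_mod_module[OF B]

private lemma PI: "u \<in> carrier (tensor_mod R A n d) \<Longrightarrow> P n d (I n d u) = u"
  using A B i p pi by (rule tensor_map_left_inverse)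

private lemma EA_lin: "g \<in> EA m n d \<Longrightarrow> g e \<in> lin_maps R (tensor_mod R A n e) (tensor_mod R A m (e + d))"
  using hom_carrier_lin[of g R "tensor_cx R A n" "tensor_cx R A m"] by simp

private lemma EA_closed: "g \<in> EA m n d \<Longrightarrow> u \<in> carrier (tensor_mod R A n e) \<Longrightarrow> g e u \<in> carrier (tensor_mod R A m (e + d))"
  using EA_lin by (rule lin_maps_closed)

private lemma T_apply: "u \<in> carrier (tensor_mod R B n e) \<Longrightarrow> T m n d g e u = I m (e + d) (g e (P n e u))"
  by (simp add: endo_transfer_def)

private lemma T_lin:
  assumes "g \<in> EA m n d"
  shows "T m n d g e \<in> lin_maps R (tensor_mod R B n e) (tensor_mod R B m (e + d))"
proof -
  have "(\<lambda>u. I m (e + d) (g e (P n e u))) \<in> lin_maps R (tensor_mod R B n e) (tensor_mod R B m (e + d))"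
    using lin_maps_comp[OF P_lin EA_lin[OF assms]] I_lin by (rule lin_maps_comp)
  then show ?thesis
    by (rule lin_maps_eqI[OF modB]) (rule T_apply)
qed

text \<open>Degree 0 of the internal hom consists of chain maps only, so there the compatibility of
  \<open>I\<close> and \<open>P\<close> with boundaries is needed. In negative degrees the homs are
  zero and linearity of \<open>I\<close> is enough.\<close>

private lemma T_hom:
  assumes g: "g \<in> EA m n d"
  shows "T m n d g \<in> EB m n d"
  unfolding hom_carrier_def tensor_cx_simps
proof (intro CollectI conjI allI impI ballI)
  show "T m n d g e \<in> lin_maps R (tensor_mod R B n e) (tensor_mod R B m (e + d)) \<inter>
      extensional (carrier (tensor_mod R B n e))" for e
    using T_lin[OF g] by (simp add: endo_transfer_def)
next
  fix e u assume d: "d = 0" and u: "u \<in> carrier (tensor_mod R B n e)"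
  have chain: "bdry (tensor_cx R A m) e (g e v) = g (e - 1) (bdry (tensor_cx R A n) e v)"
    if "v \<in> carrier (tensor_mod R A n e)" for v
    using g that d by (simp add: hom_carrier_def)
  have "g e (P n e u) \<in> carrier (tensor_mod R A m e)"
    using EA_closed[OF g P_closed[OF u]] d by simp
  then have "bdry (tensor_cx R B m) e (I m e (g e (P n e u))) = I m (e - 1) (g (e - 1) (P n (e - 1) (bdry (tensor_cx R B n) e u)))"
    unfolding tensor_map_bdry[OF B A p u] chain[OF P_closed[OF u], symmetric]
    by (rule tensor_map_bdry[OF A B i, symmetric])
  then show "bdry (tensor_cx R B m) e (T m n d g e u) = T m n d g (e - 1) (bdry (tensor_cx R B n) e u)"
    unfolding T_apply[OF u] T_apply[OF lin_maps_closed[OF tensor_bdry_lin[OF B] u]] d by simp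
next
  fix e u assume d: "d < 0" and u: "u \<in> carrier (tensor_mod R B n e)"
  have "g e (P n e u) = \<zero>\<^bsub>tensor_mod R A m (e + d)\<^esub>"
    using g d P_closed[OF u] by (simp add: hom_carrier_def)
  then show "T m n d g e u = \<zero>\<^bsub>tensor_mod R B m (e + d)\<^esub>"
    unfolding T_apply[OF u] using lin_maps_zero[OF modA modB I_lin] by simp
qed

text \<open>\<open>I\<close> and \<open>P\<close> have degree 0 and commute with boundaries, so
  conjugating both terms of the hom differential gives the differential of the conjugate with no
  further sign.\<close>

private lemma T_cx_map:
  "cx_map R (pcx (endo_prop R A) m n) (pcx (endo_prop R B) m n) (T m n)"
  unfolding cx_map_def endo_prop_simps hom_cx_carrier
proof (intro allI conjI ballI)
  fix d
  show "T m n d \<in> lin_maps R (md (hom_cx R (tensor_cx R A n) (tensor_cx R A m)) d)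
      (md (hom_cx R (tensor_cx R B n) (tensor_cx R B m)) d)"
  proof (rule lin_mapsI; unfold hom_cx_carrier hom_cx_simps tensor_cx_simps)
    show "T m n d g \<in> EB m n d" if "g \<in> EA m n d" for g
      using that by (rule T_hom)
    show "T m n d (\<lambda>e. \<lambda>x\<in>carrier (tensor_mod R A n e). g e x \<oplus>\<^bsub>tensor_mod R A m (e + d)\<^esub> h e x) =
        (\<lambda>e. \<lambda>x\<in>carrier (tensor_mod R B n e). T m n d g e x \<oplus>\<^bsub>tensor_mod R B m (e + d)\<^esub> T m n d h e x)"
      if "g \<in> EA m n d" "h \<in> EA m n d" for g h
      using lin_maps_add[OF I_lin EA_closed[OF that(1) P_closed] EA_closed[OF that(2) P_closed]]
      by (auto simp: endo_transfer_def P_closed fun_eq_iff)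
    show "T m n d (\<lambda>e. \<lambda>x\<in>carrier (tensor_mod R A n e). r \<odot>\<^bsub>tensor_mod R A m (e + d)\<^esub> g e x) =
        (\<lambda>e. \<lambda>x\<in>carrier (tensor_mod R B n e). r \<odot>\<^bsub>tensor_mod R B m (e + d)\<^esub> T m n d g e x)"
      if "r \<in> carrier R" "g \<in> EA m n d" for r g
      using lin_maps_smult[OF I_lin that(1) EA_closed[OF that(2) P_closed]]
      by (auto simp: endo_transfer_def P_closed fun_eq_iff)
  qed
  fix g assume g: "g \<in> EA m n d"
  show "T m n (d - 1) (bdry (hom_cx R (tensor_cx R A n) (tensor_cx R A m)) d g) =
      bdry (hom_cx R (tensor_cx R B n) (tensor_cx R B m)) d (T m n d g)"
  proof (rule ext)
    fix e
    have "I m (e + d - 1) (bdry (tensor_cx R A m) (e + d) (g e (P n e u))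
          \<ominus>\<^bsub>tensor_mod R A m (e + d - 1)\<^esub>
            ksgn (tensor_mod R A m (e + d - 1)) d (g (e - 1) (bdry (tensor_cx R A n) e (P n e u)))) =
        bdry (tensor_cx R B m) (e + d) (T m n d g e u)
          \<ominus>\<^bsub>tensor_mod R B m (e + d - 1)\<^esub>
            ksgn (tensor_mod R B m (e + d - 1)) d (T m n d g (e - 1) (bdry (tensor_cx R B n) e u))"
      if u: "u \<in> carrier (tensor_mod R B n e)" for u
    proof -
      have gu: "g e (P n e u) \<in> carrier (tensor_mod R A m (e + d))"
        using EA_closed[OF g P_closed[OF u]] .
      have bu: "bdry (tensor_cx R B n) e u \<in> carrier (tensor_mod R B n (e - 1))"
        using lin_maps_closed[OF tensor_bdry_lin[OF B] u] .
      \<comment> \<open>\<open>g (e - 1)\<close> lands in degree \<open>e - 1 + d\<close>, while the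
        hom differential is written with \<open>e + d - 1\<close>.\<close>
      have shift: "e - 1 + d = e + d - 1" by simp
      have gb: "g (e - 1) (P n (e - 1) (bdry (tensor_cx R B n) e u)) \<in> carrier (tensor_mod R A m (e + d - 1))"
        using EA_closed[OF g P_closed[OF bu]] by (simp only: shift)
      show ?thesis
        unfolding T_apply[OF u] T_apply[OF bu] shift tensor_map_bdry[OF B A p u, symmetric]
          tensor_map_bdry[OF A B i gu, symmetric]
          lin_maps_minus[OF modA modB I_lin lin_maps_closed[OF tensor_bdry_lin[OF A] gu] ksgn_closed[OF modA gb]]
          lin_maps_ksgn[OF modA modB I_lin gb] ..
    qed
    then show "T m n (d - 1) (bdry (hom_cx R (tensor_cx R A n) (tensor_cx R A m)) d g) e =
        bdry (hom_cx R (tensor_cx R B n) (tensor_cx R B m)) d (T m n d g) e"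
      unfolding hom_cx_simps tensor_cx_simps endo_transfer_def[of _ _ _ _ _ _ _ "d - 1"]
      by (intro restrict_ext) (simp add: P_closed add_diff_eq)
  qed
qed

text \<open>The conjugate of the horizontal composite is linear, extensional and has the prescribed
  values on elementary tensors, so uniqueness of lifts identifies it. \<open>P\<close> splits along
  the two blocks of a list, \<open>I\<close> respects concatenation, and the sign survives because
  \<open>P\<close> keeps the block degrees.\<close>

private lemma T_hcomp:
  assumes f: "f \<in> EA m1 n1 a" and g: "g \<in> EA m2 n2 b"
  shows "T (m1 + m2) (n1 + n2) (a + b) (hcomp (endo_prop R A) m1 n1 m2 n2 a b f g) =
    hcomp (endo_prop R B) m1 n1 m2 n2 a b (T m1 n1 a f) (T m2 n2 b g)"
proof (rule ext)
  fix e
  let ?h = "hcomp (endo_prop R A) m1 n1 m2 n2 a b f g"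
  have h: "?h e \<in> lin_maps R (tensor_mod R A (n1 + n2) e) (tensor_mod R A (m1 + m2) (e + (a + b)))" for e
    using A EA_lin[OF f] EA_lin[OF g] by (rule endo_hcomp_lin)
  have "(\<lambda>u. I (m1 + m2) (e + (a + b)) (?h e (P (n1 + n2) e u)))
      \<in> lin_maps R (tensor_mod R B (n1 + n2) e) (tensor_mod R B (m1 + m2) (e + (a + b)))"
    using lin_maps_comp[OF P_lin h] I_lin by (rule lin_maps_comp)
  then have lin: "T (m1 + m2) (n1 + n2) (a + b) ?h e
      \<in> lin_maps R (tensor_mod R B (n1 + n2) e) (tensor_mod R B (m1 + m2) (e + (a + b)))"
    by (rule lin_maps_eqI[OF modB]) (rule T_apply)
  have ext: "T (m1 + m2) (n1 + n2) (a + b) ?h e \<in> extensional (carrier (tensor_mod R B (n1 + n2) e))"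
    unfolding endo_transfer_def by (rule restrict_extensional)
  have val: "T (m1 + m2) (n1 + n2) (a + b) ?h e (ten R B l) =
      (let i = tdeg (take n1 l); j = tdeg (drop n1 l) in
         ksgn (tensor_mod R B (m1 + m2) (e + (a + b))) (b * i)
           (tensor_conc R B m1 (i + a) m2 (j + b)
              (T m1 n1 a f i (ten R B (take n1 l))) (T m2 n2 b g j (ten R B (drop n1 l)))))"
    if l: "l \<in> hlists B (n1 + n2) e" for l
  proof -
    let ?p = "map (\<lambda>(i, a). (i, p i a))"
    define j k where jk: "j = tdeg (take n1 l)" "k = tdeg (drop n1 l)"
    note td = hlists_take_drop[OF l, folded jk]
    have t: "ten R B (take n1 l) \<in> carrier (tensor_mod R B n1 j)"
      "ten R B (drop n1 l) \<in> carrier (tensor_mod R B n2 k)"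
      using ten_closed[OF B td(1)] ten_closed[OF B td(2)] .
    have pl: "?p l \<in> hlists A (n1 + n2) e" using B A p l by (rule graded_hlists)
    have deg: "e + (a + b) = j + a + (k + b)" using td(3) by simp
    have fu: "f j (P n1 j (ten R B (take n1 l))) \<in> carrier (tensor_mod R A m1 (j + a))"
      using EA_closed[OF f P_closed[OF t(1)]] .
    have gv: "g k (P n2 k (ten R B (drop n1 l))) \<in> carrier (tensor_mod R A m2 (k + b))"
      using EA_closed[OF g P_closed[OF t(2)]] .
    have "?h e (P (n1 + n2) e (ten R B l)) = ksgn (tensor_mod R A (m1 + m2) (e + (a + b))) (b * j)
        (tensor_conc R A m1 (j + a) m2 (k + b)
          (f j (P n1 j (ten R B (take n1 l)))) (g k (P n2 k (ten R B (drop n1 l)))))"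
      unfolding tensor_map_ten[OF B A p l] tensor_map_ten[OF B A p td(1)] tensor_map_ten[OF B A p td(2)]
        endo_hcomp_ten[OF A EA_lin[OF f] EA_lin[OF g] pl] take_map drop_map tdeg_graded jk[symmetric] ..
    then have "T (m1 + m2) (n1 + n2) (a + b) ?h e (ten R B l) =
        I (m1 + m2) (e + (a + b)) (ksgn (tensor_mod R A (m1 + m2) (e + (a + b))) (b * j)
        (tensor_conc R A m1 (j + a) m2 (k + b)
          (f j (P n1 j (ten R B (take n1 l)))) (g k (P n2 k (ten R B (drop n1 l))))))"
      unfolding T_apply[OF ten_closed[OF B l]] by (rule arg_cong)
    also have "\<dots> = ksgn (tensor_mod R B (m1 + m2) (e + (a + b))) (b * j)
        (tensor_conc R B m1 (j + a) m2 (k + b)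
          (T m1 n1 a f j (ten R B (take n1 l))) (T m2 n2 b g k (ten R B (drop n1 l))))"
      unfolding deg lin_maps_ksgn[OF modA modB I_lin tensor_conc_closed[OF A fu gv]]
        tensor_map_conc[OF A B i fu gv] T_apply[OF t(1)] T_apply[OF t(2)] ..
    finally show ?thesis by (simp only: jk Let_def)
  qed
  show "T (m1 + m2) (n1 + n2) (a + b) ?h e =
      hcomp (endo_prop R B) m1 n1 m2 n2 a b (T m1 n1 a f) (T m2 n2 b g) e"
    unfolding endo_prop_def[of R B] prop_data.simps
    using B modB lin ext val by (rule tensor_lift_eqI[symmetric])
qed

lemma endo_transfer_prop_hom: "prop_hom R (endo_prop R A) (endo_prop R B) (endo_transfer R A B i p)"
  unfolding prop_hom_def
proof (intro conjI allI impI ballI)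
  show "cx_map R (pcx (endo_prop R A) m n) (pcx (endo_prop R B) m n) (T m n)" for m n
    by (rule T_cx_map)
next
  fix m n d g \<sigma> assume "g \<in> pel (endo_prop R A) m n d" and \<sigma>: "\<sigma> permutes {..<m}"
  then have g: "g \<in> EA m n d" by (simp add: endo_prop_simps)
  have "I m (e + d) (tensor_perm R A m (e + d) \<sigma> (g e (P n e u))) =
      tensor_perm R B m (e + d) \<sigma> (I m (e + d) (g e (P n e u)))"
    if "u \<in> carrier (tensor_mod R B n e)" for e u
    using tensor_map_perm[OF A B i \<sigma> EA_closed[OF g P_closed[OF that]]] .
  then show "T m n d (lact (endo_prop R A) m n d \<sigma> g) = lact (endo_prop R B) m n d \<sigma> (T m n d g)"
    by (auto simp: endo_prop_simps endo_transfer_def P_closed fun_eq_iff)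
next
  fix m n d g \<tau> assume "g \<in> pel (endo_prop R A) m n d" and \<tau>: "\<tau> permutes {..<n}"
  have "tensor_perm R A n e \<tau> (P n e u) = P n e (tensor_perm R B n e \<tau> u)"
    "tensor_perm R B n e \<tau> u \<in> carrier (tensor_mod R B n e)"
    if "u \<in> carrier (tensor_mod R B n e)" for e u
    using tensor_map_perm[OF B A p \<tau> that] lin_maps_closed[OF tensor_perm_lin[OF B \<tau>] that] by simp_all
  then show "T m n d (ract (endo_prop R A) m n d g \<tau>) = ract (endo_prop R B) m n d (T m n d g) \<tau>"
    by (auto simp: endo_prop_simps endo_transfer_def P_closed fun_eq_iff)
next
  fix m n k a b g h assume "g \<in> pel (endo_prop R A) m n a" "h \<in> pel (endo_prop R A) n k b"
  then have h: "h \<in> EA n k b" by (simp add: endo_prop_simps)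
  \<comment> \<open>Here \<open>p i = id\<close> enters: the \<open>I\<close> at the output of
    \<open>h\<close> meets the \<open>P\<close> at the input of \<open>g\<close>.\<close>
  have "P n (e + b) (I n (e + b) (h e (P k e u))) = h e (P k e u)"
    "I n (e + b) (h e (P k e u)) \<in> carrier (tensor_mod R B n (e + b))"
    if "u \<in> carrier (tensor_mod R B k e)" for e u
    using PI[OF EA_closed[OF h P_closed[OF that]]] I_closed[OF EA_closed[OF h P_closed[OF that]]] .
  then show "T m k (a + b) (vcomp (endo_prop R A) m n k a b g h) =
      vcomp (endo_prop R B) m n k a b (T m n a g) (T n k b h)"
    by (auto simp: endo_prop_simps endo_transfer_def P_closed fun_eq_iff add.assoc add.commute[of a b])
next
  fix m1 n1 m2 n2 a b f g assume "f \<in> pel (endo_prop R A) m1 n1 a" "g \<in> pel (endo_prop R A) m2 n2 b"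
  then show "T (m1 + m2) (n1 + n2) (a + b) (hcomp (endo_prop R A) m1 n1 m2 n2 a b f g) =
      hcomp (endo_prop R B) m1 n1 m2 n2 a b (T m1 n1 a f) (T m2 n2 b g)"
    by (intro T_hcomp) (simp_all add: endo_prop_simps)
qed

text \<open>The new structure is \<open>\<alpha>\<close> followed by the conjugation. Then
  \<open>\<beta>(x) I = I \<alpha>(x) P I = I \<alpha>(x)\<close> and
  \<open>P \<beta>(x) = P I \<alpha>(x) P = \<alpha>(x) P\<close>. The first identity serves an
  injective \<open>f\<close>, the second a surjective one.\<close>

lemma prop_algebra_transfer:
  assumes \<alpha>: "prop_algebra R Q A \<alpha>"
  obtains \<beta> where "prop_algebra R Q B \<beta>" "prop_algebra_hom R Q A B \<alpha> \<beta> i" "prop_algebra_hom R Q B A \<beta> \<alpha> p"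
proof
  let ?\<beta> = "\<lambda>m n d x. T m n d (\<alpha> m n d x)"
  have \<alpha>_hom: "prop_hom R Q (endo_prop R A) \<alpha>" using \<alpha> by (simp add: prop_algebra_def)
  then show "prop_algebra R Q B ?\<beta>"
    unfolding prop_algebra_def using endo_transfer_prop_hom by (rule prop_hom_comp)
  have \<alpha>_EA: "\<alpha> m n d x \<in> EA m n d" if "1 \<le> m" "1 \<le> n" "x \<in> pel Q m n d" for m n d x
    using prop_hom_closed[OF \<alpha>_hom that] by (simp add: endo_prop_simps)
  show "prop_algebra_hom R Q A B \<alpha> ?\<beta> i"
    unfolding prop_algebra_hom_def by (auto simp: i T_apply I_closed PI)
  show "prop_algebra_hom R Q B A ?\<beta> \<alpha> p"
    unfolding prop_algebra_hom_def
    by (auto simp: p T_apply intro!: PI EA_closed[OF \<alpha>_EA] P_closed)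
qed

end

section \<open>Splitting complexes over a field\<close>

text \<open>Supplies the upper bounds for Zorn's lemma: two elements of the union already lie in a
  common member of the chain.\<close>

lemma submodule_Union_chain:
  assumes "module R W" "\<C> \<noteq> {}" "\<And>G. G \<in> \<C> \<Longrightarrow> submodule G R W"
    and chain: "\<And>G H. G \<in> \<C> \<Longrightarrow> H \<in> \<C> \<Longrightarrow> G \<subseteq> H \<or> H \<subseteq> G"
  shows "submodule (\<Union>\<C>) R W"
proof -
  interpret W: module R W by fact
  note sub = W.submoduleE[OF assms(3)]
  show ?thesis
  proof (rule W.submoduleI)
    show "\<Union>\<C> \<subseteq> carrier W" using sub(1) by blast
    show "\<zero>\<^bsub>W\<^esub> \<in> \<Union>\<C>" using assms(2,3) submodule_zero by blast
    show "\<ominus>\<^bsub>W\<^esub> a \<in> \<Union>\<C>" if "a \<in> \<Union>\<C>" for a using that sub(3) by blast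
    show "r \<odot>\<^bsub>W\<^esub> a \<in> \<Union>\<C>" if "r \<in> carrier R" "a \<in> \<Union>\<C>" for r a using that sub(4) by blast
    fix a b assume "a \<in> \<Union>\<C>" "b \<in> \<Union>\<C>"
    then obtain G H where "G \<in> \<C>" "a \<in> G" "H \<in> \<C>" "b \<in> H" by blast
    then obtain K where "K \<in> \<C>" "a \<in> K" "b \<in> K" using chain[of G H] by blast
    then show "a \<oplus>\<^bsub>W\<^esub> b \<in> \<Union>\<C>" using sub(5)[of K a b] by blast
  qed
qed

text \<open>The enlargement by one vector that contradicts maximality in the construction of
  complements.\<close>

lemma submodule_adjoin:
  assumes "module R W" and G: "submodule G R W" and s: "s \<in> carrier W"
  shows "submodule {g \<oplus>\<^bsub>W\<^esub> r \<odot>\<^bsub>W\<^esub> s | g r. g \<in> G \<and> r \<in> carrier R} R W" (is "submodule ?H R W")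
proof -
  interpret W: module R W by fact
  note sub = W.submoduleE[OF G]
  have I: "x \<in> ?H" if "x = g \<oplus>\<^bsub>W\<^esub> r \<odot>\<^bsub>W\<^esub> s" "g \<in> G" "r \<in> carrier R" for x g r
    using that by blast
  show ?thesis
  proof (rule W.submoduleI)
    show "?H \<subseteq> carrier W" using sub(1) s by blast
    show "\<zero>\<^bsub>W\<^esub> \<in> ?H"
      using s submodule_zero[OF G] by (intro I[of _ "\<zero>\<^bsub>W\<^esub>" "\<zero>\<^bsub>R\<^esub>"]) auto
  next
    fix x assume "x \<in> ?H"
    then obtain g r where x: "x = g \<oplus>\<^bsub>W\<^esub> r \<odot>\<^bsub>W\<^esub> s" "g \<in> G" "r \<in> carrier R" by blast
    have g: "g \<in> carrier W" using x sub(1) by blast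
    show "\<ominus>\<^bsub>W\<^esub> x \<in> ?H"
      using x g s sub(3) by (intro I[of _ "\<ominus>\<^bsub>W\<^esub> g" "\<ominus>\<^bsub>R\<^esub> r"]) (auto simp: W.smult_l_minus W.M.minus_add)
    show "t \<odot>\<^bsub>W\<^esub> x \<in> ?H" if "t \<in> carrier R" for t
      using that x g s sub(4)
      by (intro I[of _ "t \<odot>\<^bsub>W\<^esub> g" "t \<otimes>\<^bsub>R\<^esub> r"]) (auto simp: W.smult_r_distr W.smult_assoc1)
    fix y assume "y \<in> ?H"
    then obtain h t where y: "y = h \<oplus>\<^bsub>W\<^esub> t \<odot>\<^bsub>W\<^esub> s" "h \<in> G" "t \<in> carrier R" by blast
    have h: "h \<in> carrier W" using y sub(1) by blast
    show "x \<oplus>\<^bsub>W\<^esub> y \<in> ?H"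
      using x y g h s sub(5)
      by (intro I[of _ "g \<oplus>\<^bsub>W\<^esub> h" "r \<oplus>\<^bsub>R\<^esub> t"]) (auto simp: W.smult_l_distr W.M.add.m_ac)
  qed
qed

text \<open>Zorn's lemma gives a \<open>G\<close> maximal among the submodules between
  \<open>G0\<close> and \<open>S\<close> that meet \<open>V\<close> in zero; a vector of
  \<open>S\<close> outside \<open>G + V\<close> could be adjoined to it. \<open>V\<close> may stick
  out of \<open>S\<close>, so \<open>S\<close> is only covered by the sum. The lower bound
  \<open>G0\<close> allows a choice made before to be extended.\<close>

lemma submodule_complement:
  assumes "field R" and W: "module R W" and G0: "submodule G0 R W" and S: "submodule S R W"
    and V: "submodule V R W" and sub: "G0 \<subseteq> S" and triv: "G0 \<inter> V \<subseteq> {\<zero>\<^bsub>W\<^esub>}"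
  obtains G where "submodule G R W" "G0 \<subseteq> G" "G \<subseteq> S" "G \<inter> V \<subseteq> {\<zero>\<^bsub>W\<^esub>}"
    and "\<And>s. s \<in> S \<Longrightarrow> \<exists>g\<in>G. \<exists>v\<in>V. s = g \<oplus>\<^bsub>W\<^esub> v"
proof -
  interpret R: field R by fact
  interpret W: module R W by fact
  define \<A> where "\<A> = {G. submodule G R W \<and> G0 \<subseteq> G \<and> G \<subseteq> S \<and> G \<inter> V \<subseteq> {\<zero>\<^bsub>W\<^esub>}}"
  have "\<A> \<noteq> {}" using G0 sub triv by (auto simp: \<A>_def)
  moreover have "\<Union>\<C> \<in> \<A>" if ne: "\<C> \<noteq> {}" and ch: "subset.chain \<A> \<C>" for \<C>
  proof -
    have \<C>: "submodule G R W" "G0 \<subseteq> G" "G \<subseteq> S" "G \<inter> V \<subseteq> {\<zero>\<^bsub>W\<^esub>}" if "G \<in> \<C>" for G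
      using ch that by (auto simp: subset.chain_def \<A>_def)
    have "submodule (\<Union>\<C>) R W"
      using W ne \<C>(1) by (rule submodule_Union_chain) (use ch in \<open>auto simp: subset_chain_def\<close>)
    moreover have "G0 \<subseteq> \<Union>\<C>" using ne \<C>(2) by blast
    moreover have "\<Union>\<C> \<subseteq> S" using \<C>(3) by blast
    moreover have "\<Union>\<C> \<inter> V \<subseteq> {\<zero>\<^bsub>W\<^esub>}" using \<C>(4) by blast
    ultimately show ?thesis by (simp add: \<A>_def)
  qed
  ultimately obtain G where "G \<in> \<A>" and max: "\<And>H. H \<in> \<A> \<Longrightarrow> G \<subseteq> H \<Longrightarrow> H = G"
    using subset_Zorn_nonempty[of \<A>] by blast
  then have G: "submodule G R W" "G0 \<subseteq> G" "G \<subseteq> S" "G \<inter> V \<subseteq> {\<zero>\<^bsub>W\<^esub>}" by (auto simp: \<A>_def)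
  note GE = W.submoduleE[OF G(1)] and SE = W.submoduleE[OF S] and VE = W.submoduleE[OF V]
  have "\<exists>g\<in>G. \<exists>v\<in>V. s = g \<oplus>\<^bsub>W\<^esub> v" if s: "s \<in> S" for s
  proof (rule ccontr)
    assume no: "\<not> (\<exists>g\<in>G. \<exists>v\<in>V. s = g \<oplus>\<^bsub>W\<^esub> v)"
    have sW: "s \<in> carrier W" using s SE(1) by blast
    let ?H = "{g \<oplus>\<^bsub>W\<^esub> r \<odot>\<^bsub>W\<^esub> s | g r. g \<in> G \<and> r \<in> carrier R}"
    have H: "submodule ?H R W" using W G(1) sW by (rule submodule_adjoin)
    have GH: "G \<subseteq> ?H"
    proof
      fix g assume g: "g \<in> G"
      then have "g = g \<oplus>\<^bsub>W\<^esub> \<zero>\<^bsub>R\<^esub> \<odot>\<^bsub>W\<^esub> s" using GE(1) sW by auto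
      then show "g \<in> ?H" using g R.zero_closed by blast
    qed
    have HS: "?H \<subseteq> S" using G(3) SE(4,5) s by blast
    have HV: "?H \<inter> V \<subseteq> {\<zero>\<^bsub>W\<^esub>}"
    proof
      fix v assume "v \<in> ?H \<inter> V"
      then obtain g r where v: "v = g \<oplus>\<^bsub>W\<^esub> r \<odot>\<^bsub>W\<^esub> s" "g \<in> G" "r \<in> carrier R" "v \<in> V" by blast
      have gv: "g \<in> carrier W" "v \<in> carrier W" using v GE(1) VE(1) by blast+
      show "v \<in> {\<zero>\<^bsub>W\<^esub>}"
      proof (cases "r = \<zero>\<^bsub>R\<^esub>")
        case True
        then have "v = g" using v(1) gv sW by simp
        then show ?thesis using v G(4) by blast
      next
        case False
        \<comment> \<open>Over a field a nonzero \<open>r\<close> can be divided out, which would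
          write \<open>s\<close> as an element of \<open>G\<close> plus one of
          \<open>V\<close>.\<close>
        then have r: "r \<in> Units R" using v(3) R.field_Units by blast
        let ?q = "inv\<^bsub>R\<^esub> r"
        have q: "?q \<in> carrier R" using r by (rule R.Units_inv_closed)
        have "r \<odot>\<^bsub>W\<^esub> s = \<ominus>\<^bsub>W\<^esub> g \<oplus>\<^bsub>W\<^esub> v"
          using v(1,3) gv sW by (simp add: W.M.r_neg1 W.M.r_neg2)
        then have "?q \<odot>\<^bsub>W\<^esub> (r \<odot>\<^bsub>W\<^esub> s) = ?q \<odot>\<^bsub>W\<^esub> (\<ominus>\<^bsub>W\<^esub> g) \<oplus>\<^bsub>W\<^esub> ?q \<odot>\<^bsub>W\<^esub> v"
          using gv q by (simp add: W.smult_r_distr)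
        moreover have "?q \<odot>\<^bsub>W\<^esub> (r \<odot>\<^bsub>W\<^esub> s) = s"
          using W.smult_assoc1[OF q v(3) sW] R.Units_l_inv[OF r] sW by simp
        ultimately show ?thesis using no GE(3,4) VE(4) v(2,4) q by metis
      qed
    qed
    have "?H = G" using H G(2) GH HS HV by (intro max) (auto simp: \<A>_def)
    moreover have "s = \<zero>\<^bsub>W\<^esub> \<oplus>\<^bsub>W\<^esub> \<one>\<^bsub>R\<^esub> \<odot>\<^bsub>W\<^esub> s" using sW by simp
    then have "s \<in> ?H" using submodule_zero[OF G(1)] R.one_closed by blast
    ultimately have "s \<in> G" by blast
    moreover have "s = s \<oplus>\<^bsub>W\<^esub> \<zero>\<^bsub>W\<^esub>" using sW by simp
    ultimately show False using no submodule_zero[OF V] by blast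
  qed
  then show ?thesis using that G by blast
qed

lemma chain_complex_bdry_bdry:
  "chain_complex R A \<Longrightarrow> x \<in> carrier (md A d) \<Longrightarrow> bdry A (d - 1) (bdry A d x) = \<zero>\<^bsub>md A (d - 2)\<^esub>"
  by (simp add: chain_complex_def)

lemma chain_complex_negative: "chain_complex R A \<Longrightarrow> d < 0 \<Longrightarrow> carrier (md A d) = {\<zero>\<^bsub>md A d\<^esub>}"
  by (simp add: chain_complex_def)

lemma boundaries_submodule:
  assumes "chain_complex R A"
  shows "submodule (boundaries A d) R (md A d)"
  using submodule_image[OF chain_complex_module[OF assms] chain_complex_module[OF assms]
      chain_complex_bdry[OF assms], of "d + 1"]
  by (simp add: boundaries_def)

text \<open>The condition on \<open>V\<close> says that the connecting homomorphisms \<open>H(B/V) \<rightarrow> H(V)\<close> vanish.\<close>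

lemma subcomplex_complement:
  fixes B :: "('r, 'b) cx"
  assumes "field R" and B: "chain_complex R B"
    and V: "\<And>d. submodule (V d) R (md B d)"
    and conn: "\<And>d x. x \<in> carrier (md B d) \<Longrightarrow> bdry B d x \<in> V (d - 1) \<Longrightarrow> \<exists>v\<in>V d. bdry B d v = bdry B d x"
  obtains C where "\<And>d. submodule (C d) R (md B d)" "\<And>d x. x \<in> C d \<Longrightarrow> bdry B d x \<in> C (d - 1)"
    and "\<And>d. C d \<inter> V d \<subseteq> {\<zero>\<^bsub>md B d\<^esub>}"
    and "\<And>d x. x \<in> carrier (md B d) \<Longrightarrow> \<exists>c\<in>C d. \<exists>v\<in>V d. x = c \<oplus>\<^bsub>md B d\<^esub> v"
proof -
  interpret B: module R "md B d" for d using B by (rule chain_complex_module)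
  note zero = submodule_zero
  note lin = chain_complex_bdry[OF B]
  note VE = B.submoduleE[OF V]
  \<comment> \<open>The last clause keeps the induction on degree going: it lets an element of degree \<open>d + 1\<close> be
    corrected by an element of \<open>V\<close> so that its boundary lands in the complement already chosen.\<close>
  define good where "good d X \<longleftrightarrow> submodule X R (md B d) \<and> X \<inter> V d \<subseteq> {\<zero>\<^bsub>md B d\<^esub>} \<and>
      (\<forall>x\<in>carrier (md B d). \<exists>c\<in>X. \<exists>v\<in>V d. x = c \<oplus>\<^bsub>md B d\<^esub> v) \<and>
      (\<forall>b\<in>boundaries B d. \<exists>c\<in>X. \<exists>v\<in>V (d + 1). b = c \<oplus>\<^bsub>md B d\<^esub> bdry B (d + 1) v)" for d X
  \<comment> \<open>Below degree 0 the complex vanishes and zero is a complement; this starts the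
    recursion.\<close>
  have base: "good d {\<zero>\<^bsub>md B d\<^esub>}" if "d < 0" for d
  proof -
    have c: "carrier (md B d) = {\<zero>\<^bsub>md B d\<^esub>}" using B that by (rule chain_complex_negative)
    have "boundaries B d \<subseteq> {\<zero>\<^bsub>md B d\<^esub>}"
      using submodule_carrier[OF B.module_axioms boundaries_submodule[OF B]] c by blast
    moreover have "bdry B (d + 1) \<zero>\<^bsub>md B (d + 1)\<^esub> = \<zero>\<^bsub>md B d\<^esub>"
      using lin_maps_zero[OF B.module_axioms B.module_axioms lin[of "d + 1"]] by simp
    ultimately have "\<exists>c\<in>{\<zero>\<^bsub>md B d\<^esub>}. \<exists>v\<in>V (d + 1). b = c \<oplus>\<^bsub>md B d\<^esub> bdry B (d + 1) v"
      if "b \<in> boundaries B d" for b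
      using that zero[OF V[of "d + 1"]] by (intro bexI[of _ "\<zero>\<^bsub>md B d\<^esub>"] bexI[of _ "\<zero>\<^bsub>md B (d + 1)\<^esub>"]) auto
    moreover have "\<exists>c\<in>{\<zero>\<^bsub>md B d\<^esub>}. \<exists>v\<in>V d. x = c \<oplus>\<^bsub>md B d\<^esub> v" if "x \<in> carrier (md B d)" for x
      using that zero[OF V[of d]] unfolding c
      by (intro bexI[of _ "\<zero>\<^bsub>md B d\<^esub>"] bexI[of _ "\<zero>\<^bsub>md B d\<^esub>"]) auto
    ultimately show ?thesis
      using submodule_zero_mod[OF B.module_axioms] by (simp add: good_def)
  qed
  have step: "\<exists>Y. good (d + 1) Y \<and> (\<forall>y\<in>Y. bdry B (d + 1) y \<in> X)" if "good d X" for d X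
  proof -
    let ?e = "d + 1"
    have lin1: "bdry B ?e \<in> lin_maps R (md B ?e) (md B d)" using lin[of ?e] by simp
    from that have X: "submodule X R (md B d)"
      and Xb: "\<And>b. b \<in> boundaries B d \<Longrightarrow> \<exists>c\<in>X. \<exists>v\<in>V ?e. b = c \<oplus>\<^bsub>md B d\<^esub> bdry B ?e v"
      by (auto simp: good_def)
    note XE = B.submoduleE[OF X] and D = boundaries_submodule[OF B, of ?e]
    note DE = B.submoduleE[OF D]
    have triv: "{\<zero>\<^bsub>md B ?e\<^esub>} \<subseteq> boundaries B ?e" "{\<zero>\<^bsub>md B ?e\<^esub>} \<inter> V ?e \<subseteq> {\<zero>\<^bsub>md B ?e\<^esub>}"
      using zero[OF D] by simp_all
    \<comment> \<open>\<open>G\<close> is a complement of \<open>V\<close> within the boundaries.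
      Including it in \<open>Y\<close> is what will give \<open>Y\<close> the last clause of
      \<open>good\<close>.\<close>
    obtain G where G: "submodule G R (md B ?e)" "{\<zero>\<^bsub>md B ?e\<^esub>} \<subseteq> G" "G \<subseteq> boundaries B ?e"
      "G \<inter> V ?e \<subseteq> {\<zero>\<^bsub>md B ?e\<^esub>}"
      and Gb: "\<And>b. b \<in> boundaries B ?e \<Longrightarrow> \<exists>g\<in>G. \<exists>v\<in>V ?e. b = g \<oplus>\<^bsub>md B ?e\<^esub> v"
      by (rule submodule_complement[OF assms(1) B.module_axioms submodule_zero_mod[OF B.module_axioms] D V[of ?e] triv]) (rule that)
    \<comment> \<open>Choosing \<open>Y\<close> among the elements whose boundary falls in
      \<open>X\<close> makes the complements a subcomplex. \<open>G\<close> fits in because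
      boundaries are cycles.\<close>
    let ?T = "{x \<in> carrier (md B ?e). bdry B ?e x \<in> X}"
    have T: "submodule ?T R (md B ?e)"
      using B.module_axioms B.module_axioms lin1 X by (rule submodule_vimage)
    have "bdry B ?e b = \<zero>\<^bsub>md B d\<^esub>" if "b \<in> boundaries B ?e" for b
      using that chain_complex_bdry_bdry[OF B, of _ "?e + 1"] by (auto simp: boundaries_def add.commute)
    then have GT: "G \<subseteq> ?T" using G(3) DE(1) zero[OF X] by auto
    obtain Y where Y: "submodule Y R (md B ?e)" "G \<subseteq> Y" "Y \<subseteq> ?T" "Y \<inter> V ?e \<subseteq> {\<zero>\<^bsub>md B ?e\<^esub>}"
      and Yt: "\<And>t. t \<in> ?T \<Longrightarrow> \<exists>y\<in>Y. \<exists>v\<in>V ?e. t = y \<oplus>\<^bsub>md B ?e\<^esub> v"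
      by (rule submodule_complement[OF assms(1) B.module_axioms G(1) T V[of ?e] GT G(4)]) (rule that)
    note YE = B.submoduleE[OF Y(1)]
    have "\<exists>c\<in>Y. \<exists>v\<in>V ?e. x = c \<oplus>\<^bsub>md B ?e\<^esub> v" if x: "x \<in> carrier (md B ?e)" for x
    proof -
      \<comment> \<open>\<open>?T\<close> need not be everything, but the last clause for
        \<open>X\<close> provides a \<open>v\<close> in \<open>V\<close> such that the boundary of
        \<open>x\<close> minus \<open>v\<close> lies in \<open>X\<close>.\<close>
      have "bdry B ?e x \<in> boundaries B d" using x by (simp add: boundaries_def)
      then obtain c v where c: "c \<in> X" and v: "v \<in> V ?e" and eq: "bdry B ?e x = c \<oplus>\<^bsub>md B d\<^esub> bdry B ?e v"
        using Xb by blast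
      have vc: "v \<in> carrier (md B ?e)" "c \<in> carrier (md B d)" using v c VE(1) XE(1) by blast+
      have "bdry B ?e (x \<ominus>\<^bsub>md B ?e\<^esub> v) = c"
        using lin_maps_minus[OF B.module_axioms B.module_axioms lin1 x vc(1)] eq vc
          lin_maps_closed[OF lin1] x by (simp add: B.M.minus_eq_iff)
      then have "x \<ominus>\<^bsub>md B ?e\<^esub> v \<in> ?T" using c x vc by simp
      then obtain y w where y: "y \<in> Y" and w: "w \<in> V ?e" and "x \<ominus>\<^bsub>md B ?e\<^esub> v = y \<oplus>\<^bsub>md B ?e\<^esub> w"
        using Yt by blast
      moreover have "y \<in> carrier (md B ?e)" "w \<in> carrier (md B ?e)" using y w YE(1) VE(1) by blast+
      ultimately have "x = y \<oplus>\<^bsub>md B ?e\<^esub> (w \<oplus>\<^bsub>md B ?e\<^esub> v)"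
        using x vc by (simp add: B.M.minus_eq_iff B.M.a_assoc)
      then show ?thesis using y VE(5)[OF w v] by blast
    qed
    moreover have "\<exists>c\<in>Y. \<exists>v\<in>V (?e + 1). b = c \<oplus>\<^bsub>md B ?e\<^esub> bdry B (?e + 1) v"
      if b: "b \<in> boundaries B ?e" for b
    proof -
      obtain g v where g: "g \<in> G" and v: "v \<in> V ?e" and eq: "b = g \<oplus>\<^bsub>md B ?e\<^esub> v"
        using Gb[OF b] by blast
      have "g \<in> boundaries B ?e" using g G(3) by blast
      then have "b \<ominus>\<^bsub>md B ?e\<^esub> g \<in> boundaries B ?e"
        using submodule_minus[OF B.module_axioms D b] by blast
      moreover have "b \<ominus>\<^bsub>md B ?e\<^esub> g = v"
      proof -
        have "g \<in> carrier (md B ?e)" "v \<in> carrier (md B ?e)" using \<open>g \<in> boundaries B ?e\<close> DE(1) v VE(1) by blast+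
        then show ?thesis using eq by (simp add: B.M.minus_eq_iff B.M.a_comm)
      qed
      ultimately have "v \<in> boundaries B ?e" by simp
      then obtain w where w: "w \<in> carrier (md B (?e + 1))" "bdry B (?e + 1) w = v"
        by (auto simp: boundaries_def)
      \<comment> \<open>The hypothesis on \<open>V\<close> enters here: \<open>v\<close> lies in
        \<open>V\<close> and is the boundary of \<open>w\<close>, hence also of an element of
        \<open>V\<close>.\<close>
      then obtain v' where "v' \<in> V (?e + 1)" "bdry B (?e + 1) v' = v"
        using conn[of w "?e + 1"] v by (auto simp: add.commute)
      then show ?thesis using g Y(2) eq by blast
    qed
    ultimately show ?thesis
      using Y(1,3,4) by (intro exI[of _ Y]) (auto simp: good_def)
  qed
  \<comment> \<open>\<open>F n\<close> sits in degree \<open>n - 1\<close>, so that the recursion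
    starts from the zero complement in degree -1.\<close>
  obtain F where F: "\<And>n. good (int n - 1) (F n)" and Fb: "\<And>n y. y \<in> F (Suc n) \<Longrightarrow> bdry B (int n) y \<in> F n"
  proof -
    have "\<exists>F. \<forall>n. good (int n - 1) (F n) \<and> (\<forall>y\<in>F (Suc n). bdry B (int n) y \<in> F n)"
    proof (rule dependent_nat_choice)
      show "\<exists>X. good (int 0 - 1) X" using base[of "-1"] by auto
      show "\<exists>Y. good (int (Suc n) - 1) Y \<and> (\<forall>y\<in>Y. bdry B (int n) y \<in> X)" if "good (int n - 1) X" for X n
        using step[OF that] by simp
    qed
    then show ?thesis using that by blast
  qed
  define C where "C d = (if d < 0 then {\<zero>\<^bsub>md B d\<^esub>} else F (nat d + 1))" for d
  have C: "good d (C d)" for d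
    using base[of d] F[of "nat d + 1"] by (auto simp: C_def)
  have "bdry B d x \<in> C (d - 1)" if x: "x \<in> C d" for d x
  proof -
    have Cs: "submodule (C d) R (md B d)" for d using C by (simp add: good_def)
    have "x \<in> carrier (md B d)" using x B.submoduleE(1)[OF Cs] by blast
    then have dx: "bdry B d x \<in> carrier (md B (d - 1))" using lin_maps_closed[OF lin] by blast
    show ?thesis
    \<comment> \<open>For \<open>d \<le> 0\<close> the boundary lands in a negative degree and is
      zero; from \<open>d = 1\<close> on the recursion applies.\<close>
    proof (cases "d < 1")
      case True
      then have "bdry B d x = \<zero>\<^bsub>md B (d - 1)\<^esub>" using chain_complex_negative[OF B, of "d - 1"] dx by auto
      then show ?thesis using zero[OF Cs] by simp
    next
      case False
      then have "int (nat d) = d" "nat (d - 1) + 1 = nat d" by auto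
      then show ?thesis using False x Fb[of x "nat d"] by (auto simp: C_def)
    qed
  qed
  with C show ?thesis using that[of C] by (simp add: good_def)
qed

section \<open>Quasi-isomorphisms\<close>

context
  fixes R :: "'r ring" and A :: "('r, 'a) cx" and B :: "('r, 'b) cx" and f
  assumes A: "chain_complex R A" and B: "chain_complex R B" and f: "cx_map R A B f"
begin

interpretation A: module R "md A d" for d using A by (rule chain_complex_module)
interpretation B: module R "md B d" for d using B by (rule chain_complex_module)

private lemmas lin = cx_map_lin[OF f]
private lemmas closed = lin_maps_closed[OF lin]
private lemmas chain = cx_map_bdry[OF f]
private lemmas bA = boundaries_submodule[OF A]
private lemmas bB = boundaries_submodule[OF B]

lemma cx_map_boundaries: "b \<in> boundaries A d \<Longrightarrow> f d b \<in> boundaries B d"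
  using chain[of _ "d + 1"] closed by (auto simp: boundaries_def image_iff)

text \<open>\<open>homology_map\<close> takes a union over all representatives of a class. These
  differ by boundaries, which \<open>f\<close> carries to boundaries, so each contributes the same
  coset.\<close>

lemma homology_map_coset:
  assumes z: "z \<in> cycles A d"
  shows "homology_map B f d (boundaries A d +>\<^bsub>md A d\<^esub> z) = boundaries B d +>\<^bsub>md B d\<^esub> f d z"
  unfolding homology_map_def
proof (rule SUP_eq_const)
  have zc: "z \<in> carrier (md A d)" using z by (simp add: cycles_def)
  have "\<zero>\<^bsub>md A d\<^esub> \<oplus>\<^bsub>md A d\<^esub> z \<in> boundaries A d +>\<^bsub>md A d\<^esub> z"
    using submodule_zero[OF bA] by (auto simp: a_r_coset_def')
  then show "boundaries A d +>\<^bsub>md A d\<^esub> z \<noteq> {}" by blast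
  fix w assume "w \<in> boundaries A d +>\<^bsub>md A d\<^esub> z"
  then obtain b where b: "b \<in> boundaries A d" and w: "w = b \<oplus>\<^bsub>md A d\<^esub> z"
    by (auto simp: a_r_coset_def')
  have bc: "b \<in> carrier (md A d)" using b A.submoduleE(1)[OF bA] by blast
  have "f d w \<ominus>\<^bsub>md B d\<^esub> f d z = f d b"
    unfolding w lin_maps_add[OF lin bc zc] using closed[OF bc] closed[OF zc] by (simp add: B.M.minus_eq_iff)
  then show "boundaries B d +>\<^bsub>md B d\<^esub> f d w = boundaries B d +>\<^bsub>md B d\<^esub> f d z"
    using coset_eq_iff[OF B.module_axioms bB] cx_map_boundaries[OF b] closed[OF zc] closed[of w] bc zc w by simp
qed

text \<open>Injectivity on homology, applied to the classes of \<open>z\<close> and of zero, which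
  have the same image.\<close>

lemma quasi_iso_boundary:
  assumes q: "quasi_iso A B f" and z: "z \<in> cycles A d" and fz: "f d z \<in> boundaries B d"
  shows "z \<in> boundaries A d"
proof -
  have zc: "z \<in> carrier (md A d)" using z by (simp add: cycles_def)
  have 0: "\<zero>\<^bsub>md A d\<^esub> \<in> cycles A d"
    using lin_maps_zero[OF A.module_axioms A.module_axioms chain_complex_bdry[OF A]] by (simp add: cycles_def)
  have "f d z \<ominus>\<^bsub>md B d\<^esub> f d \<zero>\<^bsub>md A d\<^esub> = f d z"
    using closed[OF zc] lin_maps_zero[OF A.module_axioms B.module_axioms lin] by (simp add: B.M.minus_eq_iff)
  then have "homology_map B f d (boundaries A d +>\<^bsub>md A d\<^esub> z) = homology_map B f d (boundaries A d +>\<^bsub>md A d\<^esub> \<zero>\<^bsub>md A d\<^esub>)"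
    unfolding homology_map_coset[OF z] homology_map_coset[OF 0]
    using coset_eq_iff[OF B.module_axioms bB closed[OF zc] closed[OF A.M.zero_closed]] fz by simp
  then have "boundaries A d +>\<^bsub>md A d\<^esub> z = boundaries A d +>\<^bsub>md A d\<^esub> \<zero>\<^bsub>md A d\<^esub>"
    using q z 0 unfolding quasi_iso_def bij_betw_def homology_def by (meson imageI inj_onD)
  then have "z \<ominus>\<^bsub>md A d\<^esub> \<zero>\<^bsub>md A d\<^esub> \<in> boundaries A d"
    using coset_eq_iff[OF A.module_axioms bA zc A.M.zero_closed] by blast
  moreover have "z \<ominus>\<^bsub>md A d\<^esub> \<zero>\<^bsub>md A d\<^esub> = z" using zc by (simp add: A.M.minus_eq_iff)
  ultimately show ?thesis by simp
qed

text \<open>Surjectivity on homology, unwound from classes to elements by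
  \<open>coset_eq_iff\<close>.\<close>

lemma quasi_iso_cycle:
  assumes q: "quasi_iso A B f" and y: "y \<in> cycles B d"
  obtains z where "z \<in> cycles A d" "f d z \<ominus>\<^bsub>md B d\<^esub> y \<in> boundaries B d"
proof -
  have "boundaries B d +>\<^bsub>md B d\<^esub> y \<in> homology_map B f d ` homology A d"
    using q y unfolding quasi_iso_def bij_betw_def homology_def by blast
  then obtain z where z: "z \<in> cycles A d"
    and eq: "boundaries B d +>\<^bsub>md B d\<^esub> y = homology_map B f d (boundaries A d +>\<^bsub>md A d\<^esub> z)"
    unfolding homology_def by blast
  have "z \<in> carrier (md A d)" "y \<in> carrier (md B d)" using z y by (simp_all add: cycles_def)
  then show ?thesis
    using that[OF z] eq coset_eq_iff[OF B.module_axioms bB closed] unfolding homology_map_coset[OF z] by metis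
qed

text \<open>The image of \<open>f\<close> has a complementary subcomplex because \<open>f\<close> is
  injective on homology: if the boundary of \<open>x\<close> is \<open>f a\<close>, then
  \<open>a\<close> is a cycle whose image is a boundary, so \<open>a\<close> is the boundary of some
  \<open>a'\<close>, and \<open>f a'\<close> has the same boundary as \<open>x\<close>. The
  retraction discards the component in the complement.\<close>

lemma retraction_exists:
  assumes "field R" and q: "quasi_iso A B f" and inj: "\<And>d. inj_on (f d) (carrier (md A d))"
  obtains p where "cx_map R B A p" "\<And>d x. x \<in> carrier (md A d) \<Longrightarrow> p d (f d x) = x"
proof -
  let ?V = "\<lambda>d. f d ` carrier (md A d)"
  have V: "submodule (?V d) R (md B d)" for d
    using A.module_axioms B.module_axioms lin by (rule submodule_image)
  have f0: "a = \<zero>\<^bsub>md A d\<^esub>" if "a \<in> carrier (md A d)" "f d a = \<zero>\<^bsub>md B d\<^esub>" for a d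
    using inj_onD[OF inj, of d a "\<zero>\<^bsub>md A d\<^esub>"] that lin_maps_zero[OF A.module_axioms B.module_axioms lin] by simp
  have conn: "\<exists>v\<in>?V d. bdry B d v = bdry B d x"
    if x: "x \<in> carrier (md B d)" and dx: "bdry B d x \<in> ?V (d - 1)" for d x
  proof -
    obtain a where a: "a \<in> carrier (md A (d - 1))" "bdry B d x = f (d - 1) a" using dx by blast
    have da: "bdry A (d - 1) a \<in> carrier (md A (d - 2))"
      using lin_maps_closed[OF chain_complex_bdry[OF A] a(1)] by simp
    have "f (d - 2) (bdry A (d - 1) a) = \<zero>\<^bsub>md B (d - 2)\<^esub>"
      using chain[OF a(1)] chain_complex_bdry_bdry[OF B x] a(2) by simp
    then have "a \<in> cycles A (d - 1)" using f0[OF da] a by (simp add: cycles_def)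
    moreover have "f (d - 1) a \<in> boundaries B (d - 1)"
      using x by (auto simp: boundaries_def simp flip: a(2))
    ultimately have "a \<in> boundaries A (d - 1)" by (rule quasi_iso_boundary[OF q])
    then obtain a' where a': "a' \<in> carrier (md A d)" "a = bdry A d a'" by (auto simp: boundaries_def)
    then show ?thesis using chain[OF a'(1)] a(2) by auto
  qed
  obtain C where C: "\<And>d. submodule (C d) R (md B d)" "\<And>d x. x \<in> C d \<Longrightarrow> bdry B d x \<in> C (d - 1)"
    "\<And>d. C d \<inter> ?V d \<subseteq> {\<zero>\<^bsub>md B d\<^esub>}"
    and total: "\<And>d x. x \<in> carrier (md B d) \<Longrightarrow> \<exists>c\<in>C d. \<exists>v\<in>?V d. x = c \<oplus>\<^bsub>md B d\<^esub> v"
    using assms(1) B V conn by (rule subcomplex_complement) (assumption+, rule that)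
  note CE = B.submoduleE[OF C(1)]
  have Cc: "c \<in> carrier (md B d)" if "c \<in> C d" for c d using that CE(1) by blast
  \<comment> \<open>The coordinate along the image of \<open>f\<close>. It is unique because
    \<open>C\<close> meets the image in zero and \<open>f\<close> is injective.\<close>
  define p where "p d x = (THE a. a \<in> carrier (md A d) \<and> x \<ominus>\<^bsub>md B d\<^esub> f d a \<in> C d)" for d x
  have p: "p d (c \<oplus>\<^bsub>md B d\<^esub> f d a) = a" if c: "c \<in> C d" and a: "a \<in> carrier (md A d)" for d c a
    unfolding p_def
  proof (rule the_equality)
    have diff: "(c \<oplus>\<^bsub>md B d\<^esub> f d a) \<ominus>\<^bsub>md B d\<^esub> f d b = c \<oplus>\<^bsub>md B d\<^esub> f d (a \<ominus>\<^bsub>md A d\<^esub> b)"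
      if "b \<in> carrier (md A d)" for b
      unfolding lin_maps_minus[OF A.module_axioms B.module_axioms lin a that]
      using Cc[OF c] closed[OF a] closed[OF that] by (simp add: a_minus_def B.M.a_assoc)
    have "a \<ominus>\<^bsub>md A d\<^esub> a = \<zero>\<^bsub>md A d\<^esub>" using a by (simp add: A.M.minus_eq_iff)
    then show "a \<in> carrier (md A d) \<and> (c \<oplus>\<^bsub>md B d\<^esub> f d a) \<ominus>\<^bsub>md B d\<^esub> f d a \<in> C d"
      using a c diff[OF a] Cc[OF c] lin_maps_zero[OF A.module_axioms B.module_axioms lin] by simp
    fix b assume b: "b \<in> carrier (md A d) \<and> (c \<oplus>\<^bsub>md B d\<^esub> f d a) \<ominus>\<^bsub>md B d\<^esub> f d b \<in> C d"
    let ?w = "a \<ominus>\<^bsub>md A d\<^esub> b"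
    have w: "?w \<in> carrier (md A d)" using a b by simp
    have "c \<oplus>\<^bsub>md B d\<^esub> f d ?w \<in> C d" using conjunct2[OF b] unfolding diff[OF conjunct1[OF b]] .
    then have "(c \<oplus>\<^bsub>md B d\<^esub> f d ?w) \<ominus>\<^bsub>md B d\<^esub> c \<in> C d"
      using submodule_minus[OF B.module_axioms C(1)] c by blast
    also have "(c \<oplus>\<^bsub>md B d\<^esub> f d ?w) \<ominus>\<^bsub>md B d\<^esub> c = f d ?w"
      using Cc[OF c] closed[OF w] by (simp add: B.M.minus_eq_iff B.M.a_comm)
    finally have "f d ?w = \<zero>\<^bsub>md B d\<^esub>" using C(3)[of d] w by blast
    then show "b = a" using f0[OF w] a b by (simp add: A.M.minus_eq_iff)
  qed
  have dec: "\<exists>c a. c \<in> C d \<and> a \<in> carrier (md A d) \<and> x = c \<oplus>\<^bsub>md B d\<^esub> f d a"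
    if "x \<in> carrier (md B d)" for d x
    using total[OF that] by blast
  have "cx_map R B A p"
    unfolding cx_map_def
  proof (intro allI conjI ballI)
    fix d
    show "p d \<in> lin_maps R (md B d) (md A d)"
    proof (rule lin_mapsI)
      show "p d x \<in> carrier (md A d)" if "x \<in> carrier (md B d)" for x
        using dec[OF that] p by auto
      show "p d (x \<oplus>\<^bsub>md B d\<^esub> y) = p d x \<oplus>\<^bsub>md A d\<^esub> p d y"
        if xy: "x \<in> carrier (md B d)" "y \<in> carrier (md B d)" for x y
      proof -
        obtain c a where x: "c \<in> C d" "a \<in> carrier (md A d)" "x = c \<oplus>\<^bsub>md B d\<^esub> f d a"
          using dec[OF xy(1)] by blast
        obtain c' a' where y: "c' \<in> C d" "a' \<in> carrier (md A d)" "y = c' \<oplus>\<^bsub>md B d\<^esub> f d a'"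
          using dec[OF xy(2)] by blast
        have "x \<oplus>\<^bsub>md B d\<^esub> y = (c \<oplus>\<^bsub>md B d\<^esub> c') \<oplus>\<^bsub>md B d\<^esub> f d (a \<oplus>\<^bsub>md A d\<^esub> a')"
          unfolding lin_maps_add[OF lin x(2) y(2)] x(3) y(3)
          using Cc[OF x(1)] Cc[OF y(1)] closed[OF x(2)] closed[OF y(2)] by (simp add: B.M.add.m_ac)
        then show ?thesis using p x y CE(5)[OF x(1) y(1)] by simp
      qed
      show "p d (r \<odot>\<^bsub>md B d\<^esub> x) = r \<odot>\<^bsub>md A d\<^esub> p d x"
        if r: "r \<in> carrier R" and xB: "x \<in> carrier (md B d)" for r x
      proof -
        obtain c a where x: "c \<in> C d" "a \<in> carrier (md A d)" "x = c \<oplus>\<^bsub>md B d\<^esub> f d a"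
          using dec[OF xB] by blast
        have "r \<odot>\<^bsub>md B d\<^esub> x = r \<odot>\<^bsub>md B d\<^esub> c \<oplus>\<^bsub>md B d\<^esub> f d (r \<odot>\<^bsub>md A d\<^esub> a)"
          unfolding lin_maps_smult[OF lin r x(2)] x(3)
          using r Cc[OF x(1)] closed[OF x(2)] by (simp add: B.smult_r_distr)
        then show ?thesis using p x CE(4)[OF r x(1)] r by simp
      qed
    qed
    fix x assume "x \<in> carrier (md B d)"
    then obtain c a where x: "c \<in> C d" "a \<in> carrier (md A d)" "x = c \<oplus>\<^bsub>md B d\<^esub> f d a"
      using dec by blast
    \<comment> \<open>Since \<open>C\<close> is a subcomplex, this is again a decomposition into the
      two components, which makes \<open>p\<close> a chain map.\<close>
    have "bdry B d x = bdry B d c \<oplus>\<^bsub>md B (d - 1)\<^esub> f (d - 1) (bdry A d a)"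
      unfolding chain[OF x(2)] x(3) by (rule lin_maps_add[OF chain_complex_bdry[OF B] Cc[OF x(1)] closed[OF x(2)]])
    then show "p (d - 1) (bdry B d x) = bdry A d (p d x)"
      using p[OF x(1,2)] p[OF C(2)[OF x(1)] lin_maps_closed[OF chain_complex_bdry[OF A] x(2)]] x(3) by simp
  qed
  moreover have "p d (f d x) = x" if "x \<in> carrier (md A d)" for d x
    using p[OF submodule_zero[OF C(1)] that] closed[OF that] by simp
  ultimately show ?thesis using that by blast
qed

text \<open>The kernel of \<open>f\<close> has a complementary subcomplex because \<open>f\<close>
  is surjective on homology: if the boundary of \<open>x\<close> lies in the kernel,
  \<open>f x\<close> is a cycle, some cycle \<open>u\<close> satisfies \<open>f u = f x\<close>, and
  \<open>x - u\<close> is an element of the kernel with the same boundary as \<open>x\<close>. The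
  section inverts \<open>f\<close> on the complement.\<close>

lemma section_exists:
  assumes "field R" and q: "quasi_iso A B f" and surj: "\<And>d. f d ` carrier (md A d) = carrier (md B d)"
  obtains s where "cx_map R B A s" "\<And>d y. y \<in> carrier (md B d) \<Longrightarrow> f d (s d y) = y"
proof -
  let ?V = "\<lambda>d. {x \<in> carrier (md A d). f d x \<in> {\<zero>\<^bsub>md B d\<^esub>}}"
  have V: "submodule (?V d) R (md A d)" for d
    using A.module_axioms B.module_axioms lin submodule_zero_mod[OF B.module_axioms] by (rule submodule_vimage)
  have conn: "\<exists>v\<in>?V d. bdry A d v = bdry A d x"
    if x: "x \<in> carrier (md A d)" and dx: "bdry A d x \<in> ?V (d - 1)" for d x
  proof -
    have "f d x \<in> cycles B d" using closed[OF x] chain[OF x] dx by (simp add: cycles_def)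
    then obtain z where z: "z \<in> cycles A d" "f d z \<ominus>\<^bsub>md B d\<^esub> f d x \<in> boundaries B d"
      using quasi_iso_cycle[OF q] by blast
    have zc: "z \<in> carrier (md A d)" "bdry A d z = \<zero>\<^bsub>md A (d - 1)\<^esub>" using z by (simp_all add: cycles_def)
    obtain y where "y \<in> carrier (md B (d + 1))" and y: "f d z \<ominus>\<^bsub>md B d\<^esub> f d x = bdry B (d + 1) y"
      using z(2) by (auto simp: boundaries_def)
    \<comment> \<open>Lifting \<open>y\<close> along \<open>f\<close> and correcting
      \<open>z\<close> by the boundary of the lift keeps \<open>z\<close> a cycle, and turns an
      image homologous to \<open>f x\<close> into one equal to it.\<close>
    then obtain w where w: "w \<in> carrier (md A (d + 1))" "y = f (d + 1) w" using surj by blast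
    let ?b = "bdry A (d + 1) w"
    have b: "?b \<in> carrier (md A d)" "bdry A d ?b = \<zero>\<^bsub>md A (d - 1)\<^esub>"
      using lin_maps_closed[OF chain_complex_bdry[OF A] w(1)] chain_complex_bdry_bdry[OF A w(1)]
      by (simp_all add: algebra_simps)
    let ?u = "z \<ominus>\<^bsub>md A d\<^esub> ?b"
    have u: "?u \<in> carrier (md A d)" "bdry A d ?u = \<zero>\<^bsub>md A (d - 1)\<^esub>"
      using zc b lin_maps_minus[OF A.module_axioms A.module_axioms chain_complex_bdry[OF A] zc(1) b(1)]
      by (simp_all add: A.M.minus_eq_iff)
    have "f d z \<ominus>\<^bsub>md B d\<^esub> f d x = f d ?b" using y w chain[OF w(1)] by simp
    then have "f d z = f d ?b \<oplus>\<^bsub>md B d\<^esub> f d x"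
      using closed[OF zc(1)] closed[OF x] closed[OF b(1)] by (simp add: B.M.minus_eq_iff)
    then have "f d ?u = f d x"
      using lin_maps_minus[OF A.module_axioms B.module_axioms lin zc(1) b(1)]
        closed[OF zc(1)] closed[OF x] closed[OF b(1)] by (simp add: B.M.minus_eq_iff B.M.a_comm)
    then have "f d (x \<ominus>\<^bsub>md A d\<^esub> ?u) = \<zero>\<^bsub>md B d\<^esub>"
      using lin_maps_minus[OF A.module_axioms B.module_axioms lin x u(1)] closed[OF x]
      by (simp add: B.M.minus_eq_iff)
    moreover have "bdry A d (x \<ominus>\<^bsub>md A d\<^esub> ?u) = bdry A d x"
      using lin_maps_minus[OF A.module_axioms A.module_axioms chain_complex_bdry[OF A] x u(1)]
        lin_maps_closed[OF chain_complex_bdry[OF A] x] u(2) by (simp add: A.M.minus_eq_iff)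
    ultimately show ?thesis using x u(1) by (intro bexI[of _ "x \<ominus>\<^bsub>md A d\<^esub> ?u"]) auto
  qed
  obtain C where C: "\<And>d. submodule (C d) R (md A d)" "\<And>d x. x \<in> C d \<Longrightarrow> bdry A d x \<in> C (d - 1)"
    "\<And>d. C d \<inter> ?V d \<subseteq> {\<zero>\<^bsub>md A d\<^esub>}"
    and total: "\<And>d x. x \<in> carrier (md A d) \<Longrightarrow> \<exists>c\<in>C d. \<exists>v\<in>?V d. x = c \<oplus>\<^bsub>md A d\<^esub> v"
    using assms(1) A V conn by (rule subcomplex_complement) (assumption+, rule that)
  note CE = A.submoduleE[OF C(1)]
  have Cc: "c \<in> carrier (md A d)" if "c \<in> C d" for c d using that CE(1) by blast
  \<comment> \<open>The kernel contributes nothing to the image, so \<open>f\<close> maps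
    \<open>C\<close> onto \<open>B\<close>; it does so injectively because \<open>C\<close> meets
    the kernel in zero.\<close>
  define s where "s d y = (THE a. a \<in> C d \<and> f d a = y)" for d y
  have s: "s d (f d a) = a" if a: "a \<in> C d" for d a
    unfolding s_def
  proof (rule the_equality)
    fix b assume b: "b \<in> C d \<and> f d b = f d a"
    have "b \<ominus>\<^bsub>md A d\<^esub> a \<in> C d" using submodule_minus[OF A.module_axioms C(1)] a b by blast
    moreover have "f d (b \<ominus>\<^bsub>md A d\<^esub> a) = \<zero>\<^bsub>md B d\<^esub>"
      using lin_maps_minus[OF A.module_axioms B.module_axioms lin, of b d a] Cc a b closed[of a d]
      by (simp add: B.M.minus_eq_iff)
    ultimately have "b \<ominus>\<^bsub>md A d\<^esub> a = \<zero>\<^bsub>md A d\<^esub>" using C(3)[of d] Cc by blast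
    then show "b = a" using Cc a b by (simp add: A.M.minus_eq_iff)
  qed (use a in simp)
  have dec: "\<exists>a. a \<in> C d \<and> y = f d a" if y: "y \<in> carrier (md B d)" for d y
  proof -
    obtain x where x: "x \<in> carrier (md A d)" "y = f d x" using y surj by blast
    obtain c v where c: "c \<in> C d" and v: "v \<in> carrier (md A d)" "f d v = \<zero>\<^bsub>md B d\<^esub>"
      and "x = c \<oplus>\<^bsub>md A d\<^esub> v" using total[OF x(1)] by blast
    then have "y = f d c" using x lin_maps_add[OF lin Cc[OF c] v(1)] closed[OF Cc[OF c]] by simp
    then show ?thesis using c by blast
  qed
  have "cx_map R B A s"
    unfolding cx_map_def
  proof (intro allI conjI ballI)
    fix d
    show "s d \<in> lin_maps R (md B d) (md A d)"
    proof (rule lin_mapsI)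
      show "s d y \<in> carrier (md A d)" if "y \<in> carrier (md B d)" for y
        using dec[OF that] s Cc by auto
      show "s d (x \<oplus>\<^bsub>md B d\<^esub> y) = s d x \<oplus>\<^bsub>md A d\<^esub> s d y"
        if "x \<in> carrier (md B d)" "y \<in> carrier (md B d)" for x y
        using dec[OF that(1)] dec[OF that(2)] s CE(5) lin_maps_add[OF lin Cc Cc] by metis
      show "s d (r \<odot>\<^bsub>md B d\<^esub> y) = r \<odot>\<^bsub>md A d\<^esub> s d y" if "r \<in> carrier R" "y \<in> carrier (md B d)" for r y
        using dec[OF that(2)] s CE(4)[OF that(1)] lin_maps_smult[OF lin that(1) Cc] by metis
    qed
    show "s (d - 1) (bdry B d y) = bdry A d (s d y)" if "y \<in> carrier (md B d)" for y
      using dec[OF that] s C(2) chain[OF Cc] by metis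
  qed
  moreover have "f d (s d y) = y" if "y \<in> carrier (md B d)" for d y
    using dec[OF that] s by auto
  ultimately show ?thesis using that by blast
qed

end

theorem corollary1p3:
  fixes R :: "'r ring" and A :: "('r, 'a) cx" and B :: "('r, 'b) cx"
    and f :: "int \<Rightarrow> 'a \<Rightarrow> 'b"
  assumes "field R"
    and "\<And>k::nat. 0 < k \<Longrightarrow> [k] \<cdot>\<^bsub>R\<^esub> \<one>\<^bsub>R\<^esub> \<noteq> \<zero>\<^bsub>R\<^esub>"
    and "chain_complex R A" and "chain_complex R B" and "cx_map R A B f"
  shows "(quasi_iso A B f \<and> (\<forall>d. inj_on (f d) (carrier (md A d))) \<longrightarrow>
      (\<forall>\<alpha>. htcft R A \<alpha> \<longrightarrow> (\<exists>\<beta>. htcft R B \<beta> \<and> htcft_hom R A B \<alpha> \<beta> f)))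
    \<and> (quasi_iso A B f \<and> (\<forall>d. f d ` carrier (md A d) = carrier (md B d)) \<longrightarrow>
      (\<forall>\<beta>. htcft R B \<beta> \<longrightarrow> (\<exists>\<alpha>. htcft R A \<alpha> \<and> htcft_hom R A B \<alpha> \<beta> f)))"
proof (intro conjI impI allI; elim conjE)
  fix \<alpha> assume "quasi_iso A B f" "\<forall>d. inj_on (f d) (carrier (md A d))" and \<alpha>: "htcft R A \<alpha>"
  then obtain p where "cx_map R B A p" "\<And>d x. x \<in> carrier (md A d) \<Longrightarrow> p d (f d x) = x"
    using retraction_exists[OF assms(3,4,5,1)] by blast
  \<comment> \<open>\<open>f\<close> takes the place of \<open>i\<close>, and the first of the two
    morphisms obtained is the required one.\<close>
  then show "\<exists>\<beta>. htcft R B \<beta> \<and> htcft_hom R A B \<alpha> \<beta> f"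
    using prop_algebra_transfer[OF assms(3,4,5)] \<alpha> unfolding htcft_def htcft_hom_def by metis
next
  fix \<beta> assume "quasi_iso A B f" "\<forall>d. f d ` carrier (md A d) = carrier (md B d)" and \<beta>: "htcft R B \<beta>"
  then obtain s where "cx_map R B A s" "\<And>d y. y \<in> carrier (md B d) \<Longrightarrow> f d (s d y) = y"
    using section_exists[OF assms(3,4,5,1)] by blast
  \<comment> \<open>The complexes exchange roles: the section is \<open>i\<close>, \<open>f\<close>
    is \<open>p\<close>, and the second of the two morphisms is the required one.\<close>
  then show "\<exists>\<alpha>. htcft R A \<alpha> \<and> htcft_hom R A B \<alpha> \<beta> f"
    using prop_algebra_transfer[OF assms(4,3) _ assms(5)] \<beta> unfolding htcft_def htcft_hom_def by metis
qed

end
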